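(* Let $1\le k<m$, let $\alpha_1,\dots,\alpha_m$ be pairwise linearly independent linear forms on $\mathbb{C}^2$, and let $H_s=\{p\in\mathbb{C}^2:\alpha_s(p)=0\}$. Assume that $\beta_1,\dots,\beta_k\in\mathbb{Z}$ and $\beta_{k+1},\dots,\beta_m\in\mathbb{C}\setminus\mathbb{Z}$, and put $\beta=(\beta_1,\dots,\beta_m)$. (i) If $\sum_{i=1}^m\beta_i\in\mathbb{C}\setminus\mathbb{Z}$, then $c(M_\alpha^\beta)=k+1$. Among the decomposition factors of $M_\alpha^\beta$ there is one with support the whole space $\mathbb{C}^2$, one with support $H_s$ for each $s=1,\dots,k$, and none with support at the origin. (ii) If $\sum_{i=1}^m\beta_i\in\mathbb{Z}$, then $m-k\ge 2$ and $c(M_\alpha^\beta)=m+k-1$. Among the decomposition factors of $M_\alpha^\beta$ there is one with support the whole space $\mathbb{C}^2$, one with support $H_s$ for each $s=1,\dots,k$, and $m-2$ with support at the origin.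
   Context: $A_2=\mathbb{C}\langle x,y,\partial_x,\partial_y\rangle$ is the second Weyl algebra (over $\mathbb{C}$). Put $\alpha=\prod_{i=1}^m\alpha_i$ and let $\mathbb{C}[x,y]_\alpha$ be the localization of $\mathbb{C}[x,y]$ at $\alpha$. The module $M_\alpha^\beta$ is the free rank 1 $\mathbb{C}[x,y]_\alpha$-module on a generator written $\alpha^\beta$ (thought of as the multivalued function $\alpha_1^{\beta_1}\cdots\alpha_m^{\beta_m}$), made into a left $A_2$-module by $$\partial\,\alpha^\beta=\sum_{i=1}^m\frac{\beta_i\,\partial(\alpha_i)}{\alpha_i}\,\alpha^\beta,\qquad \partial\in\{\partial_x,\partial_y\},$$ extended to all of $M_\alpha^\beta$ by the Leibniz rule. For a module $M$ of finite length with composition series $0=M_0\subset M_1\subset\dots\subset M_r=M$, the decomposition factors are the simple quotients $M_i/M_{i-1}$ (counted with multiplicity) and $c(M)=r$ is their number. The module $M_\alpha^\beta$ is holonomic, hence of finite length. The support of a decomposition factor is its support as a $\mathbb{C}[x,y]$-module, viewed as a closed subset of $\mathbb{C}^2$. *)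

theory Defs
  imports
    "HOL-Library.Poly_Mapping"
    "HOL-Algebra.Algebraic_Closure_Type"
begin

hide_const (open) Polynomials.degree UnivPoly.coeff UnivPoly.monom

section \<open>Left modules over a (noncommutative) ring\<close>

text \<open>The locale \<^locale>\<open>module\<close> of the library requires a commutative ring of scalars. The
  multiplicative part of the \<^typ>\<open>('a, 'b) module\<close> record is irrelevant for modules.\<close>

locale left_module = R?: ring R + M?: abelian_group M for R :: "('r, 's) ring_scheme" (structure)
    and M :: "('r, 'a) module" (structure) +
  assumes smult_closed:
      "\<lbrakk>a \<in> carrier R; x \<in> carrier M\<rbrakk> \<Longrightarrow> a \<odot>\<^bsub>M\<^esub> x \<in> carrier M"
    and smult_l_distr:
      "\<lbrakk>a \<in> carrier R; b \<in> carrier R; x \<in> carrier M\<rbrakk> \<Longrightarrow>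
        (a \<oplus> b) \<odot>\<^bsub>M\<^esub> x = a \<odot>\<^bsub>M\<^esub> x \<oplus>\<^bsub>M\<^esub> b \<odot>\<^bsub>M\<^esub> x"
    and smult_r_distr:
      "\<lbrakk>a \<in> carrier R; x \<in> carrier M; y \<in> carrier M\<rbrakk> \<Longrightarrow>
        a \<odot>\<^bsub>M\<^esub> (x \<oplus>\<^bsub>M\<^esub> y) = a \<odot>\<^bsub>M\<^esub> x \<oplus>\<^bsub>M\<^esub> a \<odot>\<^bsub>M\<^esub> y"
    and smult_assoc1:
      "\<lbrakk>a \<in> carrier R; b \<in> carrier R; x \<in> carrier M\<rbrakk> \<Longrightarrow>
        (a \<otimes> b) \<odot>\<^bsub>M\<^esub> x = a \<odot>\<^bsub>M\<^esub> (b \<odot>\<^bsub>M\<^esub> x)"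
    and smult_one: "x \<in> carrier M \<Longrightarrow> \<one> \<odot>\<^bsub>M\<^esub> x = x"

definition quot_module :: "('r, 'a) module \<Rightarrow> 'a set \<Rightarrow> ('r, 'a set) module" where
  "quot_module M N =
    \<lparr>carrier = a_rcosets\<^bsub>M\<^esub> N, monoid.mult = undefined, one = undefined,
     ring.zero = N, add = set_add M, module.smult = (\<lambda>r U. \<Union>x\<in>U. N +>\<^bsub>M\<^esub> (r \<odot>\<^bsub>M\<^esub> x))\<rparr>"

definition simple_module :: "('r, 'm) ring_scheme \<Rightarrow> ('r, 'a) module \<Rightarrow> bool" where
  "simple_module R M \<longleftrightarrow>
    carrier M \<noteq> {\<zero>\<^bsub>M\<^esub>} \<and>
    (\<forall>N. submodule N R M \<longrightarrow> N = {\<zero>\<^bsub>M\<^esub>} \<or> N = carrier M)"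

text \<open>\<open>factor M C i\<close> is the subquotient \<open>C (i + 1) / C i\<close>.\<close>

definition factor :: "('r, 'a) module \<Rightarrow> (nat \<Rightarrow> 'a set) \<Rightarrow> nat \<Rightarrow> ('r, 'a set) module" where
  "factor M C i = quot_module (M\<lparr>carrier := C (Suc i)\<rparr>) (C i)"

definition composition_series ::
    "('r, 'm) ring_scheme \<Rightarrow> ('r, 'a) module \<Rightarrow> (nat \<Rightarrow> 'a set) \<Rightarrow> nat \<Rightarrow> bool" where
  "composition_series R M C r \<longleftrightarrow>
    C 0 = {\<zero>\<^bsub>M\<^esub>} \<and> C r = carrier M \<and>
    (\<forall>i\<le>r. submodule (C i) R M) \<and>
    (\<forall>i<r. C i \<subset> C (Suc i) \<and> simple_module R (factor M C i))"

definition finite_length :: "('r, 'm) ring_scheme \<Rightarrow> ('r, 'a) module \<Rightarrow> bool" where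
  "finite_length R M \<longleftrightarrow> (\<exists>C r. composition_series R M C r)"

text \<open>The number \<open>c(M)\<close>; the description is proper by the Jordan--Hoelder theorem.\<close>

definition num_factors :: "('r, 'm) ring_scheme \<Rightarrow> ('r, 'a) module \<Rightarrow> nat" where
  "num_factors R M = (THE r. \<exists>C. composition_series R M C r)"


section \<open>Polynomials and rational functions in two variables\<close>

text \<open>In \<^typ>\<open>complex poly poly\<close> the inner variable is \<open>x\<close> and the outer variable is \<open>y\<close>.\<close>

type_synonym poly_xy = "complex poly poly"
type_synonym ratfun_xy = "poly_xy fract"

definition var_x :: poly_xy where "var_x = [:[:0, 1:]:]"
definition var_y :: poly_xy where "var_y = [:0, 1:]"
definition const_xy :: "complex \<Rightarrow> poly_xy" where "const_xy c = [:[:c:]:]"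

definition eval_xy :: "poly_xy \<Rightarrow> complex \<times> complex \<Rightarrow> complex" where
  "eval_xy f p = poly (poly f [:snd p:]) (fst p)"

definition linear_form :: "poly_xy \<Rightarrow> bool" where
  "linear_form f \<longleftrightarrow> (\<exists>a b. f = const_xy a * var_x + const_xy b * var_y)"

definition lin_indep2 :: "poly_xy \<Rightarrow> poly_xy \<Rightarrow> bool" where
  "lin_indep2 f g \<longleftrightarrow> (\<forall>a b. const_xy a * f + const_xy b * g = 0 \<longrightarrow> a = 0 \<and> b = 0)"

definition zero_set :: "poly_xy \<Rightarrow> (complex \<times> complex) set" where
  "zero_set f = {p. eval_xy f p = 0}"

abbreviation poly_dx :: "poly_xy \<Rightarrow> poly_xy" where "poly_dx \<equiv> map_poly pderiv"
abbreviation poly_dy :: "poly_xy \<Rightarrow> poly_xy" where "poly_dy \<equiv> pderiv"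

definition is_derivation :: "('a::comm_ring_1 \<Rightarrow> 'a) \<Rightarrow> bool" where
  "is_derivation D \<longleftrightarrow>
    (\<forall>a b. D (a + b) = D a + D b) \<and> (\<forall>a b. D (a * b) = D a * b + a * D b)"

text \<open>The extension of a derivation to the fraction field by the quotient rule.\<close>

definition fract_deriv :: "('a::idom \<Rightarrow> 'a) \<Rightarrow> 'a fract \<Rightarrow> 'a fract" where
  "fract_deriv D q =
    (THE r. \<exists>a b. b \<noteq> 0 \<and> q = Fract a b \<and> r = Fract (D a * b - a * D b) (b * b))"

definition localization :: "'a::idom \<Rightarrow> 'a fract set" where
  "localization f = {Fract g (f ^ n) | g n. True}"


section \<open>The second Weyl algebra\<close>

datatype 'g free_word = Word (letters: "'g list")

text \<open>Elements of the free monoid; the ``sum'' of two words is their concatenation, so that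
  \<^typ>\<open>'g free_word \<Rightarrow>\<^sub>0 complex\<close> with its convolution product is the free
  \<open>\<complex>\<close>-algebra on the letters \<^typ>\<open>'g\<close>.\<close>

instantiation free_word :: (type) monoid_add
begin
definition zero_free_word :: "'a free_word" where "0 = Word []"
definition plus_free_word :: "'a free_word \<Rightarrow> 'a free_word \<Rightarrow> 'a free_word" where
  "u + v = Word (letters u @ letters v)"
instance
  by standard (simp_all add: zero_free_word_def plus_free_word_def)
end

datatype weyl_gen = GX | GY | GDx | GDy

type_synonym weyl_free = "weyl_gen free_word \<Rightarrow>\<^sub>0 complex"

abbreviation gen :: "weyl_gen \<Rightarrow> weyl_free" where
  "gen g \<equiv> Poly_Mapping.single (Word [g]) 1"

abbreviation commutator :: "'a::ring \<Rightarrow> 'a \<Rightarrow> 'a" where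
  "commutator u v \<equiv> u * v - v * u"

definition weyl_relations :: "weyl_free set" where
  "weyl_relations =
    {commutator (gen GX) (gen GY), commutator (gen GDx) (gen GDy),
     commutator (gen GDx) (gen GX) - 1, commutator (gen GDy) (gen GY) - 1,
     commutator (gen GDx) (gen GY), commutator (gen GDy) (gen GX)}"

abbreviation free_ring :: "weyl_free ring" where
  "free_ring \<equiv> ring_of_type_algebra"

definition weyl_ideal :: "weyl_free set" where
  "weyl_ideal = Idl\<^bsub>free_ring\<^esub> weyl_relations"

definition A2 :: "weyl_free set ring" where
  "A2 = free_ring Quot weyl_ideal"

abbreviation weyl_class :: "weyl_free \<Rightarrow> weyl_free set" where
  "weyl_class u \<equiv> weyl_ideal +>\<^bsub>free_ring\<^esub> u"

text \<open>The inclusion of \<open>\<complex>[x, y]\<close> into \<open>A2\<close>.\<close>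

definition poly_to_weyl :: "poly_xy \<Rightarrow> weyl_free set" where
  "poly_to_weyl f = weyl_class
    (\<Sum>j\<le>degree f. \<Sum>i\<le>degree (coeff f j).
      Poly_Mapping.single (Word (replicate i GX @ replicate j GY)) (coeff (coeff f j) i))"


section \<open>Supports\<close>

text \<open>Restriction of scalars from \<open>A2\<close> to \<open>\<complex>[x, y]\<close>.\<close>

definition poly_restrict :: "(weyl_free set, 'a) module \<Rightarrow> (poly_xy, 'a) module" where
  "poly_restrict N =
    \<lparr>carrier = carrier N, monoid.mult = monoid.mult N, one = one N, ring.zero = ring.zero N, add = add N,
     module.smult = (\<lambda>f n. poly_to_weyl f \<odot>\<^bsub>N\<^esub> n)\<rparr>"

text \<open>The localization of a \<open>\<complex>[x, y]\<close>-module \<open>N\<close> at the maximal ideal of a point \<open>p\<close>, as the set of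
  fractions \<open>n/s\<close> with \<open>s(p) \<noteq> 0\<close>.\<close>

definition denominators :: "complex \<times> complex \<Rightarrow> poly_xy set" where
  "denominators p = {s. eval_xy s p \<noteq> 0}"

definition frac_rel ::
    "(poly_xy, 'a) module \<Rightarrow> complex \<times> complex \<Rightarrow> (('a \<times> poly_xy) \<times> ('a \<times> poly_xy)) set" where
  "frac_rel N p =
    {((n, s), (n', s')). n \<in> carrier N \<and> n' \<in> carrier N \<and>
      s \<in> denominators p \<and> s' \<in> denominators p \<and>
      (\<exists>u\<in>denominators p. u \<odot>\<^bsub>N\<^esub> (s' \<odot>\<^bsub>N\<^esub> n) = u \<odot>\<^bsub>N\<^esub> (s \<odot>\<^bsub>N\<^esub> n'))}"

definition stalk ::
    "(poly_xy, 'a) module \<Rightarrow> complex \<times> complex \<Rightarrow> ('a \<times> poly_xy) set set" where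
  "stalk N p = (carrier N \<times> denominators p) // frac_rel N p"

definition support :: "(weyl_free set, 'a) module \<Rightarrow> (complex \<times> complex) set" where
  "support M = (let N = poly_restrict M in {p. stalk N p \<noteq> {frac_rel N p `` {(\<zero>\<^bsub>N\<^esub>, 1)}}})"

definition num_factors_with_support ::
    "(weyl_free set, 'a) module \<Rightarrow> (nat \<Rightarrow> 'a set) \<Rightarrow> nat \<Rightarrow> (complex \<times> complex) set \<Rightarrow> nat" where
  "num_factors_with_support M C r Z = card {i. i < r \<and> support (factor M C i) = Z}"


section \<open>The module \<open>M\<^sub>\<alpha>\<^sup>\<beta>\<close>\<close>

text \<open>The element \<open>f \<alpha>\<^sup>\<beta>\<close> of the free module of rank one is represented by its coefficient
  \<open>f \<in> \<complex>[x, y]\<^sub>\<alpha>\<close>. In particular \<open>\<partial>(f \<alpha>\<^sup>\<beta>) = (\<partial>f + f (\<Sum>i. \<beta>\<^sub>i \<partial>(\<alpha>\<^sub>i) / \<alpha>\<^sub>i)) \<alpha>\<^sup>\<beta>\<close> by the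
  Leibniz rule.\<close>

definition twisted_deriv ::
    "nat \<Rightarrow> (nat \<Rightarrow> poly_xy) \<Rightarrow> (nat \<Rightarrow> complex) \<Rightarrow> (poly_xy \<Rightarrow> poly_xy) \<Rightarrow> ratfun_xy \<Rightarrow> ratfun_xy"
where
  "twisted_deriv m \<alpha> \<beta> D f =
    fract_deriv D f + f * (\<Sum>i=1..m. Fract (const_xy (\<beta> i) * D (\<alpha> i)) (\<alpha> i))"

primrec gen_act ::
    "nat \<Rightarrow> (nat \<Rightarrow> poly_xy) \<Rightarrow> (nat \<Rightarrow> complex) \<Rightarrow> weyl_gen \<Rightarrow> ratfun_xy \<Rightarrow> ratfun_xy" where
  "gen_act m \<alpha> \<beta> GX = (\<lambda>f. Fract var_x 1 * f)"
| "gen_act m \<alpha> \<beta> GY = (\<lambda>f. Fract var_y 1 * f)"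
| "gen_act m \<alpha> \<beta> GDx = twisted_deriv m \<alpha> \<beta> poly_dx"
| "gen_act m \<alpha> \<beta> GDy = twisted_deriv m \<alpha> \<beta> poly_dy"

definition free_act ::
    "nat \<Rightarrow> (nat \<Rightarrow> poly_xy) \<Rightarrow> (nat \<Rightarrow> complex) \<Rightarrow> weyl_free \<Rightarrow> ratfun_xy \<Rightarrow> ratfun_xy" where
  "free_act m \<alpha> \<beta> u f =
    (\<Sum>w\<in>Poly_Mapping.keys u.
      Fract (const_xy (Poly_Mapping.lookup u w)) 1 * foldr (gen_act m \<alpha> \<beta>) (letters w) f)"

text \<open>The action of a class in \<open>A2\<close> does not depend on the chosen representative, see
  \<open>M_mod_smult\<close>.\<close>

definition M_mod ::
    "nat \<Rightarrow> (nat \<Rightarrow> poly_xy) \<Rightarrow> (nat \<Rightarrow> complex) \<Rightarrow> (weyl_free set, ratfun_xy) module" where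
  "M_mod m \<alpha> \<beta> =
    \<lparr>carrier = localization (\<Prod>i=1..m. \<alpha> i), monoid.mult = undefined, one = undefined,
     ring.zero = 0, add = (+), module.smult = (\<lambda>P f. free_act m \<alpha> \<beta> (SOME u. u \<in> P) f)\<rparr>"

section \<open>The \<open>A2\<close>-action on \<open>M\<^sub>\<alpha>\<^sup>\<beta>\<close> is well defined\<close>

text \<open>The main results are that \<open>M_mod\<close> is a
  left \<open>A2\<close>-module (\<open>left_module_M_mod\<close>), on which \<open>\<complex>[x, y]\<close> acts by multiplication
  (\<open>poly_to_weyl_act\<close>).\<close>


lemma is_derivation_dy: "is_derivation poly_dy"
  by (simp add: is_derivation_def pderiv_add pderiv_mult algebra_simps)

lemma coeff_dx: "coeff (poly_dx f) n = pderiv (coeff f n)"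
  by (simp add: coeff_map_poly)

lemma pderiv_sum': "pderiv (\<Sum>i\<in>A. f i) = (\<Sum>i\<in>A. pderiv (f i))"
  by (induction A rule: infinite_finite_induct) (auto simp: pderiv_add)

lemma is_derivation_dx: "is_derivation poly_dx"
proof -
  have "poly_dx (p * q) = poly_dx p * q + p * poly_dx q" for p q
  proof (rule poly_eqI)
    fix n
    have "coeff (poly_dx (p * q)) n =
      (\<Sum>i\<le>n. coeff p i * pderiv (coeff q (n - i)) + pderiv (coeff p i) * coeff q (n - i))"
      by (simp add: coeff_dx coeff_mult pderiv_sum' pderiv_mult mult.commute)
    then show "coeff (poly_dx (p * q)) n = coeff (poly_dx p * q + p * poly_dx q) n"
      by (simp add: coeff_dx coeff_mult sum.distrib)
  qed
  moreover have "poly_dx (p + q) = poly_dx p + poly_dx q" for p q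
    by (rule poly_eqI) (simp add: coeff_dx pderiv_add)
  ultimately show ?thesis by (simp add: is_derivation_def)
qed

lemma dx_dy_commute: "poly_dx (poly_dy f) = poly_dy (poly_dx f)"
  by (simp add: poly_eq_iff coeff_dx coeff_pderiv pderiv_mult pderiv_add)

lemma pderiv_const_values:
  "poly_dx (const_xy c) = 0" "poly_dy (const_xy c) = 0"
  "poly_dx var_x = 1" "poly_dy var_x = 0" "poly_dx var_y = 0" "poly_dy var_y = 1"
  by (simp_all add: const_xy_def var_x_def var_y_def map_poly_pCons one_pCons pderiv_pCons)

lemma derivationD:
  assumes "is_derivation D"
  shows "D (a + b) = D a + D b" "D (a * b) = D a * b + a * D b" "D 0 = 0" "D 1 = 0" "D (- a) = - D a"
proof -
  show 1: "D (a + b) = D a + D b" for a b using assms by (simp add: is_derivation_def)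
  show 2: "D (a * b) = D a * b + a * D b" for a b using assms by (simp add: is_derivation_def)
  show 3: "D 0 = 0" using 1[of 0 0] by simp
  show "D 1 = 0" using 2[of 1 1] by simp
  show "D (- a) = - D a" using 1[of a "- a"] 3 by (simp add: eq_neg_iff_add_eq_0 add.commute)
qed

lemma fract_deriv_Fract:
  fixes a b :: "'a::idom"
  assumes "is_derivation D" "b \<noteq> 0"
  shows "fract_deriv D (Fract a b) = Fract (D a * b - a * D b) (b * b)"
  unfolding fract_deriv_def
proof (rule the_equality)
  show "\<exists>a' b'. b' \<noteq> 0 \<and> Fract a b = Fract a' b' \<and>
     Fract (D a * b - a * D b) (b * b) = Fract (D a' * b' - a' * D b') (b' * b')"
    using assms by blast
next
  fix r assume "\<exists>a' b'. b' \<noteq> 0 \<and> Fract a b = Fract a' b' \<and> r = Fract (D a' * b' - a' * D b') (b' * b')"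
  then obtain a' b' where 1: "b' \<noteq> 0" "Fract a b = Fract a' b'"
     "r = Fract (D a' * b' - a' * D b') (b' * b')" by blast
  then have 2: "a * b' = a' * b" using assms(2) by (simp add: eq_fract)
  then have "D (a * b') = D (a' * b)" by simp
  then have 3: "D a * b' + a * D b' = D a' * b + a' * D b"
    using derivationD[OF assms(1)] by simp
  have "(D a' * b' - a' * D b') * (b * b) = (D a * b - a * D b) * (b' * b')"
  proof -
    have "(D a' * b' - a' * D b') * (b * b) = D a' * b * (b' * b) - (a' * b) * D b' * b"
      by (simp add: algebra_simps)
    also have "\<dots> = (D a * b' + a * D b' - a' * D b) * (b' * b) - (a * b') * D b' * b"
      using 2 3 by simp
    also have "\<dots> = D a * b' * b' * b - (a' * b) * D b * b'"
      by (simp add: algebra_simps)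
    also have "\<dots> = (D a * b - a * D b) * (b' * b')" 
      unfolding 2[symmetric] by (simp add: algebra_simps)
    finally show ?thesis .
  qed
  then show "r = Fract (D a * b - a * D b) (b * b)"
    using 1 assms(2) by (simp add: eq_fract)
qed

lemma is_derivation_fract_deriv:
  fixes D :: "'a::idom \<Rightarrow> 'a"
  assumes D: "is_derivation D"
  shows "is_derivation (fract_deriv D)"
  unfolding is_derivation_def
proof safe
  fix p q :: "'a fract"
  obtain a b c d where [simp]: "p = Fract a b" "b \<noteq> 0" "q = Fract c d" "d \<noteq> 0"
    by (metis Fract_cases)
  show "fract_deriv D (p + q) = fract_deriv D p + fract_deriv D q"
    by (simp add: fract_deriv_Fract[OF D] derivationD[OF D] eq_fract algebra_simps)
  show "fract_deriv D (p * q) = fract_deriv D p * q + p * fract_deriv D q"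
    by (simp add: fract_deriv_Fract[OF D] derivationD[OF D] eq_fract algebra_simps)
qed

lemma fract_deriv_commute:
  fixes D E :: "'a::idom \<Rightarrow> 'a"
  assumes D: "is_derivation D" and E: "is_derivation E" and c: "\<And>f. D (E f) = E (D f)"
  shows "fract_deriv D (fract_deriv E p) = fract_deriv E (fract_deriv D p)"
proof -
  obtain a b where [simp]: "p = Fract a b" "b \<noteq> 0"
    by (metis Fract_cases)
  have m: "D (u - v) = D u - D v" "E (u - v) = E u - E v" for u v
    using derivationD(1)[OF D, of "u - v" v] derivationD(1)[OF E, of "u - v" v] by simp_all
  show ?thesis
    by (simp add: fract_deriv_Fract[OF D] fract_deriv_Fract[OF E] derivationD[OF D] derivationD[OF E]
        eq_fract m c algebra_simps)
qed

lemma log_deriv_commute: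
  assumes D: "is_derivation D" and E: "is_derivation E" and c: "\<And>f. D (E f) = E (D f)"
    and k: "D k = 0" "E k = 0"
  shows "fract_deriv D (Fract (k * E a) (a::'a::idom)) = fract_deriv E (Fract (k * D a) a)"
proof (cases "a = 0")
  case True
  then show ?thesis by (simp add: eq_fract(2) fract_deriv_Fract[OF D] fract_deriv_Fract[OF E] derivationD[OF D] derivationD[OF E])
next
  case False
  then show ?thesis
    by (simp add: fract_deriv_Fract[OF D] fract_deriv_Fract[OF E] derivationD[OF D] derivationD[OF E] c k
        eq_fract algebra_simps)
qed

lemma derivation_sum: "is_derivation D \<Longrightarrow> D (\<Sum>i\<in>A. f i) = (\<Sum>i\<in>A. D (f i))"
  by (induction A rule: infinite_finite_induct) (auto simp: derivationD)

lemmas fract_der = derivationD[OF is_derivation_fract_deriv]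

lemma twisted_deriv_add:
  "is_derivation D \<Longrightarrow> twisted_deriv m \<alpha> \<beta> D (f + g) = twisted_deriv m \<alpha> \<beta> D f + twisted_deriv m \<alpha> \<beta> D g"
  by (simp add: twisted_deriv_def fract_der algebra_simps)

lemma twisted_deriv_mult:
  "is_derivation D \<Longrightarrow> twisted_deriv m \<alpha> \<beta> D (Fract g 1 * f) = Fract (D g) 1 * f + Fract g 1 * twisted_deriv m \<alpha> \<beta> D f"
  by (simp add: twisted_deriv_def fract_der fract_deriv_Fract derivationD algebra_simps)

lemma twisted_deriv_commute:
  "twisted_deriv m \<alpha> \<beta> poly_dx (twisted_deriv m \<alpha> \<beta> poly_dy f) =
   twisted_deriv m \<alpha> \<beta> poly_dy (twisted_deriv m \<alpha> \<beta> poly_dx f)"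
proof -
  note d = is_derivation_dx is_derivation_dy
  have "fract_deriv poly_dx (\<Sum>i=1..m. Fract (const_xy (\<beta> i) * poly_dy (\<alpha> i)) (\<alpha> i)) =
     fract_deriv poly_dy (\<Sum>i=1..m. Fract (const_xy (\<beta> i) * poly_dx (\<alpha> i)) (\<alpha> i))"
    by (simp add: derivation_sum[OF is_derivation_fract_deriv] d pderiv_const_values
       log_deriv_commute[OF d(1) d(2) dx_dy_commute])
  then show ?thesis
    by (simp add: twisted_deriv_def fract_der d fract_deriv_commute[OF d(1) d(2) dx_dy_commute] algebra_simps)
qed

lemma gen_act_add: "gen_act m \<alpha> \<beta> g (p + q) = gen_act m \<alpha> \<beta> g p + gen_act m \<alpha> \<beta> g q"
  by (cases g) (simp_all add: twisted_deriv_add is_derivation_dx is_derivation_dy algebra_simps)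

lemma gen_act_const:
  "gen_act m \<alpha> \<beta> g (Fract (const_xy c) 1 * q) = Fract (const_xy c) 1 * gen_act m \<alpha> \<beta> g q"
  by (cases g) (simp_all add: twisted_deriv_mult is_derivation_dx is_derivation_dy pderiv_const_values
     Zero_fract_def[symmetric] mult.left_commute)

lemma gen_act_0: "gen_act m \<alpha> \<beta> g 0 = 0"
  using gen_act_add[of m \<alpha> \<beta> g 0 0] by (metis add.right_neutral add_cancel_right_right)

lemma word_act_add: "foldr (gen_act m \<alpha> \<beta>) w (p + q) = foldr (gen_act m \<alpha> \<beta>) w p + foldr (gen_act m \<alpha> \<beta>) w q"
  by (induction w) (simp_all add: gen_act_add)
lemma word_act_0: "foldr (gen_act m \<alpha> \<beta>) w 0 = 0"
  by (induction w) (simp_all add: gen_act_0)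
lemma word_act_const: "foldr (gen_act m \<alpha> \<beta>) w (Fract (const_xy c) 1 * q) = Fract (const_xy c) 1 * foldr (gen_act m \<alpha> \<beta>) w q"
  by (induction w) (simp_all add: gen_act_const)
lemma word_act_sum: "foldr (gen_act m \<alpha> \<beta>) w (\<Sum>i\<in>A. f i) = (\<Sum>i\<in>A. foldr (gen_act m \<alpha> \<beta>) w (f i))"
  by (induction A rule: infinite_finite_induct) (simp_all add: word_act_add word_act_0)

lemma const_arith: "Fract (const_xy (a + b)) 1 = Fract (const_xy a) 1 + Fract (const_xy b) 1"
  "Fract (const_xy (a * b)) 1 = Fract (const_xy a) 1 * Fract (const_xy b) 1"
  "Fract (const_xy 0) 1 = 0" "Fract (const_xy 1) 1 = 1"
  by (simp_all add: const_xy_def Zero_fract_def One_fract_def one_pCons)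

lemma free_act_superset:
  assumes "finite S" "Poly_Mapping.keys u \<subseteq> S"
  shows "free_act m \<alpha> \<beta> u f = (\<Sum>w\<in>S. Fract (const_xy (Poly_Mapping.lookup u w)) 1 * foldr (gen_act m \<alpha> \<beta>) (letters w) f)"
  unfolding free_act_def
  by (rule sum.mono_neutral_left) (use assms in \<open>auto simp: in_keys_iff const_arith\<close>)

lemma free_act_plus: "free_act m \<alpha> \<beta> (u + v) f = free_act m \<alpha> \<beta> u f + free_act m \<alpha> \<beta> v f"
proof -
  let ?S = "Poly_Mapping.keys u \<union> Poly_Mapping.keys v"
  show ?thesis
    using free_act_superset[of ?S u m \<alpha> \<beta> f] free_act_superset[of ?S v m \<alpha> \<beta> f]
      free_act_superset[of ?S "u+v" m \<alpha> \<beta> f] Poly_Mapping.keys_add[of u v]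
    by (simp add: lookup_add const_arith distrib_right sum.distrib del: add_fract)
qed

lemma free_act_single: "free_act m \<alpha> \<beta> (Poly_Mapping.single w c) f =
   Fract (const_xy c) 1 * foldr (gen_act m \<alpha> \<beta>) (letters w) f"
  using free_act_superset[of "{w}" "Poly_Mapping.single w c"] by simp

lemma free_act_zero: "free_act m \<alpha> \<beta> 0 f = 0" by (simp add: free_act_def)
lemma free_act_uminus: "free_act m \<alpha> \<beta> (- u) f = - free_act m \<alpha> \<beta> u f"
  using free_act_plus[of m \<alpha> \<beta> u "-u" f] by (simp add: free_act_zero eq_neg_iff_add_eq_0 add.commute)
lemma free_act_minus: "free_act m \<alpha> \<beta> (u - v) f = free_act m \<alpha> \<beta> u f - free_act m \<alpha> \<beta> v f"
  using free_act_plus[of m \<alpha> \<beta> u "-v" f] by (simp add: free_act_uminus)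

lemma free_act_one: "free_act m \<alpha> \<beta> 1 f = f"
  by (simp flip: single_one add: free_act_single zero_free_word_def const_arith)

lemma free_act_add_right: "free_act m \<alpha> \<beta> u (f + g) = free_act m \<alpha> \<beta> u f + free_act m \<alpha> \<beta> u g"
  by (simp add: free_act_def word_act_add algebra_simps sum.distrib)
lemma free_act_zero_right: "free_act m \<alpha> \<beta> u 0 = 0"
  by (simp add: free_act_def word_act_0)

lemma poly_mapping_single_induct [case_names zero plus]:
  assumes "P 0" "\<And>w c u. P u \<Longrightarrow> P (Poly_Mapping.single w c + u)"
  shows "P (u :: 'a \<Rightarrow>\<^sub>0 'b::monoid_add)"
proof (induction u rule: update_induct)
  case const then show ?case using assms(1) by (metis (no_types) single_zero zero_poly_mapping_def)
next
  case (update f a b)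
  have "Poly_Mapping.update a b f = Poly_Mapping.single a b + f"
    by (rule poly_mapping_eqI) (use update in \<open>auto simp: lookup_update lookup_add lookup_single when_def in_keys_iff\<close>)
  then show ?case using assms(2) update by simp
qed

lemma free_act_mult: "free_act m \<alpha> \<beta> (u * v) f = free_act m \<alpha> \<beta> u (free_act m \<alpha> \<beta> v f)"
proof (induction u rule: poly_mapping_single_induct)
  case zero show ?case by (simp add: free_act_zero)
next
  case (plus w c u)
  have "free_act m \<alpha> \<beta> (Poly_Mapping.single w c * v) f =
     free_act m \<alpha> \<beta> (Poly_Mapping.single w c) (free_act m \<alpha> \<beta> v f)"
  proof (induction v rule: poly_mapping_single_induct)
    case zero show ?case by (simp add: free_act_zero free_act_zero_right)
  next
    case (plus w' c' v)
    show ?case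
      by (simp add: distrib_left free_act_plus plus mult_single free_act_single plus_free_word_def
         const_arith word_act_add word_act_const algebra_simps)
  qed
  then show ?case by (simp add: distrib_right free_act_plus plus)
qed

lemma ring_free: "ring (ring_of_type_algebra :: 'a::ring_1 ring)"
proof -
  have "\<exists>y. x + y = 0" for x :: 'a
    using add.right_inverse by blast
  thus ?thesis
    unfolding ring_of_type_algebra_def using add.right_inverse
    by unfold_locales (auto simp:algebra_simps Units_def)
qed

interpretation free_ring: ring free_ring by (rule ring_free)

lemma free_ring_simps [simp]:
  "carrier free_ring = UNIV" "x \<oplus>\<^bsub>free_ring\<^esub> y = x + y" "x \<otimes>\<^bsub>free_ring\<^esub> y = x * y"
  "\<zero>\<^bsub>free_ring\<^esub> = 0" "\<one>\<^bsub>free_ring\<^esub> = 1"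
  by (simp_all add: ring_of_type_algebra_def)

lemma weyl_ideal_ideal: "ideal weyl_ideal free_ring"
  unfolding weyl_ideal_def by (rule free_ring.genideal_ideal) simp

lemma free_ring_uminus [simp]: "\<ominus>\<^bsub>free_ring\<^esub> x = - x"
  using free_ring.minus_equality[of "-x" x] by simp

lemma annihilator_ideal: "ideal {u. \<forall>f. free_act m \<alpha> \<beta> u f = 0} free_ring"
proof (rule idealI)
  show "subgroup {u. \<forall>f. free_act m \<alpha> \<beta> u f = 0} (add_monoid free_ring)"
    by (rule free_ring.add.subgroupI) (auto simp: free_act_plus free_act_uminus intro!: exI[of _ 0] free_act_zero
        simp flip: a_inv_def)
qed (auto simp: free_act_mult free_act_zero_right ring_free)

lemma gen_act_free: "free_act m \<alpha> \<beta> (gen g) f = gen_act m \<alpha> \<beta> g f"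
  by (simp add: free_act_single const_arith)

lemma weyl_ideal_act: "u \<in> weyl_ideal \<Longrightarrow> free_act m \<alpha> \<beta> u f = 0"
proof -
  have "weyl_relations \<subseteq> {u. \<forall>f. free_act m \<alpha> \<beta> u f = 0}"
    by (auto simp: weyl_relations_def free_act_minus free_act_mult gen_act_free free_act_one
       twisted_deriv_mult is_derivation_dx is_derivation_dy twisted_deriv_commute pderiv_const_values
       Zero_fract_def[symmetric] One_fract_def[symmetric] mult.left_commute)
  from free_ring.genideal_minimal[OF annihilator_ideal this]
  show "u \<in> weyl_ideal \<Longrightarrow> free_act m \<alpha> \<beta> u f = 0" unfolding weyl_ideal_def by auto
qed

lemma M_mod_smult: "weyl_class u \<odot>\<^bsub>M_mod m \<alpha> \<beta>\<^esub> f = free_act m \<alpha> \<beta> u f"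
proof -
  interpret W: ideal weyl_ideal free_ring by (rule weyl_ideal_ideal)
  let ?v = "SOME v. v \<in> weyl_class u"
  have "u \<in> weyl_class u" by (rule W.a_rcos_self) simp
  then have "?v \<in> weyl_class u" by (rule someI)
  then obtain h where "h \<in> weyl_ideal" "?v = h + u"
    by (auto simp: a_r_coset_defs)
  then show ?thesis by (simp add: M_mod_def free_act_plus weyl_ideal_act)
qed

lemma ring_A2: "ring A2" unfolding A2_def by (rule ideal.quotient_is_ring[OF weyl_ideal_ideal])

lemma A2_simps:
  "carrier A2 = range weyl_class"
  "weyl_class u \<oplus>\<^bsub>A2\<^esub> weyl_class v = weyl_class (u + v)"
  "weyl_class u \<otimes>\<^bsub>A2\<^esub> weyl_class v = weyl_class (u * v)"
  "\<one>\<^bsub>A2\<^esub> = weyl_class 1"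
proof -
  interpret W: ideal weyl_ideal free_ring by (rule weyl_ideal_ideal)
  show "carrier A2 = range weyl_class"
  "weyl_class u \<oplus>\<^bsub>A2\<^esub> weyl_class v = weyl_class (u + v)"
  "weyl_class u \<otimes>\<^bsub>A2\<^esub> weyl_class v = weyl_class (u * v)"
  "\<one>\<^bsub>A2\<^esub> = weyl_class 1"
  using W.a_rcos_sum[of u v] W.rcoset_mult_add[of u v]
  by (auto simp: A2_def FactRing_def A_RCOSETS_def' )
qed

lemma localization_closed:
  fixes a :: "'a::idom"
  assumes "a \<noteq> 0"
  shows "0 \<in> localization a" "Fract g 1 \<in> localization a"
    "p \<in> localization a \<Longrightarrow> q \<in> localization a \<Longrightarrow> p + q \<in> localization a"
    "p \<in> localization a \<Longrightarrow> q \<in> localization a \<Longrightarrow> p * q \<in> localization a"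
    "is_derivation D \<Longrightarrow> p \<in> localization a \<Longrightarrow> fract_deriv D p \<in> localization a"
    "b dvd a \<Longrightarrow> Fract g b \<in> localization a"
proof -
  show g: "Fract g 1 \<in> localization a" for g
    unfolding localization_def mem_Collect_eq by (rule exI[of _ g], rule exI[of _ 0]) simp
  from g[of 0] show "0 \<in> localization a" by (simp add: Zero_fract_def)
  show "p \<in> localization a \<Longrightarrow> q \<in> localization a \<Longrightarrow> p + q \<in> localization a"
    using assms by (fastforce simp: localization_def simp flip: power_add)
  show "p \<in> localization a \<Longrightarrow> q \<in> localization a \<Longrightarrow> p * q \<in> localization a"
    by (fastforce simp: localization_def simp flip: power_add)
  show "is_derivation D \<Longrightarrow> p \<in> localization a \<Longrightarrow> fract_deriv D p \<in> localization a"
    using assms by (fastforce simp: localization_def fract_deriv_Fract simp flip: power_add)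
  assume "b dvd a"
  then obtain c where c: "a = b * c" by (auto simp: dvd_def)
  then have "Fract g b = Fract (g * c) (a ^ 1)" using assms by (simp add: eq_fract algebra_simps)
  then show "Fract g b \<in> localization a" unfolding localization_def by blast
qed

lemma localization_sum:
  "(a::'a::idom) \<noteq> 0 \<Longrightarrow> (\<And>i. i \<in> A \<Longrightarrow> f i \<in> localization a) \<Longrightarrow> (\<Sum>i\<in>A. f i) \<in> localization a"
  by (induction A rule: infinite_finite_induct) (auto simp: localization_closed)

lemma free_act_closed:
  assumes "(\<Prod>i=1..m. \<alpha> i) \<noteq> 0" "f \<in> localization (\<Prod>i=1..m. \<alpha> i)"
  shows "free_act m \<alpha> \<beta> u f \<in> localization (\<Prod>i=1..m. \<alpha> i)"
proof -
  note cl = localization_closed[OF assms(1)]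
  have tw: "twisted_deriv m \<alpha> \<beta> D g \<in> localization (\<Prod>i=1..m. \<alpha> i)"
    if "is_derivation D" "g \<in> localization (\<Prod>i=1..m. \<alpha> i)" for D g
    unfolding twisted_deriv_def
    by (intro cl localization_sum[OF assms(1)] that dvd_prodI) auto
  have "gen_act m \<alpha> \<beta> x g \<in> localization (\<Prod>i=1..m. \<alpha> i)"
    if "g \<in> localization (\<Prod>i=1..m. \<alpha> i)" for x g
    by (cases x) (auto simp only: gen_act.simps intro!: cl tw that is_derivation_dx is_derivation_dy)
  then have "foldr (gen_act m \<alpha> \<beta>) w f \<in> localization (\<Prod>i=1..m. \<alpha> i)" for w
    by (induction w) (auto simp only: assms foldr.simps o_def id_apply)
  then show ?thesis unfolding free_act_def
    by (intro localization_sum[OF assms(1)] cl)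
qed

lemma left_module_M_mod:
  assumes "\<And>i. i \<in> {1..m} \<Longrightarrow> \<alpha> i \<noteq> 0"
  shows "left_module A2 (M_mod m \<alpha> \<beta>)"
proof -
  have nz: "(\<Prod>i=1..m. \<alpha> i) \<noteq> 0" using assms by simp
  note cl = localization_closed[OF nz]
  have s: "\<zero>\<^bsub>M_mod m \<alpha> \<beta>\<^esub> = 0" "x \<oplus>\<^bsub>M_mod m \<alpha> \<beta>\<^esub> y = x + y"
    "carrier (M_mod m \<alpha> \<beta>) = localization (\<Prod>i=1..m. \<alpha> i)" for x y
    by (simp_all add: M_mod_def)
  have m1: "Fract (-1) 1 \<in> localization (\<Prod>i=1..m. \<alpha> i)" by (rule cl)
  have neg: "- x \<in> localization (\<Prod>i=1..m. \<alpha> i)" if "x \<in> localization (\<Prod>i=1..m. \<alpha> i)" for x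
    using cl(4)[OF m1 that] by (simp flip: One_fract_def minus_fract)
  have ag: "abelian_group (M_mod m \<alpha> \<beta>)"
    by (rule abelian_groupI; unfold s) (auto simp only: cl(1,3) add.assoc add.commute add.left_commute add_0_left add_0_right right_minus intro!: bexI[OF _ neg])
  show ?thesis
    by (intro left_module.intro left_module_axioms.intro ring_A2 ag)
      (use free_act_closed[OF nz] in \<open>auto simp: A2_simps M_mod_smult free_act_plus
          free_act_add_right free_act_mult free_act_one s\<close>)
qed

lemma free_act_sum: "free_act m \<alpha> \<beta> (\<Sum>i\<in>A. u i) f = (\<Sum>i\<in>A. free_act m \<alpha> \<beta> (u i) f)"
  by (induction A rule: infinite_finite_induct) (simp_all add: free_act_plus free_act_zero)

lemma foldr_replicate_gen: "foldr (gen_act m \<alpha> \<beta>) (replicate n GX) f = Fract (var_x ^ n) 1 * f"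
 "foldr (gen_act m \<alpha> \<beta>) (replicate n GY) f = Fract (var_y ^ n) 1 * f"
  by (induction n) (auto simp flip: mult.assoc simp: One_fract_def[symmetric] simp del: foldr_replicate)

lemma Fract_sum1: "(\<Sum>i\<in>A. Fract (g i) 1 * f) = Fract (\<Sum>i\<in>A. g i) 1 * (f :: 'a::idom fract)"
  by (induction A rule: infinite_finite_induct) (simp_all add: Zero_fract_def[symmetric] distrib_right[symmetric])

lemma poly_expand: "f = (\<Sum>j\<le>degree f. \<Sum>i\<le>degree (coeff f j). const_xy (coeff (coeff f j) i) * var_x ^ i * var_y ^ j)"
proof -
  have y: "var_y ^ j = monom 1 j" for j by (simp add: var_y_def monom_altdef)
  have "(\<Sum>i\<le>degree p. const_xy (coeff p i) * var_x ^ i) = [:p:]" for p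
  proof -
    have "const_xy (coeff p i) * var_x ^ i = [:monom (coeff p i) i:]" for i
    proof -
      have "var_x ^ i = [:monom 1 i:]" by (induction i) (auto simp: var_x_def one_pCons monom_altdef)
      then show ?thesis by (simp add: const_xy_def smult_monom)
    qed
    moreover have "(\<Sum>i\<in>A. [:h i:]) = [:\<Sum>i\<in>A. h i:]" for A :: "nat set" and h :: "nat \<Rightarrow> complex poly"
      by (induction A rule: infinite_finite_induct) auto
    ultimately show ?thesis by (simp add: poly_as_sum_of_monoms)
  qed
  then have "(\<Sum>j\<le>degree f. \<Sum>i\<le>degree (coeff f j). const_xy (coeff (coeff f j) i) * var_x ^ i * var_y ^ j)
     = (\<Sum>j\<le>degree f. [:coeff f j:] * monom 1 j)" by (simp add: y flip: sum_distrib_right)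
  also have "\<dots> = f" by (simp add: smult_monom poly_as_sum_of_monoms)
  finally show ?thesis by simp
qed

lemma poly_to_weyl_act: "poly_to_weyl g \<odot>\<^bsub>M_mod m \<alpha> \<beta>\<^esub> f = Fract g 1 * f"
proof -
  have "poly_to_weyl g \<odot>\<^bsub>M_mod m \<alpha> \<beta>\<^esub> f =
    (\<Sum>j\<le>degree g. \<Sum>i\<le>degree (coeff g j). Fract (const_xy (coeff (coeff g j) i) * var_x ^ i * var_y ^ j) 1 * f)"
    unfolding poly_to_weyl_def M_mod_smult free_act_sum free_act_single free_word.sel foldr_append foldr_replicate_gen
    by (simp add: mult.assoc[symmetric])
  also have "\<dots> = Fract g 1 * f"
    by (simp only: Fract_sum1 flip: poly_expand)
  finally show ?thesis .
qed

end

theory Submission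
  imports Defs "HOL-Computational_Algebra.Fundamental_Theorem_Algebra"
begin

text \<open>
  After an integer shift of the exponents, \<open>\<beta>\<^sub>i = 0\<close> for \<open>i \<le> k\<close> and \<open>\<Sum>\<beta>\<^sub>i\<close> is either \<open>0\<close> or not an integer.
  Take \<open>u = \<alpha>\<^sub>m\<close>, \<open>v = \<alpha>\<^sub>1\<close> as coordinates and put \<open>t = v / u\<close>. The Euler operator acts on the part of degree
  \<open>d\<close> by the scalar \<open>\<lambda>\<^sub>d = d + \<Sum>\<beta>\<^sub>i\<close>, so every submodule is graded, and dividing by \<open>u\<^sup>d\<close> turns it into a
  family of subspaces \<open>P\<^sub>d\<close> of the ring \<open>Q\<close> of rational functions of \<open>t\<close> with poles at the finite points
  \<open>\<alpha>\<^sub>i = 0\<close>, where \<open>u \<partial>\<^sub>v\<close> acts as a twisted derivation \<open>\<nabla>\<close>. Since \<open>\<partial>\<^sub>u u + \<partial>\<^sub>v v = \<lambda>\<^sub>d + 2\<close> on \<open>P\<^sub>d\<close>, the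
  family is determined by \<open>P\<^sub>d\<close> for large \<open>d\<close>, except that degree \<open>-2\<close> is free when \<open>\<Sum>\<beta>\<^sub>i = 0\<close>. For large
  \<open>d\<close> one has a \<open>D\<close>-module on the punctured line: a simple one with poles at the points of nonintegral
  exponent, and each of the \<open>k\<close> other lines adds one simple factor. In degree \<open>-2\<close> what remains is the
  cohomology \<open>Q / \<nabla> Q\<close> of dimension \<open>m - 2\<close>, and every line in it contributes a factor supported at the
  origin. Jordan--Hoelder transfers the count of supports to all composition series.
\<close>

section \<open>Jordan--Hoelder counting\<close>

text \<open>The obstacle is the origin, where all lines meet. The relation that recovers degree
  \<open>d\<close> from degree \<open>d + 1\<close> says that an element whose multiples by
  \<open>u\<close> and \<open>v\<close> lie in a submodule lies there itself, unless \<lambda>_d =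
  -2. After the shift this resonance is confined to one degree, and the elements killed by
  \<open>u\<close> and \<open>v\<close> modulo a submodule sit there. From degree -1 both
  \<partial>_u and \<partial>_v then produce values of \<nabla>, so the forced part of degree -2 is
  the image of \<nabla>. The number m - 2 is minus the Euler characteristic of the projective line
  without m points, infinity being one of them. The line sent to infinity has nonintegral exponent,
  because then it adds no factor: the powers of \<open>t\<close> are generated inside a single
  degree. The first k exponents are shifted to 0 and not just to some integer, so that \<nabla>
  never annihilates a leading polar coefficient. Supports are attached to pairs of submodules rather
  than to quotient modules, so that comparing two series only takes the second isomorphism
  theorem.\<close>

definition setsum :: "'a::ab_group_add set \<Rightarrow> 'a set \<Rightarrow> 'a set" where
  "setsum A B = {a + b | a b. a \<in> A \<and> b \<in> B}"

text \<open>\<open>label A B\<close> stands for an invariant of the quotient of \<open>B\<close> by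
  \<open>A\<close>. The last assumption is the second isomorphism theorem, the only fact about
  quotients that the butterfly argument uses.\<close>

locale subgroup_lattice =
  fixes sub :: "'a::ab_group_add set \<Rightarrow> bool" and label :: "'a set \<Rightarrow> 'a set \<Rightarrow> 'l"
  assumes sub_0: "sub A \<Longrightarrow> 0 \<in> A"
    and sub_add: "sub A \<Longrightarrow> x \<in> A \<Longrightarrow> y \<in> A \<Longrightarrow> x + y \<in> A"
    and sub_neg: "sub A \<Longrightarrow> x \<in> A \<Longrightarrow> - x \<in> A"
    and sub_Int: "sub A \<Longrightarrow> sub B \<Longrightarrow> sub (A \<inter> B)"
    and sub_setsum: "sub A \<Longrightarrow> sub B \<Longrightarrow> sub (setsum A B)"
    and label_setsum: "sub A \<Longrightarrow> sub Y \<Longrightarrow> label A (setsum A Y) = label (A \<inter> Y) Y"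
begin

definition covers :: "'a set \<Rightarrow> 'a set \<Rightarrow> bool" where
  "covers A B \<longleftrightarrow> sub A \<and> sub B \<and> A \<subset> B \<and> (\<forall>N. sub N \<longrightarrow> A \<subseteq> N \<longrightarrow> N \<subseteq> B \<longrightarrow> N = A \<or> N = B)"

definition chain :: "(nat \<Rightarrow> 'a set) \<Rightarrow> nat \<Rightarrow> 'a set \<Rightarrow> bool" where
  "chain C r M \<longleftrightarrow> C 0 = {0} \<and> C r = M \<and> (\<forall>i\<le>r. sub (C i)) \<and> (\<forall>i<r. covers (C i) (C (Suc i)))"

text \<open>The indices of the nonzero factors of the filtration that \<open>C\<close> induces on
  \<open>A\<close>.\<close>

definition jumps :: "(nat \<Rightarrow> 'a set) \<Rightarrow> nat \<Rightarrow> 'a set \<Rightarrow> nat set" where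
  "jumps C r A = {i. i < r \<and> \<not> C (Suc i) \<inter> A \<subseteq> C i}"

lemma sub_diff: "sub A \<Longrightarrow> x \<in> A \<Longrightarrow> y \<in> A \<Longrightarrow> x - y \<in> A"
  using sub_add[of A x "-y"] sub_neg[of A y] by simp

lemma setsum_upper: "sub A \<Longrightarrow> sub Y \<Longrightarrow> A \<subseteq> setsum A Y \<and> Y \<subseteq> setsum A Y"
  by (auto simp: setsum_def) (metis add.right_neutral sub_0, metis add.left_neutral sub_0)

lemma setsum_least: "sub B \<Longrightarrow> A \<subseteq> B \<Longrightarrow> Y \<subseteq> B \<Longrightarrow> setsum A Y \<subseteq> B"
  unfolding setsum_def using sub_add by blast

lemma chain_mono:
  assumes "chain C r M" "i \<le> j" "j \<le> r"
  shows "C i \<subseteq> C j"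
  using assms(2,3)
proof (induction j rule: dec_induct)
  case (step n)
  then have "n < r" by simp
  then have "C n \<subseteq> C (Suc n)" using assms(1) unfolding chain_def covers_def by blast
  then show ?case using step by auto
qed simp

lemma chain_sub: "chain C r M \<Longrightarrow> i \<le> r \<Longrightarrow> sub (C i)"
  by (simp add: chain_def)

text \<open>Passing from \<open>A\<close> to a cover \<open>B\<close> adds exactly one jump, so that the labels of any second chain are
  enumerated by the jumps of the first.\<close>

lemma covers_jump:
  assumes C: "chain C r M" and AB: "covers A B" and BM: "B \<subseteq> M"
  shows "\<exists>i. i \<notin> jumps C r A \<and> jumps C r B = insert i (jumps C r A) \<and> label (C i) (C (Suc i)) = label A B"
proof -
  have sA: "sub A" and sB: "sub B" and lt: "A \<subset> B" using AB by (auto simp: covers_def)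
  have C0: "C 0 = {0}" and Cr: "C r = M" using C by (auto simp: chain_def)
  obtain b where b: "b \<in> B" "b \<notin> A" using lt by blast
  \<comment> \<open>The first step of \<open>C\<close> that meets \<open>B\<close> outside
    \<open>A\<close>; up to index \<open>i\<close> the chain meets \<open>B\<close> only inside
    \<open>A\<close>.\<close>
  define i where "i = (LEAST n. \<not> C (Suc n) \<inter> B \<subseteq> A)"
  have r0: "r \<noteq> 0"
  proof
    assume "r = 0"
    then have "b \<in> {0}" using b BM C0 Cr by auto
    then show False using b sub_0[OF sA] by auto
  qed
  then have ex: "\<not> C (Suc (r - 1)) \<inter> B \<subseteq> A" using b BM Cr by auto
  then have ir: "i < r" unfolding i_def using r0
    by (metis (no_types, lifting) Least_le Suc_pred' less_Suc_eq_le not_gr_zero order_le_less_trans lessI)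
  have i1: "\<not> C (Suc i) \<inter> B \<subseteq> A" unfolding i_def using ex by (rule LeastI)
  have i2: "C j \<inter> B \<subseteq> A" if "j \<le> i" for j
  proof (cases j)
    case 0 then show ?thesis using C0 sub_0[OF sA] by auto
  next
    case (Suc n)
    then have "n < i" using that by simp
    then show ?thesis using Suc not_less_Least[of n] unfolding i_def by blast
  qed
  define Y where "Y = C (Suc i) \<inter> B"
  have sC: "sub (C i)" "sub (C (Suc i))" using C ir by (auto simp: chain_def)
  have sX: "sub Y" unfolding Y_def by (rule sub_Int[OF sC(2) sB])
  have "setsum A Y = A \<or> setsum A Y = B"
    using AB sub_setsum[OF sA sX] setsum_upper[OF sA sX] setsum_least[OF sB, of A Y] lt
    unfolding covers_def Y_def by blast
  then have AX: "setsum A Y = B" using setsum_upper[OF sA sX] i1 Y_def by blast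
  have cov: "covers (C i) (C (Suc i))" using C ir by (auto simp: chain_def)
  then have CC: "C i \<subseteq> C (Suc i)" by (auto simp: covers_def)
  have between: "setsum (C i) Y = C i \<or> setsum (C i) Y = C (Suc i)" if "sub Y" "Y \<subseteq> C (Suc i)" for Y
    using cov sub_setsum[OF sC(1) that(1)] setsum_upper[OF sC(1) that(1)] setsum_least[OF sC(2) CC that(2)]
    unfolding covers_def by blast
  have CX: "setsum (C i) Y = C (Suc i)"
    using between[OF sX] setsum_upper[OF sC(1) sX] i1 i2[of i] unfolding Y_def by blast
  have sAX: "sub (A \<inter> Y)" using sub_Int sA sX by blast
  \<comment> \<open>Otherwise \<open>A \<inter> Y\<close> would already generate
    \<open>C (Suc i)\<close> over \<open>C i\<close>. Since
    \<open>C i \<inter> B \<subseteq> A\<close>, the modular law would then give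
    \<open>Y \<subseteq> A\<close>.\<close>
  have no: "A \<inter> Y \<subseteq> C i"
  proof (rule ccontr)
    assume "\<not> A \<inter> Y \<subseteq> C i"
    then have *: "setsum (C i) (A \<inter> Y) = C (Suc i)"
      using between[OF sAX] setsum_upper[OF sC(1) sAX] unfolding Y_def by blast
    have "Y \<subseteq> A"
    proof
      fix x assume x: "x \<in> Y"
      then have "x \<in> setsum (C i) (A \<inter> Y)" using * Y_def by blast
      then obtain c a where ca: "c \<in> C i" "a \<in> A" "a \<in> Y" "x = c + a" unfolding setsum_def by blast
      then have "c \<in> B" using sub_diff[OF sX x ca(3)] Y_def by auto
      then have "c \<in> A" using i2[of i] ca by auto
      then show "x \<in> A" using ca sub_add[OF sA] by auto
    qed
    then show False using i1 Y_def by blast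
  qed
  \<comment> \<open>Both quotients are identified with the quotient of \<open>Y\<close> by
    \<open>A \<inter> Y\<close>, which equals \<open>C i \<inter> Y\<close>.\<close>
  have lab: "label (C i) (C (Suc i)) = label A B"
  proof -
    have "C i \<inter> Y = A \<inter> Y" using no i2[of i] CC unfolding Y_def by blast
    then show ?thesis using label_setsum[OF sA sX] label_setsum[OF sC(1) sX] AX CX by simp
  qed
  have notin: "i \<notin> jumps C r A"
    using no lt unfolding jumps_def Y_def by blast
  have iB: "i \<in> jumps C r B"
    using ir i1 i2[of i] unfolding jumps_def by blast
  \<comment> \<open>Before \<open>i\<close> all of \<open>C (Suc j) \<inter> B\<close> lies in
    \<open>A\<close>. After \<open>i\<close> the chain contains \<open>Y\<close>, so an element of
    \<open>B = A + Y\<close> can be moved into \<open>A\<close> modulo \<open>C j\<close>.\<close>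
  have other: "j \<in> jumps C r A" if j: "j \<in> jumps C r B" "j \<noteq> i" for j
  proof (rule ccontr)
    assume "j \<notin> jumps C r A"
    then have jA: "C (Suc j) \<inter> A \<subseteq> C j" using j by (auto simp: jumps_def)
    obtain x where x: "x \<in> C (Suc j)" "x \<in> B" "x \<notin> C j" and jr: "j < r" using j by (auto simp: jumps_def)
    show False
    proof (cases "j < i")
      case True
      then have "x \<in> A" using i2[of "Suc j"] x by auto
      then show False using jA x by auto
    next
      case False
      then have ij: "Suc i \<le> j" using j by auto
      have "x \<in> setsum A Y" using x AX by simp
      then obtain a' c where ac: "a' \<in> A" "c \<in> Y" "x = a' + c" unfolding setsum_def by blast
      have sj: "sub (C j)" "sub (C (Suc j))" using C jr by (auto simp: chain_def)
      have c: "c \<in> C j" using chain_mono[OF C ij] jr ac Y_def by auto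
      then have "c \<in> C (Suc j)" using chain_mono[OF C, of j "Suc j"] jr by auto
      then have "a' \<in> C (Suc j)" using ac x sub_diff[OF sj(2), of x c] by simp
      then have "a' \<in> C j" using jA ac by auto
      then show False using ac x sub_add[OF sj(1) _ c] by simp
    qed
  qed
  have "jumps C r A \<subseteq> jumps C r B" using lt unfolding jumps_def by blast
  then have "jumps C r B = insert i (jumps C r A)" using other iB by blast
  then show ?thesis using notin lab by blast
qed

text \<open>Along \<open>D\<close> the jumps of \<open>C\<close> are collected one by one, from none
  at zero to all of them at \<open>M\<close>. A set \<open>Z\<close> of labels is allowed because
  \<open>UNIV\<close> then yields the equality of lengths.\<close>

lemma chain_count:
  assumes C: "chain C r M" and D: "chain D s M"
  shows "card {i. i < s \<and> label (D i) (D (Suc i)) \<in> Z} = card {i. i < r \<and> label (C i) (C (Suc i)) \<in> Z}"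
proof -
  have "card {i. i < n \<and> label (D i) (D (Suc i)) \<in> Z} = card {i \<in> jumps C r (D n). label (C i) (C (Suc i)) \<in> Z}"
    if "n \<le> s" for n
    using that
  proof (induction n)
    case 0
    have "jumps C r {0} = {}" using chain_sub[OF C] sub_0 by (auto simp: jumps_def)
    then show ?case using D by (simp add: chain_def)
  next
    case (Suc n)
    have "covers (D n) (D (Suc n))" using D Suc.prems by (simp add: chain_def)
    moreover have "D (Suc n) \<subseteq> M" using chain_mono[OF D Suc.prems] D by (simp add: chain_def)
    ultimately obtain i where i: "i \<notin> jumps C r (D n)" "jumps C r (D (Suc n)) = insert i (jumps C r (D n))"
      "label (C i) (C (Suc i)) = label (D n) (D (Suc n))"
      using covers_jump[OF C] by blast
    have fin: "finite (jumps C r (D n))" by (simp add: jumps_def)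
    have 1: "{j. j < Suc n \<and> label (D j) (D (Suc j)) \<in> Z} =
      (if label (D n) (D (Suc n)) \<in> Z then insert n else id) {j. j < n \<and> label (D j) (D (Suc j)) \<in> Z}"
      by (auto simp: less_Suc_eq)
    have 2: "{j \<in> jumps C r (D (Suc n)). label (C j) (C (Suc j)) \<in> Z} =
      (if label (D n) (D (Suc n)) \<in> Z then insert i else id) {j \<in> jumps C r (D n). label (C j) (C (Suc j)) \<in> Z}"
      using i by auto
    show ?case unfolding 1 2 using Suc i fin by simp
  qed
  from this[of s] have "card {i. i < s \<and> label (D i) (D (Suc i)) \<in> Z} = card {i \<in> jumps C r M. label (C i) (C (Suc i)) \<in> Z}"
    using D by (simp add: chain_def)
  moreover have "jumps C r M = {i. i < r}"
  proof -
    have "\<not> C (Suc i) \<inter> M \<subseteq> C i" if "i < r" for i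
    proof -
      have "C i \<subset> C (Suc i)" using C that unfolding chain_def covers_def by simp
      moreover have "C (Suc i) \<subseteq> M" using chain_mono[OF C, of "Suc i" r] C that by (simp add: chain_def)
      ultimately show ?thesis by blast
    qed
    then show ?thesis by (auto simp: jumps_def)
  qed
  ultimately show ?thesis by simp
qed

lemma chain_length: "chain C r M \<Longrightarrow> chain D s M \<Longrightarrow> s = r"
  using chain_count[of C r M D s UNIV] by simp

end

section \<open>Rational functions on a punctured line with a twisted derivation\<close>

text \<open>The exponents \<open>\<gamma> i\<close> belong to the finite points \<open>a i\<close>,
  and \<open>\<omega>\<close> to the line \<open>u = 0\<close>, which is the point at infinity for
  \<open>t\<close>. The total \<open>(\<Sum>i\<in>I. \<gamma> i) + \<omega>\<close> is the exponent
  along the exceptional curve of the blown-up origin and governs the factors supported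
  there.\<close>

locale twisted_line =
  fixes \<kappa> :: "complex \<Rightarrow> 'k::field" and t :: 'k and \<delta> :: "'k \<Rightarrow> 'k"
    and I :: "nat set" and a \<gamma> :: "nat \<Rightarrow> complex" and \<omega> :: complex
  assumes \<kappa>_add: "\<kappa> (c + d) = \<kappa> c + \<kappa> d"
    and \<kappa>_mult: "\<kappa> (c * d) = \<kappa> c * \<kappa> d"
    and \<kappa>_1 [simp]: "\<kappa> 1 = 1"
    and derivation: "is_derivation \<delta>"
    and \<delta>_\<kappa> [simp]: "\<delta> (\<kappa> c) = 0"
    and \<delta>_t [simp]: "\<delta> t = 1"
    and t_nonconst: "t \<noteq> \<kappa> c"
    and fin_I: "finite I"
    and inj_a: "inj_on a I"
    and \<gamma>_cases: "i \<in> I \<Longrightarrow> \<gamma> i = 0 \<or> \<gamma> i \<notin> \<int>"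
    and \<omega>_nonint: "\<omega> \<notin> \<int>"
    and sum_cases: "(\<Sum>i\<in>I. \<gamma> i) + \<omega> \<notin> \<int> \<or> (\<Sum>i\<in>I. \<gamma> i) + \<omega> = 0"
begin

lemma \<kappa>_0 [simp]: "\<kappa> 0 = 0"
  using \<kappa>_add[of 0 0] by (metis add.right_neutral add_left_imp_eq)

lemma \<kappa>_minus: "\<kappa> (- c) = - \<kappa> c"
  using \<kappa>_add[of c "- c"] by (simp add: eq_neg_iff_add_eq_0 add.commute)

lemma \<kappa>_diff: "\<kappa> (c - d) = \<kappa> c - \<kappa> d"
  using \<kappa>_add[of c "- d"] by (simp add: \<kappa>_minus)

lemma \<kappa>_inverse_mult: "c \<noteq> 0 \<Longrightarrow> \<kappa> (inverse c) * \<kappa> c = 1"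
  by (simp flip: \<kappa>_mult)

lemma \<kappa>_eq_0_iff [simp]: "\<kappa> c = 0 \<longleftrightarrow> c = 0"
  using \<kappa>_inverse_mult[of c] by fastforce

lemma \<kappa>_of_nat: "\<kappa> (of_nat n) = of_nat n"
  by (induction n) (simp_all add: \<kappa>_add)

lemma \<kappa>_sum: "\<kappa> (\<Sum>i\<in>A. f i) = (\<Sum>i\<in>A. \<kappa> (f i))"
  by (induction A rule: infinite_finite_induct) (simp_all add: \<kappa>_add)

lemma \<kappa>_power: "\<kappa> (c ^ n) = \<kappa> c ^ n"
  by (induction n) (simp_all add: \<kappa>_mult)

lemmas \<delta>_simps = derivationD[OF derivation]

definition pt :: "nat \<Rightarrow> 'k" where "pt i = t - \<kappa> (a i)"
definition po :: "nat \<Rightarrow> 'k" where "po i = inverse (pt i)"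

lemma pt_nz [simp]: "pt i \<noteq> 0"
  using t_nonconst by (simp add: pt_def)

lemma pt_po [simp]: "pt i * po i = 1" "po i * pt i = 1"
  by (simp_all add: po_def)

lemma t_po: "t * po i = 1 + \<kappa> (a i) * po i"
proof -
  have "(t - \<kappa> (a i)) * po i = 1" using pt_po by (simp add: pt_def)
  then show ?thesis by (simp add: algebra_simps)
qed

lemma \<delta>_pt [simp]: "\<delta> (pt i) = 1"
  using \<delta>_simps(1)[of t "- \<kappa> (a i)"] by (simp add: pt_def \<delta>_simps(5))

lemma \<delta>_po: "\<delta> (po i) = - (po i ^ 2)"
proof -
  have "pt i * \<delta> (po i) = - po i"
    using \<delta>_simps(2)[of "pt i" "po i"] by (simp add: \<delta>_simps eq_neg_iff_add_eq_0 add.commute)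
  then have "po i * (pt i * \<delta> (po i)) = po i * (- po i)" by simp
  then show ?thesis by (simp add: power2_eq_square flip: mult.assoc)
qed

lemma \<delta>_power: "\<delta> (f ^ Suc n) = of_nat (Suc n) * f ^ n * \<delta> f"
  by (induction n) (simp_all add: \<delta>_simps algebra_simps)

lemma \<delta>_po_power: "\<delta> (po i ^ n) = - of_nat n * po i ^ Suc n"
proof (cases n)
  case 0 then show ?thesis by (simp add: \<delta>_simps)
next
  case (Suc m) then show ?thesis
    by (simp only: \<delta>_power \<delta>_po) (simp add: power2_eq_square algebra_simps)
qed

text \<open>The conjugate of \<open>\<delta>\<close> by the multivalued function with exponents
  \<open>\<gamma> i\<close> at the points \<open>a i\<close>.\<close>

definition nabla :: "'k \<Rightarrow> 'k" (\<open>\<nabla>\<close>) where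
  "\<nabla> f = \<delta> f + (\<Sum>i\<in>I. \<kappa> (\<gamma> i) * po i) * f"

lemma nabla_add: "\<nabla> (f + g) = \<nabla> f + \<nabla> g"
  by (simp add: nabla_def \<delta>_simps algebra_simps)

lemma nabla_mult: "\<nabla> (f * g) = \<delta> f * g + f * \<nabla> g"
  by (simp add: nabla_def \<delta>_simps algebra_simps)

lemma nabla_\<kappa>_mult: "\<nabla> (\<kappa> c * f) = \<kappa> c * \<nabla> f"
  by (simp add: nabla_mult)

lemma nabla_0 [simp]: "\<nabla> 0 = 0"
  by (simp add: nabla_def \<delta>_simps)

lemma nabla_t_mult: "\<nabla> (t * f) = f + t * \<nabla> f"
  by (simp add: nabla_mult)

lemma nabla_t_power_mult: "\<nabla> (t ^ n * f) = of_nat n * t ^ (n - 1) * f + t ^ n * \<nabla> f"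
proof (cases n)
  case (Suc m) then show ?thesis by (simp only: nabla_mult \<delta>_power) simp
qed simp

definition csub :: "'k set \<Rightarrow> bool" where
  "csub V \<longleftrightarrow> 0 \<in> V \<and> (\<forall>f\<in>V. \<forall>g\<in>V. f + g \<in> V) \<and> (\<forall>c. \<forall>f\<in>V. \<kappa> c * f \<in> V)"

lemma csubD:
  assumes "csub V"
  shows "0 \<in> V" "f \<in> V \<Longrightarrow> g \<in> V \<Longrightarrow> f + g \<in> V" "f \<in> V \<Longrightarrow> \<kappa> c * f \<in> V"
    "f \<in> V \<Longrightarrow> - f \<in> V" "f \<in> V \<Longrightarrow> g \<in> V \<Longrightarrow> f - g \<in> V"
proof -
  show 0: "0 \<in> V" and 1: "f \<in> V \<Longrightarrow> g \<in> V \<Longrightarrow> f + g \<in> V" and 2: "f \<in> V \<Longrightarrow> \<kappa> c * f \<in> V" for f g c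
    using assms by (auto simp: csub_def)
  show 3: "f \<in> V \<Longrightarrow> - f \<in> V" for f using 2[of f "-1"] by (simp add: \<kappa>_minus)
  show "f \<in> V \<Longrightarrow> g \<in> V \<Longrightarrow> f - g \<in> V" using 1[of f "-g"] 3[of g] by simp
qed

lemma csub_sum: "csub V \<Longrightarrow> (\<And>i. i \<in> A \<Longrightarrow> f i \<in> V) \<Longrightarrow> (\<Sum>i\<in>A. f i) \<in> V"
  by (induction A rule: infinite_finite_induct) (auto simp: csubD)

lemma csub_cancel: "csub V \<Longrightarrow> \<kappa> c * f \<in> V \<Longrightarrow> c \<noteq> 0 \<Longrightarrow> f \<in> V"
  using csubD(3)[of V "\<kappa> c * f" "inverse c"] \<kappa>_inverse_mult[of c] by (simp flip: mult.assoc)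

text \<open>The ring of rational functions whose only finite poles are at the points indexed by
  \<open>T\<close>. Varying \<open>T\<close> separates the submodules cut out by the lines of
  exponent 0: such a submodule allows poles along some of them and not along others.\<close>

inductive_set Q :: "nat set \<Rightarrow> 'k set" for T where
  Q_\<kappa>: "\<kappa> c \<in> Q T"
| Q_t: "t \<in> Q T"
| Q_po: "i \<in> T \<Longrightarrow> po i \<in> Q T"
| Q_add: "f \<in> Q T \<Longrightarrow> g \<in> Q T \<Longrightarrow> f + g \<in> Q T"
| Q_mult: "f \<in> Q T \<Longrightarrow> g \<in> Q T \<Longrightarrow> f * g \<in> Q T"

lemma Q_0: "0 \<in> Q T" and Q_1: "1 \<in> Q T"
  using Q_\<kappa>[of 0] Q_\<kappa>[of 1] by simp_all

lemma csub_Q: "csub (Q T)"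
  by (simp add: csub_def Q_0 Q_add Q_mult Q_\<kappa>)

lemmas Q_simps = Q_0 Q_1 Q_\<kappa> Q_t Q_add Q_mult csubD(4,5)[OF csub_Q]

lemma Q_mono: "T \<subseteq> T' \<Longrightarrow> Q T \<subseteq> Q T'"
proof
  fix f assume "T \<subseteq> T'" "f \<in> Q T"
  then show "f \<in> Q T'" by (induction rule: Q.induct[consumes 1, OF \<open>f \<in> Q T\<close>]) (auto intro: Q.intros)
qed

lemma Q_power: "f \<in> Q T \<Longrightarrow> f ^ n \<in> Q T"
  by (induction n) (auto simp: Q_simps)

lemma Q_pt: "pt i \<in> Q T"
  by (simp add: pt_def Q_simps)

lemma Q_sum: "(\<And>i. i \<in> A \<Longrightarrow> f i \<in> Q T) \<Longrightarrow> (\<Sum>i\<in>A. f i) \<in> Q T"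
  by (rule csub_sum[OF csub_Q])

lemma Q_\<delta>: "f \<in> Q T \<Longrightarrow> \<delta> f \<in> Q T"
proof (induction rule: Q.induct)
  case (Q_po i)
  then have "- (po i ^ 2) \<in> Q T" by (intro Q_simps Q_power Q.Q_po)
  then show ?case by (simp add: \<delta>_po)
qed (auto simp: \<delta>_simps Q_simps)

text \<open>By \<open>\<gamma>_cases\<close> these are the finite points of nonintegral exponent,
  where \<open>\<nabla>\<close> itself has poles; \<open>Q T\<close> is stable under
  \<open>\<nabla>\<close> once \<open>T\<close> contains them.\<close>

definition \<gamma>supp :: "nat set" where "\<gamma>supp = {i \<in> I. \<gamma> i \<noteq> 0}"

lemma Q_nabla: "\<gamma>supp \<subseteq> T \<Longrightarrow> f \<in> Q T \<Longrightarrow> \<nabla> f \<in> Q T"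
proof -
  assume T: "\<gamma>supp \<subseteq> T" and f: "f \<in> Q T"
  have "\<kappa> (\<gamma> i) * po i \<in> Q T" if "i \<in> I" for i
    using T that by (cases "\<gamma> i = 0") (auto simp: \<gamma>supp_def Q_simps Q_po)
  then have "(\<Sum>i\<in>I. \<kappa> (\<gamma> i) * po i) \<in> Q T" by (rule Q_sum)
  then show ?thesis unfolding nabla_def using f by (intro Q_add Q_mult Q_\<delta>)
qed

section \<open>Polynomials in t\<close>

definition \<phi> :: "complex poly \<Rightarrow> 'k" where "\<phi> g = poly (map_poly \<kappa> g) t"

lemma \<phi>_pCons [simp]: "\<phi> (pCons c g) = \<kappa> c + t * \<phi> g"
  by (simp add: \<phi>_def map_poly_pCons)

lemma \<phi>_0 [simp]: "\<phi> 0 = 0" by (simp add: \<phi>_def)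

lemma \<phi>_add: "\<phi> (g + h) = \<phi> g + \<phi> h"
  by (induction g h rule: poly_induct2) (simp_all add: \<kappa>_add algebra_simps)

lemma \<phi>_smult: "\<phi> (smult c g) = \<kappa> c * \<phi> g"
  by (induction g) (simp_all add: \<kappa>_mult algebra_simps)

lemma \<phi>_mult: "\<phi> (g * h) = \<phi> g * \<phi> h"
  by (induction g) (simp_all add: \<phi>_add \<phi>_smult algebra_simps)

lemma \<phi>_1 [simp]: "\<phi> 1 = 1" by (simp add: one_pCons)

lemma \<phi>_diff: "\<phi> (g - h) = \<phi> g - \<phi> h"
  using \<phi>_add[of "g - h" h] by simp

lemma \<phi>_sum: "\<phi> (\<Sum>i\<in>A. f i) = (\<Sum>i\<in>A. \<phi> (f i))"
  by (induction A rule: infinite_finite_induct) (simp_all add: \<phi>_add)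

lemma \<phi>_linear: "\<phi> [:- c, 1:] = t - \<kappa> c"
  by (simp add: \<kappa>_minus)

lemma \<phi>_pt: "\<phi> [:- a i, 1:] = pt i"
  by (simp add: \<kappa>_minus pt_def)

lemma \<delta>_\<phi>: "\<delta> (\<phi> g) = \<phi> (pderiv g)"
  by (induction g) (simp_all add: \<delta>_simps pderiv_pCons \<phi>_add)

lemma Q_\<phi>: "\<phi> g \<in> Q T"
  by (induction g) (auto simp: Q_simps)

text \<open>Over the complex numbers a nonconstant polynomial splits off a linear factor, and no
  \<open>t - \<kappa> r\<close> is 0. So \<open>t\<close>, known only not to be a constant, is
  transcendental.\<close>

lemma \<phi>_eq_0_iff [simp]: "\<phi> g = 0 \<longleftrightarrow> g = 0"
proof
  assume "\<phi> g = 0"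
  then show "g = 0"
  proof (induction "degree g" arbitrary: g rule: less_induct)
    case less
    show ?case
    proof (cases "degree g = 0")
      case True
      then obtain c where "g = [:c:]" by (metis degree_eq_zeroE)
      then show ?thesis using less by simp
    next
      case False
      then obtain r where "poly g r = 0"
        using fundamental_theorem_of_algebra[of g] constant_degree[of g] by auto
      then obtain h where h: "g = [:- r, 1:] * h" by (auto simp: poly_eq_0_iff_dvd dvd_def)
      then have hn: "h \<noteq> 0" using False by auto
      have "\<phi> h = 0" using less.prems t_nonconst[of r] unfolding h \<phi>_mult \<phi>_linear by simp
      moreover have "degree g = degree [:- r, 1:] + degree h"
        unfolding h by (rule degree_mult_eq) (use hn in auto)
      then have "degree h < degree g" by simp
      ultimately have "h = 0" using less.hyps by blast
      then show ?thesis using h by simp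
    qed
  qed
qed simp

lemma \<phi>_eq_iff [simp]: "\<phi> g = \<phi> h \<longleftrightarrow> g = h"
  using \<phi>_eq_0_iff[of "g - h"] by (simp add: \<phi>_diff)

section \<open>Denominators, poles and partial fractions\<close>

definition ptprod :: "nat set \<Rightarrow> complex poly" where "ptprod T = (\<Prod>i\<in>T. [:- a i, 1:])"

lemma ptprod_nz [simp]: "ptprod T \<noteq> 0"
  by (cases "finite T") (auto simp: ptprod_def)

lemma poly_ptprod_eq_0: "finite T \<Longrightarrow> poly (ptprod T) r = 0 \<longleftrightarrow> (\<exists>i\<in>T. a i = r)"
  by (auto simp: ptprod_def poly_prod)

lemma ptprod_po:
  assumes "finite T" "i \<in> T"
  shows "\<phi> (ptprod T) * po i = \<phi> (ptprod (T - {i}))"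
proof -
  have "ptprod T = [:- a i, 1:] * ptprod (T - {i})"
    unfolding ptprod_def by (rule prod.remove[OF assms])
  then have "\<phi> (ptprod T) * po i = \<phi> (ptprod (T - {i})) * (pt i * po i)"
    by (simp only: \<phi>_mult \<phi>_pt) (simp only: mult_ac)
  then show ?thesis by simp
qed

lemma ptprod_sum_po:
  assumes "finite T"
  shows "\<exists>q. \<phi> (ptprod T) * (\<Sum>i\<in>T. \<kappa> (c i) * po i) = \<phi> q"
proof -
  have "\<phi> (ptprod T) * (\<kappa> (c i) * po i) = \<phi> (smult (c i) (ptprod (T - {i})))" if "i \<in> T" for i
    using ptprod_po[OF assms that] by (simp add: \<phi>_smult mult.left_commute)
  then have "\<phi> (ptprod T) * (\<Sum>i\<in>T. \<kappa> (c i) * po i) = \<phi> (\<Sum>i\<in>T. smult (c i) (ptprod (T - {i})))"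
    by (simp add: sum_distrib_left \<phi>_sum)
  then show ?thesis by blast
qed

lemma Q_denominator:
  assumes "finite T" "h \<in> Q T"
  shows "\<exists>n g. \<phi> (ptprod T ^ n) * h = \<phi> g"
  using assms(2)
proof (induction rule: Q.induct)
  case (Q_\<kappa> c)
  show ?case by (rule exI[of _ 0], rule exI[of _ "[:c:]"]) simp
next
  case Q_t
  show ?case by (rule exI[of _ 0], rule exI[of _ "[:0,1:]"]) simp
next
  case (Q_po i)
  then show ?case using ptprod_po[OF assms(1) Q_po] by (intro exI[of _ 1] exI[of _ "ptprod (T - {i})"]) simp
next
  case (Q_add f g)
  then obtain n p m q where 1: "\<phi> (ptprod T ^ n) * f = \<phi> p" "\<phi> (ptprod T ^ m) * g = \<phi> q" by blast
  have "\<phi> (ptprod T ^ (n + m)) * (f + g) =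
     \<phi> (ptprod T ^ m) * (\<phi> (ptprod T ^ n) * f) + \<phi> (ptprod T ^ n) * (\<phi> (ptprod T ^ m) * g)"
    by (simp add: power_add \<phi>_mult algebra_simps)
  also have "\<dots> = \<phi> (ptprod T ^ m * p + ptprod T ^ n * q)"
    by (simp add: 1 \<phi>_mult \<phi>_add)
  finally show ?case by blast
next
  case (Q_mult f g)
  then obtain n p m q where 1: "\<phi> (ptprod T ^ n) * f = \<phi> p" "\<phi> (ptprod T ^ m) * g = \<phi> q" by blast
  have "\<phi> (ptprod T ^ (n + m)) * (f * g) =
     (\<phi> (ptprod T ^ n) * f) * (\<phi> (ptprod T ^ m) * g)"
    by (simp add: power_add \<phi>_mult algebra_simps)
  also have "\<dots> = \<phi> (p * q)" by (simp add: 1 \<phi>_mult)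
  finally show ?case by blast
qed

text \<open>After clearing denominators, a power of \<open>ptprod T\<close> would vanish at
  \<open>a s\<close>, which is not among its roots because \<open>a\<close> is injective.\<close>

lemma po_notin_Q:
  assumes "s \<in> I" "T \<subseteq> I" "s \<notin> T"
  shows "po s \<notin> Q T"
proof
  assume "po s \<in> Q T"
  have fT: "finite T" using assms fin_I finite_subset by blast
  obtain n g where g: "\<phi> (ptprod T ^ n) * po s = \<phi> g" using Q_denominator[OF fT \<open>po s \<in> Q T\<close>] by blast
  then have "\<phi> (ptprod T ^ n) = \<phi> g * pt s" by (metis mult.assoc mult.right_neutral pt_po(2))
  then have "\<phi> (ptprod T ^ n) = \<phi> (g * [:- a s, 1:])" by (simp only: \<phi>_mult \<phi>_pt)
  then have "poly (ptprod T ^ n) (a s) = 0" by simp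
  then have "poly (ptprod T) (a s) = 0" by (simp add: poly_power)
  then obtain i where "i \<in> T" "a i = a s" using poly_ptprod_eq_0[OF fT] by blast
  then show False using assms inj_a by (auto dest: inj_onD)
qed

lemma po_mult_po:
  assumes "i \<in> I" "l \<in> I" "i \<noteq> l"
  shows "po l * po i = \<kappa> (inverse (a i - a l)) * (po i - po l)"
proof -
  have n: "a i - a l \<noteq> 0" using assms inj_a by (auto dest: inj_onD)
  have "po l * (1 + \<kappa> (a i) * po i) = po i * (1 + \<kappa> (a l) * po l)"
    unfolding t_po[symmetric] by (simp add: mult_ac)
  then have "\<kappa> (a i - a l) * (po l * po i) = po i - po l"
    by (simp add: \<kappa>_diff algebra_simps)
  then have "\<kappa> (inverse (a i - a l)) * (\<kappa> (a i - a l) * (po l * po i)) = \<kappa> (inverse (a i - a l)) * (po i - po l)"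
    by simp
  then show ?thesis using \<kappa>_inverse_mult[OF n] by (simp flip: mult.assoc)
qed

text \<open>The constant \<open>c\<close> is the value of \<open>h\<close> at \<open>a s\<close>,
  where elements of \<open>Q T\<close> are regular.\<close>

lemma Q_eval:
  assumes "s \<in> I" "T \<subseteq> I" "s \<notin> T" "h \<in> Q T"
  shows "\<exists>c. \<exists>q\<in>Q T. h = \<kappa> c + pt s * q"
  using assms(4)
proof (induction rule: Q.induct)
  case (Q_\<kappa> c)
  show ?case by (intro exI[of _ c] bexI[of _ 0]) (simp_all add: Q_simps)
next
  case Q_t
  show ?case by (intro exI[of _ "a s"] bexI[of _ 1]) (simp_all add: Q_simps pt_def)
next
  case (Q_po i)
  let ?c = "inverse (a i - a s)"
  have i: "i \<in> I" "s \<noteq> i" using Q_po assms by auto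
  have "po i = pt s * (po s * po i)" by (simp flip: mult.assoc)
  also have "\<dots> = \<kappa> (- ?c) + pt s * (\<kappa> ?c * po i)"
    unfolding po_mult_po[OF i(1) assms(1) i(2)[symmetric]] by (simp add: algebra_simps \<kappa>_minus)
  finally show ?case using Q_po by (intro exI[of _ "- ?c"] bexI[of _ "\<kappa> ?c * po i"]) (auto simp: Q_simps Q.Q_po)
next
  case (Q_add f g)
  then obtain c q d r where *: "f = \<kappa> c + pt s * q" "q \<in> Q T" "g = \<kappa> d + pt s * r" "r \<in> Q T" by blast
  show ?case by (intro exI[of _ "c + d"] bexI[of _ "q + r"]) (auto simp: * \<kappa>_add algebra_simps Q_simps)
next
  case (Q_mult f g)
  then obtain c q d r where *: "f = \<kappa> c + pt s * q" "q \<in> Q T" "g = \<kappa> d + pt s * r" "r \<in> Q T" by blast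
  show ?case by (intro exI[of _ "c * d"] bexI[of _ "\<kappa> c * r + q * g"]) (auto simp: * \<kappa>_mult algebra_simps Q_simps Q_pt)
qed

lemma Q_clear:
  assumes "h \<in> Q (insert s T)"
  shows "\<exists>J. pt s ^ J * h \<in> Q T"
  using assms
proof (induction rule: Q.induct)
  case (Q_\<kappa> c) show ?case by (rule exI[of _ 0]) (simp add: Q_simps)
next
  case Q_t show ?case by (rule exI[of _ 0]) (simp add: Q_simps)
next
  case (Q_po i)
  show ?case
  proof (cases "i = s")
    case True then show ?thesis by (intro exI[of _ 1]) (simp add: Q_simps)
  next
    case False then show ?thesis using Q_po by (intro exI[of _ 0]) (simp add: Q.Q_po)
  qed
next
  case (Q_add f g)
  then obtain n m where *: "pt s ^ n * f \<in> Q T" "pt s ^ m * g \<in> Q T" by blast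
  have "pt s ^ (n + m) * (f + g) = pt s ^ m * (pt s ^ n * f) + pt s ^ n * (pt s ^ m * g)"
    by (simp add: power_add algebra_simps)
  also have "\<dots> \<in> Q T" by (rule Q.Q_add[OF Q.Q_mult[OF Q_power[OF Q_pt] *(1)] Q.Q_mult[OF Q_power[OF Q_pt] *(2)]])
  finally show ?case by blast
next
  case (Q_mult f g)
  then obtain n m where *: "pt s ^ n * f \<in> Q T" "pt s ^ m * g \<in> Q T" by blast
  have "pt s ^ (n + m) * (f * g) = (pt s ^ n * f) * (pt s ^ m * g)"
    by (simp add: power_add algebra_simps)
  also have "\<dots> \<in> Q T" using * by (rule Q.Q_mult)
  finally show ?case by blast
qed

text \<open>\<open>Suc J\<close> is the order of the pole of \<open>h\<close> at \<open>a s\<close>,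
  and \<open>c\<close> is the leading Laurent coefficient.\<close>

lemma Q_principal:
  assumes "s \<in> I" "T \<subseteq> I" "s \<notin> T" "h \<in> Q (insert s T)" "h \<notin> Q T"
  shows "\<exists>J c. c \<noteq> 0 \<and> (\<exists>q\<in>Q T. pt s ^ Suc J * h = \<kappa> c + pt s * q)"
proof -
  define N where "N = (LEAST J. pt s ^ J * h \<in> Q T)"
  have N: "pt s ^ N * h \<in> Q T" unfolding N_def using Q_clear[OF assms(4)] by (rule LeastI_ex)
  then have "N \<noteq> 0" using assms(5) by (cases N) auto
  then obtain J where J: "N = Suc J" by (cases N) auto
  then have notin: "pt s ^ J * h \<notin> Q T" by (metis (no_types, lifting) J N_def lessI not_less_Least)
  obtain c q where q: "q \<in> Q T" "pt s ^ Suc J * h = \<kappa> c + pt s * q"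
    using Q_eval[OF assms(1,2,3) N] unfolding J by blast
  have "c \<noteq> 0"
  proof
    assume "c = 0"
    then have "pt s * (pt s ^ J * h) = pt s * q" using q by (simp add: mult.assoc)
    then show False using notin q by simp
  qed
  then show ?thesis using q by blast
qed

text \<open>Induction on the order of the pole at \<open>a s\<close>: subtracting the leading polar
  term lowers it.\<close>

lemma Q_pole_span:
  assumes s: "s \<in> I" "T \<subseteq> I" "s \<notin> T" and V: "csub V" "Q T \<subseteq> V" "\<And>j. po s ^ Suc j \<in> V"
  shows "Q (insert s T) \<subseteq> V"
proof
  fix h assume "h \<in> Q (insert s T)"
  then obtain J where "pt s ^ J * h \<in> Q T" using Q_clear by blast
  then show "h \<in> V"
  proof (induction J arbitrary: h)
    case 0 then show ?case using V by auto
  next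
    case (Suc J)
    then obtain c q where q: "q \<in> Q T" "pt s ^ Suc J * h = \<kappa> c + pt s * q"
      using Q_eval[OF s] by blast
    have inv: "po s ^ n * pt s ^ n = 1" for n by (simp flip: power_mult_distrib)
    have "po s ^ Suc J * (pt s ^ Suc J * h) = po s ^ Suc J * \<kappa> c + po s ^ J * ((po s * pt s) * q)"
      unfolding q(2) by (simp only: algebra_simps power_Suc)
    then have "(po s ^ Suc J * pt s ^ Suc J) * h = \<kappa> c * po s ^ Suc J + po s ^ J * ((po s * pt s) * q)"
      by (simp only: mult_ac)
    then have h: "h = \<kappa> c * po s ^ Suc J + po s ^ J * q"
      by (simp only: inv pt_po mult_1_left)
    have "pt s ^ J * (po s ^ J * q) = (po s ^ J * pt s ^ J) * q" by (simp only: mult_ac)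
    then have "pt s ^ J * (po s ^ J * q) \<in> Q T" using q(1) by (simp only: inv mult_1_left)
    then have "po s ^ J * q \<in> V" by (rule Suc.IH)
    then show ?case unfolding h using V by (intro csubD(2,3)[OF V(1)])
  qed
qed

lemma Q_span:
  assumes "T \<subseteq> I" and V: "csub V" "\<And>j. t ^ j \<in> V" "\<And>i j. i \<in> T \<Longrightarrow> po i ^ Suc j \<in> V"
  shows "Q T \<subseteq> V"
proof -
  have fT: "finite T" using assms fin_I finite_subset by blast
  show ?thesis using fT assms(1) V(3)
  proof (induction T rule: finite_induct)
    case empty
    have tp: "t ^ n * \<phi> g \<in> V" for n g
    proof (induction g arbitrary: n)
      case (pCons c g)
      have "t ^ n * \<phi> (pCons c g) = \<kappa> c * t ^ n + t ^ Suc n * \<phi> g" by (simp add: algebra_simps)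
      then show ?case using V pCons.IH by (simp only: csubD)
    qed (simp add: csubD[OF V(1)])
    have "\<exists>g. h = \<phi> g" if "h \<in> Q {}" for h
      using Q_denominator[OF finite.emptyI that] by (simp add: ptprod_def)
    then show ?case using tp[of 0] by auto
  next
    case (insert s T)
    then show ?case by (intro Q_pole_span[OF _ _ _ V(1)]) auto
  qed
qed

lemma po_mult_po_power:
  assumes V: "csub V" "po l \<in> V" and il: "i \<in> I" "l \<in> I" "i \<noteq> l" and p: "\<And>j. j \<in> {1..n} \<Longrightarrow> po i ^ j \<in> V"
  shows "po l * po i ^ n \<in> V"
  using p
proof (induction n)
  case 0 then show ?case using V by simp
next
  case (Suc n)
  have "po l * po i ^ Suc n = \<kappa> (inverse (a i - a l)) * (po i ^ Suc n - po l * po i ^ n)"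
  proof -
    have "po l * po i ^ Suc n = (po l * po i) * po i ^ n" by simp
    then show ?thesis unfolding po_mult_po[OF il] by (simp add: algebra_simps)
  qed
  moreover have "po i ^ Suc n - po l * po i ^ n \<in> V"
  proof (rule csubD(5)[OF V(1)])
    show "po i ^ Suc n \<in> V" by (rule Suc.prems) simp
    show "po l * po i ^ n \<in> V" by (rule Suc.IH, rule Suc.prems) simp
  qed
  ultimately show ?case using V by (simp add: csubD)
qed

section \<open>Leading coefficients of the twisted derivation at the poles and at infinity\<close>

lemma nabla_po_power:
  assumes i: "i \<in> I"
  shows "\<nabla> (po i ^ n) = \<kappa> (\<gamma> i - of_nat n) * po i ^ Suc n + (\<Sum>l\<in>I-{i}. \<kappa> (\<gamma> l) * (po l * po i ^ n))"
  unfolding nabla_def sum.remove[OF fin_I i] \<delta>_po_power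
  by (simp add: \<kappa>_diff \<kappa>_of_nat algebra_simps sum_distrib_right sum_distrib_left)

text \<open>This is what the shift of integral exponents to 0 buys: a positive integral exponent
  would make the leading coefficient in \<open>nabla_po_power\<close> vanish, and the poles of that
  order would not be produced.\<close>

lemma \<gamma>_neq_of_nat:
  assumes "i \<in> I"
  shows "\<gamma> i - of_nat (Suc n) \<noteq> 0"
  using \<gamma>_cases[OF assms] by (metis Ints_of_nat diff_eq_diff_eq diff_zero of_nat_eq_0_iff old.nat.distinct(2) right_minus_eq)

text \<open>\<open>\<nabla>\<close> turns a pole of order \<open>n\<close> into one of order
  \<open>n + 1\<close> with nonzero leading coefficient, and partial fractions reduce the mixed
  products to poles that are already available.\<close>

lemma pole_step:
  assumes V: "csub V" and n: "\<And>f. f \<in> V \<Longrightarrow> \<nabla> f \<in> V" and p: "\<And>l. l \<in> \<gamma>supp \<Longrightarrow> po l \<in> V"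
    and i: "i \<in> I" "po i \<in> V"
  shows "po i ^ Suc j \<in> V"
proof (induction j rule: less_induct)
  case (less j)
  show ?case
  proof (cases j)
    case 0 then show ?thesis using i by simp
  next
    case (Suc n)
    have pw: "po i ^ k \<in> V" if k: "k \<in> {1..Suc n}" for k
    proof -
      obtain k' where "k = Suc k'" using k by (cases k) auto
      then show ?thesis using less[of k'] k Suc by simp
    qed
    have "(\<Sum>l\<in>I-{i}. \<kappa> (\<gamma> l) * (po l * po i ^ Suc n)) \<in> V"
    proof (rule csub_sum[OF V])
      fix l assume l: "l \<in> I - {i}"
      show "\<kappa> (\<gamma> l) * (po l * po i ^ Suc n) \<in> V"
      proof (cases "\<gamma> l = 0")
        case False
        then show ?thesis using l p[of l] pw by (intro csubD(3)[OF V] po_mult_po_power[OF V]) (auto simp: \<gamma>supp_def i)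
      qed (simp add: csubD[OF V])
    qed
    moreover have "\<nabla> (po i ^ Suc n) \<in> V" using pw[of "Suc n"] by (intro n) simp
    ultimately have "\<nabla> (po i ^ Suc n) - (\<Sum>l\<in>I-{i}. \<kappa> (\<gamma> l) * (po l * po i ^ Suc n)) \<in> V"
      by (intro csubD(5)[OF V])
    then have "\<kappa> (\<gamma> i - of_nat (Suc n)) * po i ^ Suc (Suc n) \<in> V"
      unfolding nabla_po_power[OF i(1)] add_diff_cancel_right' .
    then show ?thesis using csub_cancel[OF V _ \<gamma>_neq_of_nat[OF i(1)]] Suc by blast
  qed
qed

lemma t_power_po:
  assumes V: "csub V" and p: "po l \<in> V" and "\<And>j. j < n \<Longrightarrow> t ^ j \<in> V"
  shows "t ^ n * po l \<in> V"
  using assms(3)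
proof (induction n)
  case 0 then show ?case using p by simp
next
  case (Suc n)
  have "t ^ Suc n * po l = t ^ n + \<kappa> (a l) * (t ^ n * po l)"
  proof -
    have "t ^ Suc n * po l = t ^ n * (t * po l)" by simp
    then show ?thesis unfolding t_po by (simp add: algebra_simps)
  qed
  then show ?case using Suc V by (simp add: csubD)
qed

lemma t_power_Suc_po:
  assumes V: "csub V" and p: "po l \<in> V" and "\<And>j. j < n \<Longrightarrow> t ^ j \<in> V"
  shows "t ^ Suc n * po l - t ^ n \<in> V"
proof -
  have "t ^ Suc n * po l - t ^ n = \<kappa> (a l) * (t ^ n * po l)"
  proof -
    have "t ^ Suc n * po l = t ^ n * (t * po l)" by simp
    then show ?thesis unfolding t_po by (simp add: algebra_simps)
  qed
  then show ?thesis using t_power_po[OF assms] V by (simp add: csubD)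
qed

text \<open>\<open>\<nabla>\<close> acts on \<open>t\<^sup>n\<close> with exponent \<open>n + \<Sum>\<gamma>\<^sub>i\<close> at infinity.\<close>

lemma nabla_t_power:
  assumes V: "csub V" and p: "\<And>l. l \<in> \<gamma>supp \<Longrightarrow> po l \<in> V" and "\<And>j. j < n \<Longrightarrow> t ^ j \<in> V"
    and km: "k + m = Suc n"
  shows "t ^ k * \<nabla> (t ^ m) - \<kappa> (of_nat m + (\<Sum>i\<in>I. \<gamma> i)) * t ^ n \<in> V"
proof -
  have 1: "t ^ k * \<delta> (t ^ m) = \<kappa> (of_nat m) * t ^ n"
  proof (cases m)
    case 0 then show ?thesis by (simp add: \<delta>_simps)
  next
    case (Suc m') then show ?thesis using km
      by (simp only: \<delta>_power \<kappa>_of_nat \<delta>_t) (simp add: algebra_simps flip: power_add)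
  qed
  have "t ^ k * \<nabla> (t ^ m) = t ^ k * \<delta> (t ^ m) + t ^ (k + m) * (\<Sum>i\<in>I. \<kappa> (\<gamma> i) * po i)"
    by (simp add: nabla_def algebra_simps power_add)
  then have "t ^ k * \<nabla> (t ^ m) - \<kappa> (of_nat m + (\<Sum>i\<in>I. \<gamma> i)) * t ^ n =
      (\<Sum>i\<in>I. \<kappa> (\<gamma> i) * (t ^ Suc n * po i - t ^ n))"
    unfolding 1 km by (simp add: \<kappa>_add \<kappa>_sum algebra_simps sum_distrib_left sum_subtractf)
  also have "\<dots> \<in> V"
  proof (rule csub_sum[OF V])
    fix i assume "i \<in> I"
    then show "\<kappa> (\<gamma> i) * (t ^ Suc n * po i - t ^ n) \<in> V"
      using t_power_Suc_po[OF V p assms(3)] by (cases "\<gamma> i = 0") (auto simp: \<gamma>supp_def csubD[OF V])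
  qed
  finally show ?thesis .
qed

section \<open>Graded families\<close>

definition lam :: "int \<Rightarrow> complex" where "lam d = of_int d + ((\<Sum>i\<in>I. \<gamma> i) + \<omega>)"

lemma lam_Suc: "lam (d + 1) = lam d + 1"
  by (simp add: lam_def)

text \<open>The total exponent is 0 or not an integer, so the eigenvalue -2 can occur only in degree
  -2, and only when the total is 0.\<close>

lemma lam_neq: "lam 0 \<noteq> 0 \<or> d \<noteq> -2 \<Longrightarrow> lam d + 2 \<noteq> 0"
proof
  assume 1: "lam 0 \<noteq> 0 \<or> d \<noteq> -2" and 2: "lam d + 2 = 0"
  from 2 have 3: "(\<Sum>i\<in>I. \<gamma> i) + \<omega> = of_int (- d - 2)"
  proof -
    have "(\<Sum>i\<in>I. \<gamma> i) + \<omega> = (lam d + 2) - of_int d - 2" by (simp add: lam_def)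
    then show ?thesis unfolding 2 by simp
  qed
  then have "(\<Sum>i\<in>I. \<gamma> i) + \<omega> \<in> \<int>" by (metis Ints_of_int)
  then have 4: "(\<Sum>i\<in>I. \<gamma> i) + \<omega> = 0" using sum_cases by blast
  then have "of_int (- d - 2) = (0::complex)" using 3 by simp
  then have "d = -2" by (simp only: of_int_eq_0_iff)
  then show False using 1 4 by (simp add: lam_def)
qed

text \<open>\<open>P d\<close> is the part of degree \<open>d\<close> of a graded submodule, with \<open>u\<^sup>d\<close> divided out; the conditions say
  that it is stable under \<open>u\<close>, \<open>v\<close>, \<open>\<partial>\<^sub>v\<close> and \<open>\<partial>\<^sub>u\<close>.\<close>

definition graded :: "(int \<Rightarrow> 'k set) \<Rightarrow> bool" where
  "graded P \<longleftrightarrow> (\<forall>d. csub (P d) \<and> P d \<subseteq> P (d + 1) \<and>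
     (\<forall>h\<in>P d. t * h \<in> P (d + 1) \<and> \<nabla> h \<in> P (d - 1) \<and> \<kappa> (lam d) * h - t * \<nabla> h \<in> P (d - 1)))"

lemma gradedD:
  assumes "graded P"
  shows "csub (P d)" "h \<in> P d \<Longrightarrow> h \<in> P (d + 1)" "h \<in> P d \<Longrightarrow> t * h \<in> P (d + 1)"
    "h \<in> P d \<Longrightarrow> \<nabla> h \<in> P (d - 1)" "h \<in> P d \<Longrightarrow> \<kappa> (lam d) * h - t * \<nabla> h \<in> P (d - 1)"
  using assms by (auto simp: graded_def)

lemma graded_mono:
  assumes "graded P" "d \<le> e"
  shows "P d \<subseteq> P e"
  using assms(2)
proof (induction e rule: int_ge_induct)
  case (step e)
  then show ?case using gradedD(2)[OF assms(1)] by blast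
qed simp

lemma graded_nabla: "graded P \<Longrightarrow> h \<in> P d \<Longrightarrow> \<nabla> h \<in> P d"
  using gradedD(4)[of P h d] graded_mono[of P "d - 1" d] by auto

lemma graded_t_power: "graded P \<Longrightarrow> h \<in> P d \<Longrightarrow> t ^ n * h \<in> P (d + int n)"
proof (induction n)
  case (Suc n)
  then show ?case using gradedD(3)[of P "t ^ n * h" "d + int n"] by (simp add: algebra_simps)
qed simp

lemma graded_pt_power: "graded P \<Longrightarrow> h \<in> P d \<Longrightarrow> pt i ^ n * h \<in> P (d + int n)"
proof (induction n)
  case (Suc n)
  let ?h = "pt i ^ n * h"
  have P: "graded P" and h: "?h \<in> P (d + int n)" using Suc by auto
  have "t * ?h - \<kappa> (a i) * ?h \<in> P (d + int n + 1)"
    by (rule csubD(5)[OF gradedD(1)[OF P] gradedD(3)[OF P h] csubD(3)[OF gradedD(1)[OF P] gradedD(2)[OF P h]]])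
  then show ?case by (simp add: pt_def algebra_simps)
qed simp

text \<open>The relation \<open>\<partial>\<^sub>v v + \<partial>\<^sub>u u = \<lambda>\<^sub>d + 2\<close> in degree \<open>d\<close> recovers \<open>P d\<close> from \<open>P (d + 1)\<close>.\<close>

lemma graded_descent:
  assumes P: "graded P" and h: "h \<in> P (d + 1)" "t * h \<in> P (d + 1)" and l: "lam d + 2 \<noteq> 0"
  shows "h \<in> P d"
proof -
  have "\<nabla> (t * h) + (\<kappa> (lam (d + 1)) * h - t * \<nabla> h) \<in> P (d + 1 - 1)"
    by (intro csubD(2)[OF gradedD(1)[OF P]] gradedD(4,5)[OF P] h)
  moreover have "\<nabla> (t * h) + (\<kappa> (lam (d + 1)) * h - t * \<nabla> h) = \<kappa> (lam d + 2) * h"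
  proof -
    have "\<kappa> (lam d + 2) = \<kappa> (lam (d + 1)) + 1"
    proof -
      have "lam d + 2 = lam (d + 1) + 1" by (simp add: lam_Suc)
      then show ?thesis by (simp only: \<kappa>_add \<kappa>_1)
    qed
    then show ?thesis unfolding nabla_t_mult by (simp add: algebra_simps)
  qed
  ultimately show ?thesis using csub_cancel[OF gradedD(1)[OF P] _ l] by simp
qed

text \<open>The largest family that is \<open>Q T\<close> in the degrees \<open>\<ge> -1\<close> and \<open>W\<close> in degree \<open>-2\<close>.\<close>

definition fam :: "nat set \<Rightarrow> 'k set \<Rightarrow> int \<Rightarrow> 'k set" where
  "fam T W d = (if d \<ge> -1 then Q T else {h \<in> Q T. \<forall>j. int j \<le> -2 - d \<longrightarrow> t ^ j * h \<in> W})"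

lemma fam_subset_Q: "fam T W d \<subseteq> Q T"
  by (auto simp: fam_def)

lemma fam_minus_2: "W \<subseteq> Q T \<Longrightarrow> fam T W (-2) = W"
  by (auto simp: fam_def)

lemma fam_up:
  assumes "h \<in> fam T W d"
  shows "h \<in> fam T W (d + 1)" "t * h \<in> fam T W (d + 1)"
proof -
  show "h \<in> fam T W (d + 1)" using assms by (auto simp: fam_def split: if_splits)
  have hQ: "t * h \<in> Q T" by (rule Q_mult[OF Q_t subsetD[OF fam_subset_Q assms]])
  show "t * h \<in> fam T W (d + 1)"
  proof (cases "d + 1 \<ge> -1")
    case False
    have "t ^ j * (t * h) \<in> W" if "int j \<le> -2 - (d + 1)" for j
    proof -
      have "t ^ Suc j * h \<in> W" using assms that False by (auto simp: fam_def simp del: power_Suc split: if_splits)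
      then show ?thesis by (simp add: mult_ac)
    qed
    then show ?thesis using hQ False by (auto simp: fam_def)
  qed (use hQ in \<open>auto simp: fam_def\<close>)
qed

text \<open>Below degree -2 an element belongs to the family when all its monomial multiples of
  degree -2 lie in \<open>W\<close>. This survives \<partial>_u and \<partial>_v because commuting
  \<open>t ^ j\<close> past \<open>\<nabla>\<close> leaves such multiples and a value of
  \<open>\<nabla>\<close>, and \<open>W\<close> contains all these values. Without resonance degree
  -2 is not free, hence the alternative \<open>W = Q T\<close>.\<close>

lemma graded_fam:
  assumes T: "\<gamma>supp \<subseteq> T" and W: "csub W" "W \<subseteq> Q T" "\<And>f. f \<in> Q T \<Longrightarrow> \<nabla> f \<in> W"
    and c: "W = Q T \<or> lam 0 = 0"
  shows "graded (fam T W)"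
  unfolding graded_def
proof (intro allI conjI ballI subsetI)
  fix d
  show "csub (fam T W d)"
  proof (cases "d \<ge> -1")
    case False
    have e: "t ^ j * (\<kappa> c * f) \<in> W" if "t ^ j * f \<in> W" for j c f
      using csubD(3)[OF W(1) that, of c] by (simp add: mult.left_commute)
    show ?thesis unfolding csub_def
      using False e csubD(1-3)[OF csub_Q[of T]] csubD(1,2)[OF W(1)]
      by (auto simp: fam_def distrib_left)
  qed (auto simp: fam_def csub_Q)
  fix h assume h: "h \<in> fam T W d"
  show "h \<in> fam T W (d + 1)" "t * h \<in> fam T W (d + 1)" by (rule fam_up[OF h])+
  have hQ: "h \<in> Q T" using h fam_subset_Q by blast
  have nQ: "\<nabla> h \<in> Q T" by (rule Q_nabla[OF T hQ])
  have lQ: "\<kappa> (lam d) * h - t * \<nabla> h \<in> Q T" by (intro Q_simps hQ nQ)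
  have hW: "t ^ j * h \<in> W" if "int j \<le> -2 - d" for j
    using h that by (cases "d \<ge> -1") (auto simp: fam_def)
  show "\<nabla> h \<in> fam T W (d - 1)"
  proof (cases "d - 1 \<ge> -1")
    case False
    have "t ^ j * \<nabla> h \<in> W" if j: "int j \<le> -2 - (d - 1)" for j
    proof -
      have "of_nat j * t ^ (j - 1) * h \<in> W"
      proof (cases j)
        case (Suc i)
        have "\<kappa> (of_nat j) * (t ^ i * h) \<in> W" using j Suc by (intro csubD(3)[OF W(1)] hW) auto
        then show ?thesis using Suc by (simp add: \<kappa>_of_nat mult.assoc \<kappa>_add)
      qed (simp add: csubD(1)[OF W(1)])
      moreover have "\<nabla> (t ^ j * h) \<in> W" by (intro W(3) Q_simps Q_power hQ)
      ultimately show ?thesis using csubD(5)[OF W(1)] nabla_t_power_mult[of j h]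
        by (metis add_diff_cancel_left')
    qed
    then show ?thesis using nQ False by (auto simp: fam_def)
  qed (use nQ in \<open>auto simp: fam_def\<close>)
  show "\<kappa> (lam d) * h - t * \<nabla> h \<in> fam T W (d - 1)"
  proof (cases "d - 1 \<ge> -1 \<or> W = Q T")
    case True
    have "t ^ j * (\<kappa> (lam d) * h - t * \<nabla> h) \<in> Q T" for j by (rule Q.Q_mult[OF Q_power[OF Q_t] lQ])
    then show ?thesis using lQ True by (auto simp: fam_def)
  next
    case False
    then have l0: "lam 0 = 0" using c by blast
    then have ld: "lam d = of_int d" by (simp add: lam_def)
    have "t ^ j * (\<kappa> (lam d) * h - t * \<nabla> h) \<in> W" if j: "int j \<le> -2 - (d - 1)" for j
    proof -
      \<comment> \<open>The coefficient vanishes precisely for \<open>j = -1 - d\<close>, the one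
        exponent in this range about which the membership of \<open>h\<close> says nothing.\<close>
      have eq: "t ^ j * (\<kappa> (lam d) * h - t * \<nabla> h) = \<kappa> (of_int (d + int j + 1)) * (t ^ j * h) - \<nabla> (t ^ Suc j * h)"
        unfolding nabla_t_power_mult ld by (simp add: \<kappa>_add \<kappa>_of_nat algebra_simps)
      have "\<kappa> (of_int (d + int j + 1)) * (t ^ j * h) \<in> W"
      proof (cases "d + int j + 1 = 0")
        case True then show ?thesis by (simp add: csubD(1)[OF W(1)] del: of_int_add)
      next
        case False then show ?thesis using j by (intro csubD(3)[OF W(1)] hW) auto
      qed
      moreover have "\<nabla> (t ^ Suc j * h) \<in> W" by (rule W(3)[OF Q.Q_mult[OF Q_power[OF Q_t] hQ]])
      ultimately show ?thesis unfolding eq by (rule csubD(5)[OF W(1)])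
    qed
    then show ?thesis using lQ False by (auto simp: fam_def)
  qed
qed

lemma graded_Q: "\<gamma>supp \<subseteq> T \<Longrightarrow> graded (\<lambda>d. Q T)"
  by (auto simp: graded_def csub_Q intro: Q_simps Q_nabla)

text \<open>Repeated descent, which stops at degree -1 because the next step may be the resonant
  one.\<close>

lemma graded_Q_down:
  assumes P: "graded P" and D: "Q T \<subseteq> P D" and d: "-1 \<le> d"
  shows "Q T \<subseteq> P d"
proof (cases "D \<le> d")
  case True then show ?thesis using D graded_mono[OF P] by blast
next
  case False
  then have "d \<le> D" by simp
  then show ?thesis using d
  proof (induction d rule: int_le_induct)
    case base then show ?case using D by simp
  next
    case (step i)
    have 1: "Q T \<subseteq> P i" using step by simp
    show ?case
    proof
      fix h assume "h \<in> Q T"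
      then have "h \<in> P (i - 1 + 1)" "t * h \<in> P (i - 1 + 1)" using 1 Q_mult[OF Q_t] by auto
      moreover have "lam (i - 1) + 2 \<noteq> 0" using step.prems by (intro lam_neq) auto
      ultimately show "h \<in> P (i - 1)" by (rule graded_descent[OF P])
    qed
  qed
qed

text \<open>The least possible part of degree -2 of a family that reaches \<open>Q T\<close> in some
  degree. At resonance it consists of the values of \<partial>_v on degree -1; \<partial>_u gives
  nothing new, since \<open>lam (-1) = -1\<close> makes it
  \<open>h \<mapsto> - \<nabla> (t * h)\<close>. Otherwise the descent applies also here and gives
  all of \<open>Q T\<close>.\<close>

definition Wmin :: "nat set \<Rightarrow> 'k set" where
  "Wmin T = (if lam 0 = 0 then \<nabla> ` Q T else Q T)"

lemma csub_nabla_image: "csub (\<nabla> ` Q T)"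
  unfolding csub_def
proof (intro conjI ballI allI)
  show "0 \<in> \<nabla> ` Q T" using Q_0 by (auto intro!: image_eqI[of _ _ 0])
  fix f g c assume f: "f \<in> \<nabla> ` Q T"
  then obtain f' where f': "f = \<nabla> f'" "f' \<in> Q T" by blast
  show "\<kappa> c * f \<in> \<nabla> ` Q T" using f' by (auto simp flip: nabla_\<kappa>_mult intro: Q_simps)
  assume "g \<in> \<nabla> ` Q T"
  then obtain g' where g': "g = \<nabla> g'" "g' \<in> Q T" by blast
  show "f + g \<in> \<nabla> ` Q T" using f' g' by (auto simp flip: nabla_add intro: Q_simps)
qed

lemma Wmin_props:
  assumes "\<gamma>supp \<subseteq> T"
  shows "csub (Wmin T)" "Wmin T \<subseteq> Q T" "\<And>f. f \<in> Q T \<Longrightarrow> \<nabla> f \<in> Wmin T" "Wmin T = Q T \<or> lam 0 = 0"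
  using csub_nabla_image Q_nabla[OF assms] csub_Q by (auto simp: Wmin_def)

lemmas graded_fam_Wmin = graded_fam[OF _ Wmin_props]

lemma graded_Wmin_le:
  assumes P: "graded P" and D: "Q T \<subseteq> P D"
  shows "Wmin T \<subseteq> P (-2)"
proof
  fix h assume h: "h \<in> Wmin T"
  have 1: "Q T \<subseteq> P (-1)" by (rule graded_Q_down[OF P D]) simp
  show "h \<in> P (-2)"
  proof (cases "lam 0 = 0")
    case True
    then obtain f where "f \<in> Q T" "h = \<nabla> f" using h by (auto simp: Wmin_def)
    then show ?thesis using 1 gradedD(4)[OF P, of f "-1"] by auto
  next
    case False
    then have "h \<in> Q T" using h by (simp add: Wmin_def)
    then have "h \<in> P (-2 + 1)" "t * h \<in> P (-2 + 1)" using 1 Q_mult[OF Q_t] by auto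
    moreover have "lam (-2) + 2 \<noteq> 0" using False by (intro lam_neq) auto
    ultimately show ?thesis by (rule graded_descent[OF P])
  qed
qed

text \<open>Below degree -2 no eigenvalue is resonant, so the descent forces everything whose
  multiples by \<open>u\<close> and \<open>v\<close> are already present.\<close>

lemma fam_le:
  assumes P: "graded P" and D: "Q T \<subseteq> P D" and W: "W \<subseteq> P (-2)" "W \<subseteq> Q T"
  shows "fam T W \<le> P"
proof -
  have up: "fam T W d \<subseteq> P d" if "-1 \<le> d" for d
    using graded_Q_down[OF P D that] fam_subset_Q by blast
  have "fam T W d \<subseteq> P d" if "d \<le> -2" for d
    using that
  proof (induction d rule: int_le_induct)
    case base then show ?case using W by (simp add: fam_minus_2)
  next
    case (step i)
    show ?case
    proof
      fix h assume h: "h \<in> fam T W (i - 1)"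
      have "h \<in> P (i - 1 + 1)" "t * h \<in> P (i - 1 + 1)" using fam_up[OF h] step.IH by auto
      moreover have "lam (i - 1) + 2 \<noteq> 0" using step.hyps by (intro lam_neq) auto
      ultimately show "h \<in> P (i - 1)" by (rule graded_descent[OF P])
    qed
  qed
  then have "fam T W d \<subseteq> P d" for d using up by (cases "-1 \<le> d") auto
  then show ?thesis by (simp add: le_fun_def)
qed

section \<open>Minimal steps between families\<close>

definition family_covers :: "(int \<Rightarrow> 'k set) \<Rightarrow> (int \<Rightarrow> 'k set) \<Rightarrow> bool" where
  "family_covers P P' \<longleftrightarrow> graded P \<and> graded P' \<and> P < P' \<and> (\<forall>R. graded R \<longrightarrow> P < R \<longrightarrow> R \<le> P' \<longrightarrow> R = P')"

lemma strict_le_exD: "P < (R :: int \<Rightarrow> 'k set) \<Longrightarrow> \<exists>d h. h \<in> R d \<and> h \<notin> P d"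
  unfolding less_le_not_le le_fun_def by blast

text \<open>Multiplying by a power of \<open>pt s\<close> reduces \<open>h\<close> to a nonzero
  multiple of \<open>po s\<close> plus an element of \<open>Q T\<close>, and from
  \<open>po s\<close> the operator \<open>\<nabla>\<close> produces all higher poles without leaving
  the degree. Each factor \<open>pt s\<close> raises the degree by one, whence an unspecified
  \<open>D\<close>.\<close>

lemma Q_le_from_pole:
  assumes P: "graded P" and T: "\<gamma>supp \<subseteq> T" and s: "s \<in> I" "T \<subseteq> I" "s \<notin> T" and D: "Q T \<subseteq> P D"
    and h: "h \<in> P d" "h \<in> Q (insert s T)" "h \<notin> Q T"
  shows "\<exists>D. Q (insert s T) \<subseteq> P D"
proof -
  obtain J c q where q: "c \<noteq> 0" "q \<in> Q T" "pt s ^ Suc J * h = \<kappa> c + pt s * q"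
    using Q_principal[OF s h(2,3)] by blast
  have "po s * (pt s ^ Suc J * h) = po s * (\<kappa> c + pt s * q)" using q by simp
  then have e: "pt s ^ J * h = \<kappa> c * po s + q"
    by (simp add: algebra_simps) (simp add: mult.assoc[symmetric])
  define E where "E = max D (d + int J)"
  have QE: "Q T \<subseteq> P E" using D graded_mono[OF P, of D E] by (auto simp: E_def)
  have "pt s ^ J * h \<in> P E"
    using graded_pt_power[OF P h(1), of s J] graded_mono[OF P, of "d + int J" E] by (auto simp: E_def)
  then have "\<kappa> c * po s \<in> P E"
    unfolding e using csubD(5)[OF gradedD(1)[OF P], of "\<kappa> c * po s + q" E q] QE q(2) by auto
  then have po: "po s \<in> P E" using csub_cancel[OF gradedD(1)[OF P]] q(1) by blast
  have "po s ^ Suc j \<in> P E" for j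
  proof (rule pole_step[OF gradedD(1)[OF P] graded_nabla[OF P] _ s(1) po])
    show "po l \<in> P E" if "l \<in> \<gamma>supp" for l using that T QE Q_po by blast
  qed
  then show ?thesis using Q_pole_span[OF s gradedD(1)[OF P] QE] by blast
qed

text \<open>On a pole of order \<open>n\<close> at \<open>a s\<close> the operator
  \<open>\<nabla>\<close> has leading coefficient \<open>\<gamma> s - n\<close>, which is not 0, so
  it raises the order to \<open>n + 1\<close>. A value with at most a simple pole at
  \<open>a s\<close> therefore comes from a function regular there. The set \<open>T'\<close> leaves
  room for poles of the value at other points.\<close>

lemma nabla_pole:
  assumes s: "s \<in> I" "T \<subseteq> I" "s \<notin> T" and T': "T \<subseteq> T'" "T' \<subseteq> I" "s \<notin> T'" "\<gamma>supp - {s} \<subseteq> T'"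
    and f: "f \<in> Q (insert s T)" "pt s * \<nabla> f \<in> Q T'"
  shows "f \<in> Q T"
proof (rule ccontr)
  assume "f \<notin> Q T"
  then obtain J c q where q: "c \<noteq> 0" "q \<in> Q T" "pt s ^ Suc J * f = \<kappa> c + pt s * q"
    using Q_principal[OF s f(1)] by blast
  define e where "e = pt s ^ Suc J * f"
  have eQ: "e \<in> Q T" using q unfolding e_def by (auto intro: Q_simps Q_pt)
  have QQ: "Q T \<subseteq> Q T'" by (rule Q_mono[OF T'(1)])
  have 1: "pt s * \<nabla> e = of_nat (Suc J) * e + pt s * (pt s ^ J * (pt s * \<nabla> f))"
    unfolding e_def nabla_mult \<delta>_power by (simp add: algebra_simps)
  define R where "R = (\<Sum>l\<in>I-{s}. \<kappa> (\<gamma> l) * po l)"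
  have "\<kappa> (\<gamma> l) * po l \<in> Q T'" if "l \<in> I - {s}" for l
    using T' that by (cases "\<gamma> l = 0") (auto simp: \<gamma>supp_def Q_simps Q_po)
  then have R: "R \<in> Q T'" unfolding R_def by (rule Q_sum)
  have 2: "pt s * \<nabla> e = pt s * (\<delta> e + R * e) + \<kappa> (\<gamma> s) * e"
    unfolding nabla_def sum.remove[OF fin_I s(1)] R_def[symmetric]
    by (simp add: algebra_simps)
  define z where "z = pt s ^ J * (pt s * \<nabla> f) - (\<delta> e + R * e)"
  have zQ: "z \<in> Q T'" unfolding z_def
    by (rule csubD(5)[OF csub_Q Q_mult[OF Q_power[OF Q_pt] f(2)] Q_add[OF subsetD[OF QQ Q_\<delta>[OF eQ]] Q_mult[OF R subsetD[OF QQ eQ]]]])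
  \<comment> \<open>Comparison of the two expressions for \<open>pt s * \<nabla> e\<close>: the
    power of \<open>pt s\<close> contributes \<open>Suc J\<close>, the residue of the connection
    contributes \<open>\<gamma> s\<close>.\<close>
  have "\<kappa> (\<gamma> s - of_nat (Suc J)) * e = pt s * z"
    using 1 2 unfolding z_def \<kappa>_diff \<kappa>_of_nat by (simp add: algebra_simps)
  then have "po s * (\<kappa> (\<gamma> s - of_nat (Suc J)) * e) = z" by (simp flip: mult.assoc)
  then have "\<kappa> (\<gamma> s - of_nat (Suc J)) * (po s * e) = z" by (simp add: mult_ac)
  then have "\<kappa> (\<gamma> s - of_nat (Suc J)) * (po s * e) \<in> Q T'" using zQ by simp
  then have "po s * e \<in> Q T'" using csub_cancel[OF csub_Q _ \<gamma>_neq_of_nat[OF s(1)]] by blast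
  moreover have "po s * e = \<kappa> c * po s + q"
    using q(3) unfolding e_def[symmetric] by (simp add: algebra_simps)
  ultimately have "\<kappa> c * po s \<in> Q T'" using q(2) QQ csubD(5)[OF csub_Q, of "\<kappa> c * po s + q" T' q] by auto
  then have "po s \<in> Q T'" using csub_cancel[OF csub_Q] q(1) by blast
  then show False using po_notin_Q[OF s(1)] T' by blast
qed

text \<open>Anything above the smaller family brings a pole at \<open>a s\<close>, and one such pole
  generates the larger family.\<close>

lemma family_covers_line:
  assumes T: "\<gamma>supp \<subseteq> T" and s: "s \<in> I" "T \<subseteq> I" "s \<notin> T"
  shows "family_covers (fam T (Wmin T)) (fam (insert s T) (Wmin (insert s T)))"
  unfolding family_covers_def
proof (intro conjI allI impI)
  let ?T = "insert s T"
  have T': "\<gamma>supp \<subseteq> ?T" using T by auto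
  note g = graded_fam_Wmin[OF T] and g' = graded_fam_Wmin[OF T']
  have QQ: "Q T \<subseteq> Q ?T" by (rule Q_mono) auto
  show "graded (fam T (Wmin T))" "graded (fam ?T (Wmin ?T))" using g T g' T' by blast+
  have "Wmin T \<subseteq> Wmin ?T" using QQ by (auto simp: Wmin_def)
  then have le: "fam T (Wmin T) \<le> fam ?T (Wmin ?T)"
    using QQ by (auto simp: fam_def le_fun_def)
  have "po s \<in> fam ?T (Wmin ?T) 0" "po s \<notin> fam T (Wmin T) 0"
    using po_notin_Q[OF s] by (auto simp: fam_def intro: Q_po)
  then have "fam T (Wmin T) \<noteq> fam ?T (Wmin ?T)" by metis
  then show "fam T (Wmin T) < fam ?T (Wmin ?T)" using le by (simp add: order_less_le)
  fix R assume R: "graded R" "fam T (Wmin T) < R" "R \<le> fam ?T (Wmin ?T)"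
  obtain d h where h: "h \<in> R d" "h \<notin> fam T (Wmin T) d" using strict_le_exD[OF R(2)] by blast
  have h': "h \<in> fam ?T (Wmin ?T) d" using h R(3) by (auto simp: le_fun_def)
  have hQ: "h \<in> Q ?T" using h' fam_subset_Q by blast
  have "h \<notin> Q T"
  proof
    assume hT: "h \<in> Q T"
    then obtain j where d: "\<not> -1 \<le> d" and j: "int j \<le> -2 - d" "t ^ j * h \<notin> Wmin T" using h(2) by (auto simp: fam_def split: if_splits)
    have tQ: "t ^ j * h \<in> Q T" by (rule Q_mult[OF Q_power[OF Q_t] hT])
    then have l0: "lam 0 = 0" using j by (auto simp: Wmin_def split: if_splits)
    have "t ^ j * h \<in> Wmin ?T" using h' j d by (auto simp: fam_def split: if_splits)
    then obtain f where f: "f \<in> Q ?T" "t ^ j * h = \<nabla> f" using l0 by (auto simp: Wmin_def)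
    have "f \<in> Q T" by (rule nabla_pole[OF s subset_refl s(2,3) _ f(1)]) (use T tQ f in \<open>auto intro: Q_simps Q_pt\<close>)
    then show False using f j l0 by (auto simp: Wmin_def)
  qed
  moreover have "Q T \<subseteq> R 0" using le_funD[OF less_imp_le[OF R(2)], of 0] by (simp add: fam_def)
  ultimately obtain D where D: "Q ?T \<subseteq> R D" using Q_le_from_pole[OF R(1) T s _ h(1) hQ] by blast
  have "fam ?T (Wmin ?T) \<le> R"
    using fam_le[OF R(1) D graded_Wmin_le[OF R(1) D]] Wmin_props(2)[OF T'] by blast
  then show "R = fam ?T (Wmin ?T)" using R(3) by (rule antisym[rotated])
qed

text \<open>Every subspace between the values of \<open>\<nabla>\<close> and \<open>Q T\<close> is a
  possible part of degree -2, so one can climb one dimension at a time. A family strictly above the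
  lower one already differs from it in degree -2, because an element of lower degree fails to be in
  \<open>fam T W\<close> through one of its multiples there.\<close>

lemma family_covers_origin:
  assumes T: "\<gamma>supp \<subseteq> T" and W: "csub W" "\<And>f. f \<in> Q T \<Longrightarrow> \<nabla> f \<in> W" "W \<subseteq> Q T" and l0: "lam 0 = 0"
    and w: "w \<in> Q T" "w \<notin> W" and W': "W' = {x + \<kappa> c * w | x c. x \<in> W}"
  shows "family_covers (fam T W) (fam T W')"
  unfolding family_covers_def
proof (intro conjI allI impI)
  have WW: "W \<subseteq> W'"
  proof
    fix x assume "x \<in> W"
    then show "x \<in> W'" unfolding W' by (intro CollectI exI[of _ x] exI[of _ 0]) simp
  qed
  have wW: "w \<in> W'" unfolding W' using csubD(1)[OF W(1)] by (intro CollectI exI[of _ 0] exI[of _ 1]) simp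
  have W'Q: "W' \<subseteq> Q T" using W(3) w(1) by (auto simp: W' intro!: Q_simps)
  have cW': "csub W'" unfolding csub_def
  proof (intro conjI ballI allI)
    show "0 \<in> W'" using WW csubD(1)[OF W(1)] by blast
    fix f g b assume "f \<in> W'"
    then obtain x c where x: "f = x + \<kappa> c * w" "x \<in> W" unfolding W' by blast
    show "\<kappa> b * f \<in> W'" unfolding W' x
      by (intro CollectI exI[of _ "\<kappa> b * x"] exI[of _ "b * c"]) (use x csubD[OF W(1)] in \<open>simp add: algebra_simps \<kappa>_mult\<close>)
    assume "g \<in> W'"
    then obtain y d where y: "g = y + \<kappa> d * w" "y \<in> W" unfolding W' by blast
    show "f + g \<in> W'" unfolding x y unfolding W'
      by (intro CollectI exI[of _ "x + y"] exI[of _ "c + d"]) (use x y csubD[OF W(1)] in \<open>simp add: algebra_simps \<kappa>_add\<close>)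
  qed
  show "graded (fam T W)" "graded (fam T W')"
    using W WW l0 by (auto intro!: graded_fam T cW' W'Q)
  have le: "fam T W \<le> fam T W'" using WW by (auto simp: fam_def le_fun_def)
  have "fam T W (-2) \<noteq> fam T W' (-2)" using fam_minus_2 W(3) W'Q w wW by metis
  then have "fam T W \<noteq> fam T W'" by metis
  then show "fam T W < fam T W'" using le by (simp add: order_less_le)
  fix R assume R: "graded R" "fam T W < R" "R \<le> fam T W'"
  obtain d h where h: "h \<in> R d" "h \<notin> fam T W d" using strict_le_exD[OF R(2)] by blast
  have h': "h \<in> fam T W' d" using h R(3) by (auto simp: le_fun_def)
  then obtain j where j: "int j \<le> -2 - d" "t ^ j * h \<notin> W" "\<not> -1 \<le> d"
    using h(2) by (auto simp: fam_def split: if_splits)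
  have "t ^ j * h \<in> R (-2)" using graded_t_power[OF R(1) h(1), of j] graded_mono[OF R(1), of "d + int j" "-2"] j by auto
  moreover have "t ^ j * h \<in> W'" using h' j by (auto simp: fam_def)
  then obtain x c where x: "t ^ j * h = x + \<kappa> c * w" "x \<in> W" unfolding W' by blast
  moreover have WR: "W \<subseteq> R (-2)" using R(2) fam_minus_2[OF W(3)] unfolding less_le_not_le le_fun_def by blast
  ultimately have "\<kappa> c * w \<in> R (-2)"
    using csubD(5)[OF gradedD(1)[OF R(1)], of "x + \<kappa> c * w" "-2" x] by auto
  moreover have "c \<noteq> 0" using x j by auto
  ultimately have "w \<in> R (-2)" using csub_cancel[OF gradedD(1)[OF R(1)]] by blast
  then have W'R: "W' \<subseteq> R (-2)" using WR unfolding W' by (auto intro!: csubD(2,3)[OF gradedD(1)[OF R(1)]])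
  have "Q T \<subseteq> R (-1)" using le_funD[OF less_imp_le[OF R(2)], of "-1"] by (simp add: fam_def)
  then have "fam T W' \<le> R" using fam_le[OF R(1) _ W'R W'Q] by blast
  then show "R = fam T W'" using R(3) by (rule antisym[rotated])
qed

section \<open>The simple factor on the line punctured at the nonintegral points\<close>

lemma sum_\<gamma>supp: "(\<Sum>i\<in>I. \<kappa> (\<gamma> i) * po i) = (\<Sum>i\<in>\<gamma>supp. \<kappa> (\<gamma> i) * po i)"
  by (rule sum.mono_neutral_right[OF fin_I]) (auto simp: \<gamma>supp_def)

lemma nabla_1: "\<nabla> 1 = (\<Sum>i\<in>\<gamma>supp. \<kappa> (\<gamma> i) * po i)"
  by (simp add: nabla_def sum_\<gamma>supp \<delta>_simps)

lemma csub_\<phi>_mult: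
  assumes "csub U" "\<And>f. f \<in> U \<Longrightarrow> t * f \<in> U" "f \<in> U"
  shows "\<phi> g * f \<in> U"
proof (induction g)
  case 0 then show ?case using assms(1) by (simp add: csubD)
next
  case (pCons c g)
  have "\<phi> (pCons c g) * f = \<kappa> c * f + t * (\<phi> g * f)" by (simp add: algebra_simps)
  then show ?case using assms pCons by (simp add: csubD)
qed

lemma \<gamma>_nonint: "i \<in> \<gamma>supp \<Longrightarrow> \<gamma> i \<notin> \<int>"
  using \<gamma>_cases by (auto simp: \<gamma>supp_def)

text \<open>A generator of minimal degree of the polynomials in a \<open>\<nabla>\<close>-stable ideal cannot have a root, since no
  exponent is an integer.\<close>

lemma nabla_stable_contains_1:
  assumes U: "csub U" "\<And>f. f \<in> U \<Longrightarrow> t * f \<in> U" "\<And>f. f \<in> U \<Longrightarrow> \<nabla> f \<in> U"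
    and h: "h \<in> U" "h \<in> Q \<gamma>supp" "h \<noteq> 0"
  shows "1 \<in> U"
proof -
  have fin: "finite \<gamma>supp" using fin_I by (simp add: \<gamma>supp_def)
  have Up: "\<phi> g * f \<in> U" if "f \<in> U" for g f
    by (rule csub_\<phi>_mult[OF U(1,2) that])
  obtain n p where p: "\<phi> (ptprod \<gamma>supp ^ n) * h = \<phi> p" using Q_denominator[OF fin h(2)] by blast
  define A where "A = {g. g \<noteq> 0 \<and> \<phi> g \<in> U}"
  have "p \<in> A"
    unfolding A_def using p Up[OF h(1), of "ptprod \<gamma>supp ^ n"] h(3) \<phi>_eq_0_iff[of p]
    by (metis (mono_tags, lifting) mem_Collect_eq mult_eq_0_iff ptprod_nz \<phi>_eq_0_iff power_not_zero)
  then obtain g where g: "g \<in> A" "\<And>q. q \<in> A \<Longrightarrow> degree g \<le> degree q"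
    using ex_has_least_nat[of "\<lambda>q. q \<in> A" p degree] by blast
  have g0: "g \<noteq> 0" and gU: "\<phi> g \<in> U" using g by (auto simp: A_def)
  have gdvd: "g dvd q" if "\<phi> q \<in> U" for q
  proof (rule ccontr)
    assume "\<not> g dvd q"
    then have r: "q mod g \<noteq> 0" by (simp add: mod_eq_0_iff_dvd)
    have "\<phi> (q mod g) = \<phi> q - \<phi> (q div g) * \<phi> g"
      by (simp flip: \<phi>_mult \<phi>_diff add: minus_div_mult_eq_mod)
    also have "\<dots> \<in> U" using that Up[OF gU] by (intro csubD(5)[OF U(1)])
    finally have "q mod g \<in> A" using r by (simp add: A_def)
    then have "degree g \<le> degree (q mod g)" by (rule g(2))
    moreover have "degree (q mod g) < degree g" using r g0 degree_mod_less[of g q] by auto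
    ultimately show False by simp
  qed
  have "degree g = 0"
  proof (rule ccontr)
    assume "degree g \<noteq> 0"
    then obtain r where r: "poly g r = 0"
      using fundamental_theorem_of_algebra[of g] constant_degree[of g] by auto
    obtain g2 where g2: "g = [:- r, 1:] ^ Polynomial.order r g * g2" "\<not> [:- r, 1:] dvd g2"
      using Polynomial.order_decomp[OF g0] by blast
    have "Polynomial.order r g \<noteq> 0" using r g0 order_root by blast
    then obtain e where e: "Polynomial.order r g = Suc e" by (cases "Polynomial.order r g") auto
    define L where "L = [:- r, 1:]"
    have gL: "g = L ^ Suc e * g2" using g2 e L_def by simp
    define g1 where "g1 = L ^ e * g2"
    have gg1: "g = L * g1" by (simp add: gL g1_def)
    \<comment> \<open>At most one index, by injectivity of \<open>a\<close>: the puncture at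
      \<open>r\<close>, if there is one. Accordingly \<open>\<gamma>r\<close> is a nonintegral
      exponent or 0.\<close>
    define S where "S = {i \<in> \<gamma>supp. a i = r}"
    define S' where "S' = {i \<in> \<gamma>supp. a i \<noteq> r}"
    define \<gamma>r where "\<gamma>r = (\<Sum>i\<in>S. \<gamma> i)"
    have finS: "finite S" "finite S'" using fin by (auto simp: S_def S'_def)
    have SS: "\<gamma>supp = S \<union> S'" "S \<inter> S' = {}" by (auto simp: S_def S'_def)
    have card: "S = {} \<or> (\<exists>i. S = {i} \<and> i \<in> \<gamma>supp)"
    proof -
      have "i = j" if "i \<in> S" "j \<in> S" for i j
        using that inj_a by (auto simp: S_def \<gamma>supp_def dest: inj_onD)
      then show ?thesis by (metis (no_types, lifting) S_def insertI1 equals0I is_singletonI' is_singleton_def mem_Collect_eq)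
    qed
    have \<gamma>r: "\<gamma>r + of_nat (Suc e) \<noteq> 0"
    proof
      assume z: "\<gamma>r + of_nat (Suc e) = 0"
      show False
      proof (cases "S = {}")
        case True
        then have "(of_nat (Suc e) :: complex) = 0" using z by (simp add: \<gamma>r_def del: of_nat_Suc)
        then show False by (simp only: of_nat_eq_0_iff)
      next
        case False
        then obtain i where i: "S = {i}" "i \<in> \<gamma>supp" using card by blast
        then have "\<gamma> i + of_nat (Suc e) = 0" using z by (simp add: \<gamma>r_def del: of_nat_Suc)
        then have "\<gamma> i = - of_nat (Suc e)" by (simp add: add_eq_0_iff2)
        then show False using \<gamma>_nonint[OF i(2)] by (metis Ints_minus Ints_of_nat)
      qed
    qed
    \<comment> \<open>Clears the poles of \<open>\<nabla>\<close> away from \<open>r\<close>; a pole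
      at \<open>r\<close> is absorbed by the root of \<open>g\<close>.\<close>
    define R where "R = ptprod S'"
    have split: "(\<Sum>i\<in>I. \<kappa> (\<gamma> i) * po i) = (\<Sum>i\<in>S. \<kappa> (\<gamma> i) * po i) + (\<Sum>i\<in>S'. \<kappa> (\<gamma> i) * po i)"
    proof -
      have "(\<Sum>i\<in>I. \<kappa> (\<gamma> i) * po i) = (\<Sum>i\<in>\<gamma>supp. \<kappa> (\<gamma> i) * po i)" by (rule sum_\<gamma>supp)
      also have "\<dots> = (\<Sum>i\<in>S. \<kappa> (\<gamma> i) * po i) + (\<Sum>i\<in>S'. \<kappa> (\<gamma> i) * po i)"
        unfolding SS(1) by (rule sum.union_disjoint[OF finS SS(2)])
      finally show ?thesis .
    qed
    have "\<kappa> (\<gamma> i) * po i * \<phi> g = \<kappa> (\<gamma> i) * \<phi> g1" if "i \<in> S" for i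
    proof -
      have "\<phi> g = pt i * \<phi> g1" unfolding gg1 \<phi>_mult L_def using that by (simp add: S_def pt_def \<kappa>_minus)
      then show ?thesis by (simp add: mult.assoc[symmetric])
    qed
    then have 1: "(\<Sum>i\<in>S. \<kappa> (\<gamma> i) * po i) * \<phi> g = \<kappa> \<gamma>r * \<phi> g1"
      unfolding sum_distrib_right \<gamma>r_def \<kappa>_sum by (intro sum.cong refl)
    obtain B where 2: "\<phi> R * (\<Sum>i\<in>S'. \<kappa> (\<gamma> i) * po i) = \<phi> B"
      using ptprod_sum_po[OF finS(2)] unfolding R_def by blast
    have "\<phi> R * \<nabla> (\<phi> g) = \<phi> R * \<phi> (pderiv g) + \<phi> R * ((\<Sum>i\<in>S. \<kappa> (\<gamma> i) * po i) * \<phi> g)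
        + (\<phi> R * (\<Sum>i\<in>S'. \<kappa> (\<gamma> i) * po i)) * \<phi> g"
      unfolding nabla_def split \<delta>_\<phi> by (simp add: algebra_simps)
    also have "\<dots> = \<phi> (R * (pderiv g + smult \<gamma>r g1) + B * g)"
      unfolding 1 2 by (simp add: \<phi>_mult \<phi>_add \<phi>_smult algebra_simps)
    finally have "\<phi> (R * (pderiv g + smult \<gamma>r g1) + B * g) \<in> U"
      using Up[OF U(3)[OF gU], of R] by simp
    then have "g dvd R * (pderiv g + smult \<gamma>r g1) + B * g" by (rule gdvd)
    then have "g dvd R * (pderiv g + smult \<gamma>r g1)" by (simp add: dvd_add_left_iff)
    \<comment> \<open>The operator lowers the order of vanishing at \<open>r\<close> by exactly one,
      because the coefficient of \<open>g2\<close> is not 0. This will contradict the divisibility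
      by \<open>g\<close>.\<close>
    moreover have "pderiv g + smult \<gamma>r g1 = L ^ e * (smult (\<gamma>r + of_nat (Suc e)) g2 + L * pderiv g2)"
    proof -
      have "pderiv L = 1" by (simp add: L_def pderiv_pCons)
      then have "pderiv g = smult (of_nat (Suc e)) (L ^ e) * g2 + L ^ Suc e * pderiv g2"
        unfolding gL pderiv_mult pderiv_power_Suc by (simp add: algebra_simps)
      then show ?thesis unfolding g1_def by (simp add: algebra_simps smult_add_left)
    qed
    ultimately have "L ^ e * (L * g2) dvd L ^ e * (R * (smult (\<gamma>r + of_nat (Suc e)) g2 + L * pderiv g2))"
      unfolding gL by (simp only: mult_ac power_Suc)
    moreover have L0: "L ^ e \<noteq> 0" by (simp add: L_def)
    ultimately have "L * g2 dvd R * (smult (\<gamma>r + of_nat (Suc e)) g2 + L * pderiv g2)"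
      by (simp only: dvd_mult_cancel_left) simp
    then have "L dvd R * (smult (\<gamma>r + of_nat (Suc e)) g2 + L * pderiv g2)" by (rule dvd_mult_left)
    then have "poly (R * (smult (\<gamma>r + of_nat (Suc e)) g2 + L * pderiv g2)) r = 0"
      unfolding L_def by (simp only: poly_eq_0_iff_dvd)
    moreover have "poly R r \<noteq> 0" unfolding R_def using poly_ptprod_eq_0[OF finS(2), of r] by (auto simp: S'_def)
    moreover have "poly L r = 0" by (simp add: L_def)
    ultimately have "(\<gamma>r + of_nat (Suc e)) * poly g2 r = 0"
      by (simp only: poly_mult poly_add poly_smult mult_eq_0_iff) simp
    then have "poly g2 r = 0" using \<gamma>r by (simp only: mult_eq_0_iff) simp
    then show False using g2(2) by (simp add: poly_eq_0_iff_dvd)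
  qed
  then obtain c where c: "g = [:c:]" by (metis degree_eq_zeroE)
  then have "c \<noteq> 0" "\<kappa> c * 1 \<in> U" using g0 gU by auto
  then show ?thesis using csub_cancel[OF U(1)] by blast
qed

text \<open>The union over all degrees is stable under \<open>t\<close> and \<open>\<nabla>\<close>,
  hence contains 1 and the simple poles. The remaining work is to find everything in one single
  degree.\<close>

lemma Q_le_from_nonzero:
  assumes P: "graded P" "\<And>d. P d \<subseteq> Q \<gamma>supp" and h: "h \<in> P d" "h \<noteq> 0"
  shows "\<exists>D. Q \<gamma>supp \<subseteq> P D"
proof -
  have fin: "finite \<gamma>supp" using fin_I by (simp add: \<gamma>supp_def)
  define U where "U = (\<Union>d. P d)"
  have inU: "f \<in> P e \<Longrightarrow> f \<in> U" for f e by (auto simp: U_def)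
  have cU: "csub U" unfolding csub_def
  proof (intro conjI ballI allI)
    show "0 \<in> U" using csubD(1)[OF gradedD(1)[OF P(1)]] inU by blast
    fix f g c assume f: "f \<in> U"
    then obtain i where i: "f \<in> P i" by (auto simp: U_def)
    then show "\<kappa> c * f \<in> U" using csubD(3)[OF gradedD(1)[OF P(1)]] inU by blast
    assume "g \<in> U"
    then obtain j where j: "g \<in> P j" by (auto simp: U_def)
    have "f \<in> P (max i j)" "g \<in> P (max i j)" using i j graded_mono[OF P(1), of i "max i j"] graded_mono[OF P(1), of j "max i j"] by auto
    then show "f + g \<in> U" using csubD(2)[OF gradedD(1)[OF P(1)]] inU by blast
  qed
  have tU: "t * f \<in> U" if "f \<in> U" for f using that gradedD(3)[OF P(1)] by (auto simp: U_def)
  have nU: "\<nabla> f \<in> U" if "f \<in> U" for f using that gradedD(4)[OF P(1)] by (auto simp: U_def)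
  have one: "1 \<in> U"
    by (rule nabla_stable_contains_1[OF cU tU nU inU[OF h(1)] subsetD[OF P(2) h(1)] h(2)])
  have Up: "\<phi> g * f \<in> U" if "f \<in> U" for g f
    by (rule csub_\<phi>_mult[OF cU tU that])
  have U1: "\<phi> g \<in> U" for g using Up[OF one, of g] by simp
  have po: "po i \<in> U" if i: "i \<in> \<gamma>supp" for i
  proof -
    define T where "T = \<gamma>supp - {i}"
    have iI: "i \<in> I" "\<gamma> i \<noteq> 0" and TI: "T \<subseteq> I" "i \<notin> T" and finT: "finite T" using i fin by (auto simp: \<gamma>supp_def T_def)
    have sub: "\<nabla> 1 = \<kappa> (\<gamma> i) * po i + (\<Sum>l\<in>T. \<kappa> (\<gamma> l) * po l)"
      unfolding nabla_1 T_def by (rule sum.remove[OF fin i])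
    obtain B where 2: "\<phi> (ptprod T) * (\<Sum>l\<in>T. \<kappa> (\<gamma> l) * po l) = \<phi> B"
      using ptprod_sum_po[OF finT] by blast
    have "\<phi> (ptprod T) * \<nabla> 1 - \<phi> B \<in> U"
      by (intro csubD(5)[OF cU] Up nU one U1)
    also have "\<phi> (ptprod T) * \<nabla> 1 - \<phi> B = \<kappa> (\<gamma> i) * (\<phi> (ptprod T) * po i)"
      unfolding sub 2[symmetric] by (simp add: algebra_simps)
    finally have 3: "\<phi> (ptprod T) * po i \<in> U" using csub_cancel[OF cU _ iI(2)] by blast
    \<comment> \<open>The product of the other factors takes the nonzero value \<open>c\<close> at
      \<open>a i\<close>, so modulo polynomials it may be replaced by \<open>c\<close>.\<close>
    define c where "c = poly (ptprod T) (a i)"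
    have c0: "c \<noteq> 0" unfolding c_def using poly_ptprod_eq_0[OF finT] inj_a TI iI by (auto dest: inj_onD)
    have "poly (ptprod T - [:c:]) (a i) = 0" by (simp add: c_def)
    then have "[:- a i, 1:] dvd ptprod T - [:c:]" by (simp only: poly_eq_0_iff_dvd)
    then obtain q where q: "ptprod T - [:c:] = [:- a i, 1:] * q" by (rule dvdE)
    have "\<phi> (ptprod T) - \<kappa> c = pt i * \<phi> q"
    proof -
      have "\<phi> (ptprod T - [:c:]) = pt i * \<phi> q" unfolding q \<phi>_mult \<phi>_pt ..
      then show ?thesis by (simp add: \<phi>_diff)
    qed
    then have "(\<phi> (ptprod T) - \<kappa> c) * po i = \<phi> q * (pt i * po i)" by simp
    then have "\<kappa> c * po i = \<phi> (ptprod T) * po i - \<phi> q" by (simp add: algebra_simps)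
    also have "\<dots> \<in> U" by (rule csubD(5)[OF cU 3 U1])
    finally show ?thesis using csub_cancel[OF cU _ c0] by blast
  qed
  \<comment> \<open>The parts grow with the degree, so finitely many elements share one. The powers
    of \<open>t\<close> are infinitely many and have to be produced inside that degree.\<close>
  have "\<exists>D. \<forall>f\<in>F. f \<in> P D" if "finite F" "F \<subseteq> U" for F
    using that
  proof (induction F rule: finite_induct)
    case (insert f F)
    then obtain D E where "\<forall>f\<in>F. f \<in> P D" "f \<in> P E" by (auto simp: U_def)
    then have "\<forall>f\<in>insert f F. f \<in> P (max D E)"
      using graded_mono[OF P(1), of D "max D E"] graded_mono[OF P(1), of E "max D E"] by auto
    then show ?case by blast
  qed simp
  from this[of "insert 1 (po ` \<gamma>supp)"] obtain D where D: "\<forall>f\<in>insert 1 (po ` \<gamma>supp). f \<in> P D"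
    using one po fin by auto
  note cD = gradedD(1)[OF P(1), of D]
  have poD: "po i \<in> P D" if "i \<in> \<gamma>supp" for i using D that by auto
  have tD: "t ^ n \<in> P D" for n
  proof (induction n rule: less_induct)
    case (less n)
    show ?case
    proof (cases n)
      case 0 then show ?thesis using D by simp
    next
      case (Suc m)
      have tm: "t ^ m \<in> P D" using less Suc by simp
      \<comment> \<open>This is the operator \<open>v * \<partial>_u\<close>, which preserves the
        degree. Modulo known elements it sends \<open>t ^ m\<close> to
        \<open>D + \<omega> - m\<close> times \<open>t ^ Suc m\<close>, and this factor is nonzero
        because the line at infinity has nonintegral exponent.\<close>
      have "t * (\<kappa> (lam D) * t ^ m - t * \<nabla> (t ^ m)) \<in> P (D - 1 + 1)"
        by (intro gradedD(3)[OF P(1)] gradedD(5)[OF P(1)] tm)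
      then have 1: "t * (\<kappa> (lam D) * t ^ m - t * \<nabla> (t ^ m)) \<in> P D" by simp
      have 2: "t ^ 2 * \<nabla> (t ^ m) - \<kappa> (of_nat m + (\<Sum>i\<in>I. \<gamma> i)) * t ^ n \<in> P D"
        by (rule nabla_t_power[OF cD poD less]) (use Suc in auto)
      have "t * (\<kappa> (lam D) * t ^ m - t * \<nabla> (t ^ m)) + (t ^ 2 * \<nabla> (t ^ m) - \<kappa> (of_nat m + (\<Sum>i\<in>I. \<gamma> i)) * t ^ n)
         = \<kappa> (lam D - (of_nat m + (\<Sum>i\<in>I. \<gamma> i))) * t ^ n"
        unfolding Suc \<kappa>_diff by (simp add: algebra_simps power2_eq_square)
      then have 3: "\<kappa> (lam D - (of_nat m + (\<Sum>i\<in>I. \<gamma> i))) * t ^ n \<in> P D"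
        using csubD(2)[OF cD 1 2] by simp
      have "lam D - (of_nat m + (\<Sum>i\<in>I. \<gamma> i)) \<noteq> 0"
      proof
        assume "lam D - (of_nat m + (\<Sum>i\<in>I. \<gamma> i)) = 0"
        then have "\<omega> = of_nat m - of_int D" by (simp add: lam_def algebra_simps)
        then show False using \<omega>_nonint by simp
      qed
      then show ?thesis using csub_cancel[OF cD 3] by blast
    qed
  qed
  have "po i ^ Suc j \<in> P D" if "i \<in> \<gamma>supp" for i j
    by (rule pole_step[OF cD graded_nabla[OF P(1)] poD _ poD[OF that]]) (use that in \<open>auto simp: \<gamma>supp_def\<close>)
  then have "Q \<gamma>supp \<subseteq> P D" by (intro Q_span[OF _ cD tD]) (auto simp: \<gamma>supp_def)
  then show ?thesis by blast
qed

lemma family_covers_generic: "family_covers (\<lambda>d. {0}) (fam \<gamma>supp (Wmin \<gamma>supp))"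
  unfolding family_covers_def
proof (intro conjI allI impI)
  show "graded (\<lambda>d. {0})" by (auto simp: graded_def csub_def)
  show gf: "graded (fam \<gamma>supp (Wmin \<gamma>supp))" using graded_fam_Wmin[of \<gamma>supp] by blast
  have le: "(\<lambda>d. {0}) \<le> fam \<gamma>supp (Wmin \<gamma>supp)"
    using csubD(1)[OF gradedD(1)[OF gf]] by (auto simp: le_fun_def)
  have "1 \<in> fam \<gamma>supp (Wmin \<gamma>supp) 0" by (simp add: fam_def Q_1)
  then have "(\<lambda>d. {0}) \<noteq> fam \<gamma>supp (Wmin \<gamma>supp)" by (metis singletonD zero_neq_one)
  then show "(\<lambda>d. {0}) < fam \<gamma>supp (Wmin \<gamma>supp)" using le by (simp add: order_less_le)
  fix R assume R: "graded R" "(\<lambda>d. {0}) < R" "R \<le> fam \<gamma>supp (Wmin \<gamma>supp)"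
  obtain d h where h: "h \<in> R d" "h \<noteq> 0" using strict_le_exD[OF R(2)] by blast
  have "R d \<subseteq> Q \<gamma>supp" for d using R(3) fam_subset_Q unfolding le_fun_def by blast
  then obtain D where D: "Q \<gamma>supp \<subseteq> R D" using Q_le_from_nonzero[OF R(1) _ h] by blast
  have "fam \<gamma>supp (Wmin \<gamma>supp) \<le> R"
    using fam_le[OF R(1) D graded_Wmin_le[OF R(1) D]] Wmin_props(2)[OF subset_refl] by blast
  then show "R = fam \<gamma>supp (Wmin \<gamma>supp)" using R(3) by (rule antisym[rotated])
qed

text \<open>Simple poles at all points but one of \<open>\<gamma>supp\<close> form a basis of the twisted de Rham cohomology of the
  punctured line.\<close>

definition Wpoles :: "nat set \<Rightarrow> 'k set" where
  "Wpoles J = {\<nabla> f + (\<Sum>i\<in>J. \<kappa> (c i) * po i) | f c. f \<in> Q I}"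

lemma Wpoles_empty: "Wpoles {} = \<nabla> ` Q I"
  by (auto simp: Wpoles_def)

lemma Wpoles_insert:
  assumes "finite J" "s \<notin> J"
  shows "Wpoles (insert s J) = {x + \<kappa> c * po s | x c. x \<in> Wpoles J}"
proof safe
  fix x assume "x \<in> Wpoles (insert s J)"
  then obtain f c where *: "x = \<nabla> f + (\<Sum>i\<in>insert s J. \<kappa> (c i) * po i)" "f \<in> Q I" unfolding Wpoles_def by blast
  then have "x = (\<nabla> f + (\<Sum>i\<in>J. \<kappa> (c i) * po i)) + \<kappa> (c s) * po s" using assms by (simp add: algebra_simps)
  then show "\<exists>y c. x = y + \<kappa> c * po s \<and> y \<in> Wpoles J" unfolding Wpoles_def using *(2) by blast
next
  fix y c assume "y \<in> Wpoles J"
  then obtain f b where *: "y = \<nabla> f + (\<Sum>i\<in>J. \<kappa> (b i) * po i)" "f \<in> Q I" unfolding Wpoles_def by blast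
  have "(\<Sum>i\<in>J. \<kappa> (b i) * po i) = (\<Sum>i\<in>J. \<kappa> ((b(s := c)) i) * po i)"
    using assms by (intro sum.cong) auto
  then have "y + \<kappa> c * po s = \<nabla> f + (\<Sum>i\<in>insert s J. \<kappa> ((b(s := c)) i) * po i)"
    using assms * by (simp add: algebra_simps)
  then show "y + \<kappa> c * po s \<in> Wpoles (insert s J)" unfolding Wpoles_def using *(2) by blast
qed

lemma csub_Wpoles: "csub (Wpoles J)"
  unfolding csub_def
proof (intro conjI ballI allI)
  show "0 \<in> Wpoles J" unfolding Wpoles_def
    by (intro CollectI exI[of _ 0] exI[of _ "\<lambda>_. 0"]) (simp add: Q_0)
  fix x y b assume "x \<in> Wpoles J"
  then obtain f c where x: "x = \<nabla> f + (\<Sum>i\<in>J. \<kappa> (c i) * po i)" "f \<in> Q I" unfolding Wpoles_def by blast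
  show "\<kappa> b * x \<in> Wpoles J" unfolding Wpoles_def
    by (intro CollectI exI[of _ "\<kappa> b * f"] exI[of _ "\<lambda>i. b * c i"])
      (simp add: x Q_mult Q_\<kappa> nabla_\<kappa>_mult \<kappa>_mult distrib_left mult.assoc sum_distrib_left)
  assume "y \<in> Wpoles J"
  then obtain g d where y: "y = \<nabla> g + (\<Sum>i\<in>J. \<kappa> (d i) * po i)" "g \<in> Q I" unfolding Wpoles_def by blast
  show "x + y \<in> Wpoles J" unfolding Wpoles_def
    by (intro CollectI exI[of _ "f + g"] exI[of _ "\<lambda>i. c i + d i"])
      (simp add: x y Q_add nabla_add \<kappa>_add algebra_simps sum.distrib)
qed

lemma \<gamma>supp_I: "\<gamma>supp \<subseteq> I" by (auto simp: \<gamma>supp_def)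

lemma Wpoles_nabla: "f \<in> Q I \<Longrightarrow> \<nabla> f \<in> Wpoles J"
  unfolding Wpoles_def by (intro CollectI exI[of _ f] exI[of _ "\<lambda>_. 0"]) simp

lemma Wpoles_po:
  assumes "finite J" "s \<in> J"
  shows "po s \<in> Wpoles J"
proof -
  have "(\<Sum>i\<in>J. \<kappa> (if i = s then 1 else 0) * po i) = (\<Sum>i\<in>J. if i = s then po i else 0)"
    by (intro sum.cong) auto
  then have "po s = \<nabla> 0 + (\<Sum>i\<in>J. \<kappa> (if i = s then 1 else 0) * po i)" using assms by simp
  then show ?thesis unfolding Wpoles_def
    by (intro CollectI exI[of _ 0] exI[of _ "\<lambda>i. if i = s then 1 else 0"] conjI Q_0)
qed

lemma Wpoles_subset_Q: "J \<subseteq> I \<Longrightarrow> Wpoles J \<subseteq> Q I"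
  unfolding Wpoles_def using Q_nabla[OF \<gamma>supp_I] by (auto intro!: Q_add Q_sum Q_mult Q_\<kappa> Q_po)

lemma sum_\<gamma>_nonint: "lam 0 = 0 \<Longrightarrow> (\<Sum>i\<in>I. \<gamma> i) \<notin> \<int>"
  using \<omega>_nonint by (metis Ints_minus add.commute add_eq_0_iff lam_def of_int_0 add_0)

text \<open>The relation among the simple poles given by \<open>\<nabla> 1\<close> is solved for the
  pole at \<open>r\<close>, whose exponent is not 0. Higher poles come from
  \<open>pole_step\<close>, and \<open>t ^ n\<close> comes from \<open>\<nabla> (t ^ Suc n)\<close>,
  whose leading coefficient is nonzero since the sum of the \<open>\<gamma> i\<close> equals
  \<open>- \<omega>\<close>.\<close>

lemma Wpoles_top:
  assumes l0: "lam 0 = 0" and r: "r \<in> \<gamma>supp"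
  shows "Wpoles (I - {r}) = Q I"
proof
  let ?V = "Wpoles (I - {r})"
  show "?V \<subseteq> Q I" by (rule Wpoles_subset_Q) auto
  have fin: "finite \<gamma>supp" using fin_I by (simp add: \<gamma>supp_def)
  note V = csub_Wpoles[of "I - {r}"]
  have n: "\<nabla> f \<in> ?V" if "f \<in> ?V" for f
    using that \<open>?V \<subseteq> Q I\<close> by (auto intro: Wpoles_nabla)
  have po1: "po l \<in> ?V" if "l \<in> I" "l \<noteq> r" for l
    using that fin_I by (intro Wpoles_po) auto
  have "\<nabla> 1 = (\<Sum>l\<in>\<gamma>supp. \<kappa> (\<gamma> l) * po l)" by (rule nabla_1)
  also have "\<dots> = \<kappa> (\<gamma> r) * po r + (\<Sum>l\<in>\<gamma>supp - {r}. \<kappa> (\<gamma> l) * po l)"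
    by (rule sum.remove[OF fin r])
  finally have "\<kappa> (\<gamma> r) * po r = \<nabla> 1 - (\<Sum>l\<in>\<gamma>supp - {r}. \<kappa> (\<gamma> l) * po l)" by simp
  also have "\<dots> \<in> ?V"
    using \<gamma>supp_I by (intro csubD(5)[OF V] Wpoles_nabla Q_1 csub_sum[OF V] csubD(3)[OF V] po1) auto
  finally have "po r \<in> ?V" using csub_cancel[OF V] r by (auto simp: \<gamma>supp_def)
  then have po: "po l \<in> ?V" if "l \<in> I" for l using po1 that by (cases "l = r") auto
  have t: "t ^ n \<in> ?V" for n
  proof (induction n rule: less_induct)
    case (less n)
    have "t ^ 0 * \<nabla> (t ^ Suc n) - \<kappa> (of_nat (Suc n) + (\<Sum>i\<in>I. \<gamma> i)) * t ^ n \<in> ?V"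
      by (rule nabla_t_power[OF V _ less]) (use po \<gamma>supp_I in auto)
    moreover have "t ^ 0 * \<nabla> (t ^ Suc n) \<in> ?V" unfolding power_0 mult_1_left by (rule Wpoles_nabla[OF Q_power[OF Q_t]])
    ultimately have "\<kappa> (of_nat (Suc n) + (\<Sum>i\<in>I. \<gamma> i)) * t ^ n \<in> ?V"
      using csubD(5)[OF V, of "t ^ 0 * \<nabla> (t ^ Suc n)" "t ^ 0 * \<nabla> (t ^ Suc n) - \<kappa> (of_nat (Suc n) + (\<Sum>i\<in>I. \<gamma> i)) * t ^ n"]
      by (simp only: diff_diff_eq2 add_diff_cancel_left')
    moreover have "of_nat (Suc n) + (\<Sum>i\<in>I. \<gamma> i) \<noteq> 0"
      using sum_\<gamma>_nonint[OF l0] by (metis Ints_minus Ints_of_nat add_eq_0_iff)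
    ultimately show ?case using csub_cancel[OF V] by blast
  qed
  have "po i ^ Suc j \<in> ?V" if "i \<in> I" for i j
    by (rule pole_step[OF V n _ that po[OF that]]) (use po \<gamma>supp_I in auto)
  then show "Q I \<subseteq> ?V" by (intro Q_span[OF subset_refl V t])
qed

lemma po_independent:
  assumes "(\<Sum>i\<in>I. \<kappa> (c i) * po i) \<in> Q {}" and s: "s \<in> I"
  shows "c s = 0"
proof (rule ccontr)
  assume "c s \<noteq> 0"
  have "\<kappa> (c s) * po s = (\<Sum>i\<in>I. \<kappa> (c i) * po i) - (\<Sum>i\<in>I - {s}. \<kappa> (c i) * po i)"
    using sum.remove[OF fin_I s, of "\<lambda>i. \<kappa> (c i) * po i"] by simp
  also have "\<dots> \<in> Q (I - {s})"
    by (rule csubD(5)[OF csub_Q subsetD[OF Q_mono[OF empty_subsetI] assms(1)]])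
      (intro Q_sum Q_mult Q_\<kappa> Q_po)
  finally have "po s \<in> Q (I - {s})" using csub_cancel[OF csub_Q] \<open>c s \<noteq> 0\<close> by blast
  then show False using po_notin_Q[OF s, of "I - {s}"] by blast
qed

text \<open>A finite pole of \<open>f\<close> would give \<open>\<nabla> f\<close> a pole of order
  at least 2, by \<open>nabla_pole\<close>. A positive degree at infinity would leave a polynomial
  term in \<open>\<nabla> f\<close>, since the sum of the \<open>\<gamma> i\<close> is not an
  integer.\<close>

lemma exact_simple_poles:
  assumes l0: "lam 0 = 0" and f: "f \<in> Q I" "\<nabla> f = (\<Sum>i\<in>I. \<kappa> (c i) * po i)"
  shows "\<exists>b. f = \<kappa> b"
proof -
  have "f \<in> Q {}"
  proof -
    have "f \<in> Q T \<Longrightarrow> f \<in> Q {}" if "finite T" "T \<subseteq> I" for T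
      using that
    proof (induction T rule: finite_induct)
      case (insert s T)
      have "pt s * \<nabla> f = \<kappa> (c s) + pt s * (\<Sum>i\<in>I - {s}. \<kappa> (c i) * po i)"
        unfolding f(2) using insert.prems sum.remove[OF fin_I, of s "\<lambda>i. \<kappa> (c i) * po i"]
        by (simp add: algebra_simps)
      also have "\<dots> \<in> Q (I - {s})" by (intro Q_add Q_\<kappa> Q_mult Q_pt Q_sum Q_po) auto
      finally have "f \<in> Q T"
        by (intro nabla_pole[of s T "I - {s}"]) (use insert \<gamma>supp_I in auto)
      then show ?case using insert by auto
    qed auto
    then show ?thesis using f(1) fin_I by blast
  qed
  then obtain g where g: "f = \<phi> g"
    using Q_denominator[of "{}" f] by (auto simp: ptprod_def)
  have "degree g = 0"
  proof (rule ccontr)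
    assume "degree g \<noteq> 0"
    then obtain n where n: "degree g = Suc n" by (cases "degree g") auto
    \<comment> \<open>Simple finite poles plus polynomials of degree below \<open>n\<close>. For
      \<open>f\<close> of degree \<open>Suc n\<close> the element
      \<open>\<nabla> (t ^ Suc n)\<close> would lie in \<open>V\<close>, although its coefficient at
      \<open>t ^ n\<close> is not 0.\<close>
    define V where "V = {\<phi> p + (\<Sum>i\<in>I. \<kappa> (d i) * po i) | p d. \<forall>j\<ge>n. coeff p j = 0}"
    have V: "csub V" unfolding csub_def
    proof (intro conjI ballI allI)
      show "0 \<in> V" unfolding V_def
        by (intro CollectI exI[of _ 0] exI[of _ "\<lambda>_. 0"]) simp
      fix x y b assume "x \<in> V"
      then obtain p d where x: "x = \<phi> p + (\<Sum>i\<in>I. \<kappa> (d i) * po i)" "\<forall>j\<ge>n. coeff p j = 0" unfolding V_def by blast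
      show "\<kappa> b * x \<in> V" unfolding V_def
        by (intro CollectI exI[of _ "smult b p"] exI[of _ "\<lambda>i. b * d i"])
          (simp add: x \<phi>_smult \<kappa>_mult algebra_simps sum_distrib_left)
      assume "y \<in> V"
      then obtain q e where y: "y = \<phi> q + (\<Sum>i\<in>I. \<kappa> (e i) * po i)" "\<forall>j\<ge>n. coeff q j = 0" unfolding V_def by blast
      show "x + y \<in> V" unfolding V_def
        by (intro CollectI exI[of _ "p + q"] exI[of _ "\<lambda>i. d i + e i"])
          (simp add: x y \<phi>_add \<kappa>_add algebra_simps sum.distrib)
    qed
    have \<phi>V: "\<phi> p \<in> V" if "\<forall>j\<ge>n. coeff p j = 0" for p unfolding V_def
      using that by (intro CollectI exI[of _ p] exI[of _ "\<lambda>_. 0"]) simp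
    have sV: "(\<Sum>i\<in>I. \<kappa> (d i) * po i) \<in> V" for d unfolding V_def
      by (intro CollectI exI[of _ 0] exI[of _ d]) simp
    have poV: "po l \<in> V" if "l \<in> I" for l
    proof -
      have "(\<Sum>i\<in>I. \<kappa> (if i = l then 1 else 0) * po i) = (\<Sum>i\<in>I. if i = l then po i else 0)"
        by (intro sum.cong) auto
      then have "po l = (\<Sum>i\<in>I. \<kappa> (if i = l then 1 else 0) * po i)" using that fin_I by simp
      then show ?thesis using sV by metis
    qed
    have \<phi>m: "t ^ j = \<phi> (monom 1 j)" for j by (induction j) (auto simp: monom_Suc)
    have tV: "t ^ j \<in> V" if "j < n" for j unfolding \<phi>m using that by (intro \<phi>V) auto
    have ntV: "\<nabla> (t ^ m) \<in> V" if m: "m \<le> n" for m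
    proof (cases m)
      case 0
      have "\<nabla> 1 = (\<Sum>l\<in>I. \<kappa> (\<gamma> l) * po l)" by (simp add: nabla_def \<delta>_simps)
      then show ?thesis using 0 sV by simp
    next
      case (Suc m')
      have "t ^ 0 * \<nabla> (t ^ m) - \<kappa> (of_nat m + (\<Sum>i\<in>I. \<gamma> i)) * t ^ m' \<in> V"
        by (rule nabla_t_power[OF V]) (use poV \<gamma>supp_I tV Suc m in auto)
      moreover have "\<kappa> (of_nat m + (\<Sum>i\<in>I. \<gamma> i)) * t ^ m' \<in> V"
        using tV[of m'] Suc m by (intro csubD(3)[OF V]) auto
      ultimately show ?thesis using csubD(2)[OF V] by fastforce
    qed
    have "\<phi> g = \<phi> (\<Sum>m\<le>Suc n. monom (coeff g m) m)"
      using poly_as_sum_of_monoms[of g] n by simp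
    also have "\<dots> = (\<Sum>m\<le>Suc n. \<kappa> (coeff g m) * t ^ m)"
      unfolding \<phi>_sum \<phi>m by (simp add: \<phi>_smult[symmetric] smult_monom)
    finally have gs: "f = (\<Sum>m\<le>n. \<kappa> (coeff g m) * t ^ m) + \<kappa> (coeff g (Suc n)) * t ^ Suc n" using g by simp
    have nsum: "\<nabla> (\<Sum>m\<in>A. h m) = (\<Sum>m\<in>A. \<nabla> (h m))" for A and h :: "nat \<Rightarrow> 'k"
      by (induction A rule: infinite_finite_induct) (auto simp: nabla_add)
    have "\<kappa> (coeff g (Suc n)) * \<nabla> (t ^ Suc n) = \<nabla> f - (\<Sum>m\<le>n. \<kappa> (coeff g m) * \<nabla> (t ^ m))"
      unfolding gs nabla_add nsum nabla_\<kappa>_mult by simp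
    also have "\<dots> \<in> V" unfolding f(2)
      using ntV by (intro csubD(5)[OF V] sV csub_sum[OF V] csubD(3)[OF V]) auto
    finally have "\<nabla> (t ^ Suc n) \<in> V" using csub_cancel[OF V] n by (metis leading_coeff_0_iff degree_0 nat.distinct(1))
    moreover have "t ^ 0 * \<nabla> (t ^ Suc n) - \<kappa> (of_nat (Suc n) + (\<Sum>i\<in>I. \<gamma> i)) * t ^ n \<in> V"
      by (rule nabla_t_power[OF V]) (use poV \<gamma>supp_I tV in auto)
    ultimately have "\<kappa> (of_nat (Suc n) + (\<Sum>i\<in>I. \<gamma> i)) * t ^ n \<in> V"
      using csubD(5)[OF V, of "\<nabla> (t ^ Suc n)" "t ^ 0 * \<nabla> (t ^ Suc n) - \<kappa> (of_nat (Suc n) + (\<Sum>i\<in>I. \<gamma> i)) * t ^ n"]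
      by (simp only: power_0 mult_1_left diff_diff_eq2 add_diff_cancel_left')
    moreover have "of_nat (Suc n) + (\<Sum>i\<in>I. \<gamma> i) \<noteq> 0"
      using sum_\<gamma>_nonint[OF l0] by (metis Ints_minus Ints_of_nat add_eq_0_iff)
    ultimately have "t ^ n \<in> V" using csub_cancel[OF V] by blast
    then obtain p d where p: "t ^ n = \<phi> p + (\<Sum>i\<in>I. \<kappa> (d i) * po i)" "\<forall>j\<ge>n. coeff p j = 0" unfolding V_def by blast
    then have "(\<Sum>i\<in>I. \<kappa> (d i) * po i) = \<phi> (monom 1 n - p)" by (simp add: \<phi>_diff \<phi>m)
    then have "d i = 0" if "i \<in> I" for i using po_independent[OF _ that, of d] Q_\<phi> by simp
    then have "\<phi> (monom 1 n) = \<phi> p" using p by (simp add: \<phi>m)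
    then have "monom 1 n = p" by simp
    then show False using p(2) by (metis coeff_monom order_refl zero_neq_one)
  qed
  then obtain b where "g = [:b:]" by (metis degree_eq_zeroE)
  then show ?thesis using g by auto
qed

text \<open>A linear dependence would be a value \<open>\<nabla> f\<close> with simple poles only,
  so \<open>f\<close> is a constant \<open>b\<close> and the residues are those of
  \<open>\<nabla> 1\<close> times \<open>b\<close>. The residue at \<open>r\<close>, which is 0
  while \<open>\<gamma> r\<close> is not, forces \<open>b = 0\<close>, and the residue at
  \<open>s\<close> is 1.\<close>

lemma po_notin_Wpoles:
  assumes l0: "lam 0 = 0" and r: "r \<in> \<gamma>supp" and J: "J \<subseteq> I - {r}" and s: "s \<in> I - {r}" "s \<notin> J"
  shows "po s \<notin> Wpoles J"
proof
  assume "po s \<in> Wpoles J"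
  then obtain f c where *: "po s = \<nabla> f + (\<Sum>i\<in>J. \<kappa> (c i) * po i)" "f \<in> Q I" unfolding Wpoles_def by blast
  define e where "e i = (if i = s then 1 else if i \<in> J then - c i else 0)" for i
  have J': "insert s J \<subseteq> I" using J s by auto
  then have fJ: "finite J" using finite_subset[OF _ fin_I] by auto
  have "(\<Sum>i\<in>I. \<kappa> (e i) * po i) = (\<Sum>i\<in>insert s J. \<kappa> (e i) * po i)"
    by (rule sum.mono_neutral_right[OF fin_I J']) (auto simp: e_def)
  also have "\<dots> = po s + (\<Sum>i\<in>J. \<kappa> (e i) * po i)" using s fJ by (simp add: e_def)
  also have "(\<Sum>i\<in>J. \<kappa> (e i) * po i) = (\<Sum>i\<in>J. - (\<kappa> (c i) * po i))"
    using s by (intro sum.cong) (auto simp: e_def \<kappa>_minus)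
  finally have e: "\<nabla> f = (\<Sum>i\<in>I. \<kappa> (e i) * po i)" using * by (simp add: sum_negf)
  obtain b where b: "f = \<kappa> b" using exact_simple_poles[OF l0 *(2) e] by blast
  have "(\<Sum>i\<in>I. \<kappa> (e i - b * \<gamma> i) * po i) = 0"
    using e unfolding b nabla_def by (simp add: \<kappa>_diff \<kappa>_mult algebra_simps sum_subtractf sum_distrib_left)
  then have z: "e i - b * \<gamma> i = 0" if "i \<in> I" for i
    using po_independent[OF _ that, of "\<lambda>i. e i - b * \<gamma> i"] Q_0 by simp
  have "e r = 0" using s J by (auto simp: e_def)
  then have "b = 0" using z[of r] r by (auto simp: \<gamma>supp_def)
  then show False using z[of s] s by (simp add: e_def)
qed

end

section \<open>Submodules as graded families\<close>

text \<open>The factor \<open>e\<close> absorbs the integer shift of the exponents, and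
  \<open>Du\<close>, \<open>Dv\<close> are \<partial>_u, \<partial>_v on the original module. Only
  their additivity and their effect on homogeneous elements enter the comparison with graded
  families.\<close>

locale twisted_plane = twisted_line \<kappa> t \<delta> I a \<gamma> \<omega>
  for \<kappa> :: "complex \<Rightarrow> 'k::field" and t \<delta> I a \<gamma> \<omega> +
  fixes e u :: 'k and Du Dv :: "'k \<Rightarrow> 'k"
  assumes e_nz: "e \<noteq> 0" and u_nz: "u \<noteq> 0"
    and Du_add: "Du (f + g) = Du f + Du g" and Dv_add: "Dv (f + g) = Dv f + Dv g"
    and Dv_homog: "h \<in> Q I \<Longrightarrow> Dv (e * u powi d * h) = e * u powi (d - 1) * \<nabla> h"
    and Du_homog: "h \<in> Q I \<Longrightarrow> Du (e * u powi d * h) = e * u powi (d - 1) * (\<kappa> (lam d) * h - t * \<nabla> h)"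
begin

definition homog :: "int \<Rightarrow> 'k \<Rightarrow> 'k" where "homog d h = e * u powi d * h"

lemma homog_simps: "homog d (h + g) = homog d h + homog d g" "homog d 0 = 0" "\<kappa> c * homog d h = homog d (\<kappa> c * h)"
  "u * homog d h = homog (d + 1) h" "u * t * homog d h = homog (d + 1) (t * h)"
  using u_nz by (simp_all add: homog_def algebra_simps power_int_add)

lemma D_homog: "h \<in> Q I \<Longrightarrow> Dv (homog d h) = homog (d - 1) (\<nabla> h)"
  "h \<in> Q I \<Longrightarrow> Du (homog d h) = homog (d - 1) (\<kappa> (lam d) * h - t * \<nabla> h)"
  by (simp_all add: homog_def Dv_homog Du_homog)

definition tot :: "(int \<Rightarrow> 'k set) \<Rightarrow> 'k set" where
  "tot P = {\<Sum>d\<in>F. homog d (h d) | F h. finite F \<and> (\<forall>d\<in>F. h d \<in> P d)}"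

definition stable :: "'k set \<Rightarrow> bool" where
  "stable N \<longleftrightarrow> csub N \<and> (\<forall>f\<in>N. u * f \<in> N \<and> u * t * f \<in> N \<and> Du f \<in> N \<and> Dv f \<in> N)"

definition sub :: "'k set \<Rightarrow> bool" where "sub N \<longleftrightarrow> N \<subseteq> tot (\<lambda>d. Q I) \<and> stable N"

definition gpart :: "'k set \<Rightarrow> int \<Rightarrow> 'k set" where "gpart N d = {h \<in> Q I. homog d h \<in> N}"

lemma tot_homog: "h \<in> P d \<Longrightarrow> homog d h \<in> tot P"
  unfolding tot_def by (intro CollectI exI[of _ "{d}"] exI[of _ "\<lambda>_. h"]) simp

lemma tot_induct [consumes 1, case_names zero add homog]:
  assumes "f \<in> tot P" "R 0" "\<And>f g. R f \<Longrightarrow> R g \<Longrightarrow> R (f + g)" "\<And>d h. h \<in> P d \<Longrightarrow> R (homog d h)"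
  shows "R f"
proof -
  obtain F h where F: "f = (\<Sum>d\<in>F. homog d (h d))" "finite F" "\<forall>d\<in>F. h d \<in> P d"
    using assms(1) by (auto simp: tot_def)
  from F(2,3) have "R (\<Sum>d\<in>F. homog d (h d))"
    by (induction F rule: finite_induct) (auto intro: assms)
  then show ?thesis using F by simp
qed

lemma tot_add:
  assumes P: "\<And>d. csub (P d)" and f: "f \<in> tot P" "g \<in> tot P"
  shows "f + g \<in> tot P"
proof -
  obtain F h where F: "f = (\<Sum>d\<in>F. homog d (h d))" "finite F" "\<forall>d\<in>F. h d \<in> P d"
    using f(1) by (auto simp: tot_def)
  obtain G k where G: "g = (\<Sum>d\<in>G. homog d (k d))" "finite G" "\<forall>d\<in>G. k d \<in> P d"
    using f(2) by (auto simp: tot_def)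
  define h' where "h' d = (if d \<in> F then h d else 0)" for d
  define k' where "k' d = (if d \<in> G then k d else 0)" for d
  have 1: "f = (\<Sum>d\<in>F \<union> G. homog d (h' d))" unfolding F(1)
    by (rule sum.mono_neutral_cong_left) (use F G in \<open>auto simp: h'_def homog_simps\<close>)
  have 2: "g = (\<Sum>d\<in>F \<union> G. homog d (k' d))" unfolding G(1)
    by (rule sum.mono_neutral_cong_left) (use F G in \<open>auto simp: k'_def homog_simps\<close>)
  have "f + g = (\<Sum>d\<in>F \<union> G. homog d (h' d + k' d))"
    unfolding 1 2 by (simp add: homog_simps sum.distrib)
  moreover have "\<forall>d\<in>F \<union> G. h' d + k' d \<in> P d"
    using F G by (auto simp: h'_def k'_def intro!: csubD(2)[OF P] csubD(1)[OF P])
  ultimately show ?thesis unfolding tot_def using F(2) G(2)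
    by (intro CollectI exI[of _ "F \<union> G"] exI[of _ "\<lambda>d. h' d + k' d"]) simp
qed

lemma tot_0: "0 \<in> tot P"
  unfolding tot_def by (intro CollectI exI[of _ "{}"]) simp

lemma D_0: "Du 0 = 0" "Dv 0 = 0"
  using Du_add[of 0 0] Dv_add[of 0 0] by (metis add_cancel_right_right)+

lemma csub_tot:
  assumes P: "\<And>d. csub (P d)"
  shows "csub (tot P)"
  unfolding csub_def
proof (intro conjI ballI allI)
  show "0 \<in> tot P" by (rule tot_0)
  fix f g c assume f: "f \<in> tot P"
  show "g \<in> tot P \<Longrightarrow> f + g \<in> tot P" by (rule tot_add[OF P f])
  from f show "\<kappa> c * f \<in> tot P"
  proof (induction rule: tot_induct)
    case zero show ?case by (simp add: tot_0)
  next
    case (add f g) then show ?case by (simp add: distrib_left tot_add[OF P])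
  next
    case (homog d h) then show ?case unfolding homog_simps by (intro tot_homog csubD(3)[OF P])
  qed
qed

lemma tot_mono: "P \<le> P' \<Longrightarrow> tot P \<subseteq> tot P'"
  unfolding tot_def le_fun_def by blast

lemma sub_tot:
  assumes P: "graded P" and PQ: "P \<le> (\<lambda>d. Q I)"
  shows "sub (tot P)"
proof -
  note c = gradedD(1)[OF P]
  have hQ: "h \<in> P d \<Longrightarrow> h \<in> Q I" for h d using PQ by (auto simp: le_fun_def)
  have "u * f \<in> tot P \<and> u * t * f \<in> tot P \<and> Du f \<in> tot P \<and> Dv f \<in> tot P" if "f \<in> tot P" for f
    using that
  proof (induction rule: tot_induct)
    case zero show ?case by (simp add: tot_0 D_0)
  next
    case (add f g) then show ?case by (simp add: distrib_left tot_add[OF c] Du_add Dv_add)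
  next
    case (homog d h)
    then show ?case using gradedD(2-)[OF P homog] hQ[OF homog] by (simp add: homog_simps D_homog tot_homog)
  qed
  moreover have "csub (tot P)" by (rule csub_tot) (rule c)
  ultimately show ?thesis unfolding sub_def stable_def using tot_mono[OF PQ] by blast
qed

lemma graded_gpart:
  assumes "sub N"
  shows "graded (gpart N)"
proof -
  have c: "csub N" and s: "f \<in> N \<Longrightarrow> u * f \<in> N \<and> u * t * f \<in> N \<and> Du f \<in> N \<and> Dv f \<in> N" for f
    using assms by (auto simp: sub_def stable_def)
  show ?thesis unfolding graded_def
  proof (intro allI conjI ballI subsetI)
    fix d
    show "csub (gpart N d)" unfolding csub_def gpart_def
      using csubD[OF c] by (auto simp: homog_simps Q_0 Q_add Q_mult Q_\<kappa> simp flip: homog_simps(3))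
    fix h assume h: "h \<in> gpart N d"
    then have hQ: "h \<in> Q I" and hN: "homog d h \<in> N" by (auto simp: gpart_def)
    have nQ: "\<nabla> h \<in> Q I" by (rule Q_nabla[OF \<gamma>supp_I hQ])
    show "h \<in> gpart N (d + 1)" using s[OF hN] hQ by (simp add: gpart_def homog_simps)
    show "t * h \<in> gpart N (d + 1)" using s[OF hN] hQ by (simp add: gpart_def homog_simps Q_mult Q_t)
    show "\<nabla> h \<in> gpart N (d - 1)" using s[OF hN] hQ nQ by (simp add: gpart_def D_homog)
    show "\<kappa> (lam d) * h - t * \<nabla> h \<in> gpart N (d - 1)" using s[OF hN] hQ nQ
      by (simp add: gpart_def D_homog Q_simps)
  qed
qed

section \<open>Grading by the Euler operator\<close>

definition euler :: "'k \<Rightarrow> 'k" where "euler f = u * Du f + u * t * Dv f"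

lemma euler_homog: "h \<in> Q I \<Longrightarrow> euler (homog d h) = \<kappa> (lam d) * homog d h"
  unfolding euler_def using u_nz e_nz
  by (simp add: D_homog homog_simps algebra_simps)  (simp add: homog_def algebra_simps)

lemma euler_add: "euler (f + g) = euler f + euler g"
  by (simp add: euler_def Du_add Dv_add algebra_simps)

lemma euler_sum: "euler (\<Sum>d\<in>A. f d) = (\<Sum>d\<in>A. euler (f d))"
proof -
  have e0: "euler 0 = 0" by (simp add: euler_def D_0)
  show ?thesis by (induction A rule: infinite_finite_induct) (auto simp: euler_add e0)
qed

text \<open>Applying \<open>euler\<close> and subtracting \<open>lam x\<close> times the sum removes
  the component of degree \<open>x\<close>; the others are multiplied by
  \<open>lam d - lam x = d - x\<close>, which can be divided out.\<close>

lemma eigen_separation: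
  assumes c: "csub N" and E: "\<And>f. f \<in> N \<Longrightarrow> euler f \<in> N"
    and "finite F" "\<And>d. d \<in> F \<Longrightarrow> h d \<in> Q I" "(\<Sum>d\<in>F. homog d (h d)) \<in> N"
  shows "\<forall>d\<in>F. homog d (h d) \<in> N"
  using assms(3-)
proof (induction F arbitrary: h rule: finite_induct)
  case (insert x F)
  let ?s = "\<Sum>d\<in>insert x F. homog d (h d)"
  have 1: "euler ?s - \<kappa> (lam x) * ?s \<in> N"
    by (intro csubD(5)[OF c] csubD(3)[OF c] E insert.prems)
  have "euler ?s = (\<Sum>d\<in>insert x F. \<kappa> (lam d) * homog d (h d))"
    unfolding euler_sum using insert.prems(1) by (intro sum.cong refl euler_homog)
  then have "euler ?s - \<kappa> (lam x) * ?s = (\<Sum>d\<in>insert x F. homog d (\<kappa> (lam d - lam x) * h d))"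
    by (simp only: sum_distrib_left sum_subtractf[symmetric] \<kappa>_diff)
      (simp add: left_diff_distrib homog_simps(3)[symmetric] homog_def right_diff_distrib mult.left_commute)
  also have "\<dots> = (\<Sum>d\<in>F. homog d (\<kappa> (lam d - lam x) * h d))"
    using insert.hyps by (simp add: homog_simps)
  finally have "(\<Sum>d\<in>F. homog d (\<kappa> (lam d - lam x) * h d)) \<in> N" using 1 by simp
  moreover have "\<kappa> (lam d - lam x) * h d \<in> Q I" if "d \<in> F" for d
    using insert.prems(1) that by (intro Q_mult Q_\<kappa>) auto
  ultimately have IH: "\<forall>d\<in>F. homog d (\<kappa> (lam d - lam x) * h d) \<in> N" by (rule insert.IH[rotated])
  have F: "homog d (h d) \<in> N" if "d \<in> F" for d
  proof -
    have "lam d - lam x \<noteq> 0" using that insert.hyps by (auto simp: lam_def)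
    moreover have "\<kappa> (lam d - lam x) * homog d (h d) \<in> N" unfolding homog_simps using IH that by blast
    ultimately show ?thesis using csub_cancel[OF c] by blast
  qed
  then have "?s - (\<Sum>d\<in>F. homog d (h d)) \<in> N" by (intro csubD(5)[OF c] csub_sum[OF c] insert.prems)
  then show ?case using F insert.hyps by auto
qed auto

lemma sub_euler: "sub N \<Longrightarrow> f \<in> N \<Longrightarrow> euler f \<in> N"
  unfolding sub_def stable_def euler_def using csubD(2) by blast

lemma subD: "sub N \<Longrightarrow> csub N" "sub N \<Longrightarrow> N \<subseteq> tot (\<lambda>d. Q I)"
  by (auto simp: sub_def stable_def)

lemma tot_gpart:
  assumes N: "sub N"
  shows "tot (gpart N) = N"
proof
  show "tot (gpart N) \<subseteq> N"
  proof
    fix f assume "f \<in> tot (gpart N)"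
    then show "f \<in> N"
      by (induction rule: tot_induct) (auto simp: gpart_def csubD[OF subD(1)[OF N]])
  qed
  show "N \<subseteq> tot (gpart N)"
  proof
    fix f assume f: "f \<in> N"
    then obtain F h where F: "f = (\<Sum>d\<in>F. homog d (h d))" "finite F" "\<forall>d\<in>F. h d \<in> Q I"
      using subD(2)[OF N] by (auto simp: tot_def)
    then have "\<forall>d\<in>F. homog d (h d) \<in> N"
      using f by (intro eigen_separation[OF subD(1)[OF N] sub_euler[OF N]]) auto
    then have "\<forall>d\<in>F. h d \<in> gpart N d" using F by (auto simp: gpart_def)
    then show "f \<in> tot (gpart N)" unfolding tot_def using F by blast
  qed
qed

lemma gpart_tot:
  assumes P: "graded P" and PQ: "P \<le> (\<lambda>d. Q I)"
  shows "gpart (tot P) = P"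
  unfolding fun_eq_iff set_eq_iff
proof (intro allI iffI)
  fix d h assume "h \<in> gpart (tot P) d"
  then have h: "h \<in> Q I" "homog d h \<in> tot P" by (auto simp: gpart_def)
  then obtain F k where F: "homog d h = (\<Sum>d\<in>F. homog d (k d))" "finite F" "\<forall>d\<in>F. k d \<in> P d"
    by (auto simp: tot_def)
  define k' where "k' i = (if i \<in> F then k i else 0)" for i
  have k': "k' i \<in> P i" for i using F csubD(1)[OF gradedD(1)[OF P]] by (auto simp: k'_def)
  have kQ: "k' i \<in> Q I" for i using k'[of i] PQ by (auto simp: le_fun_def)
  have "(\<Sum>i\<in>F. homog i (k i)) = (\<Sum>i\<in>insert d F. homog i (k' i))"
    by (rule sum.mono_neutral_cong_left) (use F in \<open>auto simp: k'_def homog_simps\<close>)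
  moreover have "homog d h = (\<Sum>i\<in>insert d F. homog i (if i = d then h else 0))"
  proof -
    have "(\<Sum>i\<in>insert d F. homog i (if i = d then h else 0)) = (\<Sum>i\<in>{d}. homog i (if i = d then h else 0))"
      by (rule sum.mono_neutral_right) (use F in \<open>auto simp: homog_simps\<close>)
    then show ?thesis by simp
  qed
  ultimately have "(\<Sum>i\<in>insert d F. homog i (k' i)) - (\<Sum>i\<in>insert d F. homog i (if i = d then h else 0)) = 0"
    using F by simp
  then have "(\<Sum>i\<in>insert d F. homog i (k' i - (if i = d then h else 0))) = 0"
    by (simp only: sum_subtractf[symmetric]) (simp add: homog_def right_diff_distrib)
  \<comment> \<open>Separation inside the zero subspace is the uniqueness of homogeneous
    components.\<close>
  then have "\<forall>i\<in>insert d F. homog i (k' i - (if i = d then h else 0)) \<in> {0}"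
    using F(2) kQ h(1)
    by (intro eigen_separation) (auto simp: csub_def euler_def D_0 Q_simps)
  then have "homog d (k' d - h) = 0" by auto
  then have "k' d = h" using e_nz u_nz by (simp add: homog_def)
  then show "h \<in> P d" using k' by blast
next
  fix d h assume "h \<in> P d"
  then show "h \<in> gpart (tot P) d" using PQ tot_homog[of h P d] by (auto simp: gpart_def le_fun_def)
qed

lemma gpart_mono: "N \<subseteq> N' \<Longrightarrow> gpart N \<le> gpart N'"
  by (auto simp: gpart_def le_fun_def)

lemma tot_family_covers:
  assumes c: "family_covers P P'" and Q: "P' \<le> (\<lambda>d. Q I)"
  shows "sub (tot P) \<and> sub (tot P') \<and> tot P \<subset> tot P' \<and>
    (\<forall>N. sub N \<longrightarrow> tot P \<subseteq> N \<longrightarrow> N \<subseteq> tot P' \<longrightarrow> N = tot P \<or> N = tot P')"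
proof (intro conjI allI impI)
  have g: "graded P" "graded P'" and lt: "P < P'" using c by (auto simp: family_covers_def)
  then have PQ: "P \<le> (\<lambda>d. Q I)" using Q by (auto simp: less_le_not_le intro: order_trans)
  note gt = gpart_tot[OF g(1) PQ] gpart_tot[OF g(2) Q]
  show "sub (tot P)" "sub (tot P')" by (rule sub_tot[OF g(1) PQ], rule sub_tot[OF g(2) Q])
  have "tot P \<noteq> tot P'" using gt lt by (metis less_irrefl)
  then show "tot P \<subset> tot P'" using tot_mono[of P P'] lt by (simp add: less_le)
  fix N assume N: "sub N" "tot P \<subseteq> N" "N \<subseteq> tot P'"
  have "P \<le> gpart N" "gpart N \<le> P'" using gpart_mono[OF N(2)] gpart_mono[OF N(3)] gt by simp_all
  then have "gpart N = P \<or> gpart N = P'" using c graded_gpart[OF N(1)] unfolding family_covers_def by (metis order_le_less)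
  then show "N = tot P \<or> N = tot P'" using tot_gpart[OF N(1)] by metis
qed

lemma sub_Int: "sub A \<Longrightarrow> sub B \<Longrightarrow> sub (A \<inter> B)"
  by (auto simp: sub_def stable_def csub_def)

lemma sub_setsum:
  assumes A: "sub A" and B: "sub B"
  shows "sub (setsum A B)"
proof -
  have cA: "csub A" and cB: "csub B" using A B subD by auto
  have Q: "csub (tot (\<lambda>d. Q I))" by (rule csub_tot[OF csub_Q])
  have "setsum A B \<subseteq> tot (\<lambda>d. Q I)"
    using subD(2)[OF A] subD(2)[OF B] by (auto simp: setsum_def intro!: csubD(2)[OF Q])
  moreover have "csub (setsum A B)" unfolding csub_def
  proof (intro conjI ballI allI)
    show "0 \<in> setsum A B" unfolding setsum_def
      using csubD(1)[OF cA] csubD(1)[OF cB] by (intro CollectI exI[of _ 0]) simp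
    fix f g c assume "f \<in> setsum A B"
    then obtain x y where xy: "f = x + y" "x \<in> A" "y \<in> B" by (auto simp: setsum_def)
    show "\<kappa> c * f \<in> setsum A B" unfolding setsum_def
      using xy csubD(3)[OF cA] csubD(3)[OF cB]
      by (intro CollectI exI[of _ "\<kappa> c * x"] exI[of _ "\<kappa> c * y"]) (simp add: distrib_left)
    assume "g \<in> setsum A B"
    then obtain x' y' where xy': "g = x' + y'" "x' \<in> A" "y' \<in> B" by (auto simp: setsum_def)
    show "f + g \<in> setsum A B" unfolding setsum_def
      using xy xy' csubD(2)[OF cA] csubD(2)[OF cB]
      by (intro CollectI exI[of _ "x + x'"] exI[of _ "y + y'"]) simp
  qed
  moreover have "u * f \<in> setsum A B \<and> u * t * f \<in> setsum A B \<and> Du f \<in> setsum A B \<and> Dv f \<in> setsum A B"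
    if "f \<in> setsum A B" for f
  proof -
    obtain x y where xy: "f = x + y" "x \<in> A" "y \<in> B" using \<open>f \<in> setsum A B\<close> by (auto simp: setsum_def)
    then have "u * x \<in> A \<and> u * t * x \<in> A \<and> Du x \<in> A \<and> Dv x \<in> A" "u * y \<in> B \<and> u * t * y \<in> B \<and> Du y \<in> B \<and> Dv y \<in> B"
      using A B by (auto simp: sub_def stable_def)
    then show ?thesis unfolding setsum_def xy(1) Du_add Dv_add distrib_left by blast
  qed
  ultimately show ?thesis by (auto simp: sub_def stable_def)
qed

end

section \<open>Composition series of \<open>M\<^sub>\<alpha>\<^sup>\<beta>\<close>\<close>

text \<open>Submodules in terms of the four generators and the constants acting on coefficients,
  which avoids the classes that make up \<open>A2\<close>.\<close>

definition weyl_stable :: "nat \<Rightarrow> (nat \<Rightarrow> poly_xy) \<Rightarrow> (nat \<Rightarrow> complex) \<Rightarrow> ratfun_xy set \<Rightarrow> bool" where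
  "weyl_stable m \<alpha> \<beta> N \<longleftrightarrow> N \<subseteq> localization (\<Prod>i=1..m. \<alpha> i) \<and> 0 \<in> N \<and> (\<forall>x\<in>N. \<forall>y\<in>N. x + y \<in> N) \<and>
    (\<forall>c. \<forall>x\<in>N. Fract (const_xy c) 1 * x \<in> N) \<and> (\<forall>g. \<forall>x\<in>N. gen_act m \<alpha> \<beta> g x \<in> N)"

lemma weyl_stableD:
  assumes "weyl_stable m \<alpha> \<beta> N"
  shows "0 \<in> N" "x \<in> N \<Longrightarrow> y \<in> N \<Longrightarrow> x + y \<in> N" "x \<in> N \<Longrightarrow> Fract (const_xy c) 1 * x \<in> N"
    "x \<in> N \<Longrightarrow> gen_act m \<alpha> \<beta> g x \<in> N" "x \<in> N \<Longrightarrow> x \<in> localization (\<Prod>i=1..m. \<alpha> i)"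
    "x \<in> N \<Longrightarrow> - x \<in> N" "x \<in> N \<Longrightarrow> y \<in> N \<Longrightarrow> x - y \<in> N"
proof -
  show "0 \<in> N" and add: "x \<in> N \<Longrightarrow> y \<in> N \<Longrightarrow> x + y \<in> N" and c: "x \<in> N \<Longrightarrow> Fract (const_xy c) 1 * x \<in> N"
    and "x \<in> N \<Longrightarrow> gen_act m \<alpha> \<beta> g x \<in> N" "x \<in> N \<Longrightarrow> x \<in> localization (\<Prod>i=1..m. \<alpha> i)" for x y c g
    using assms by (auto simp: weyl_stable_def)
  have "const_xy (-1) = -1" by (simp add: const_xy_def one_pCons)
  then have "Fract (const_xy (-1)) 1 = (-1 :: ratfun_xy)"
    by (simp flip: minus_fract One_fract_def)
  then show neg: "x \<in> N \<Longrightarrow> - x \<in> N" for x using c[of x "-1"] by simp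
  show "x \<in> N \<Longrightarrow> y \<in> N \<Longrightarrow> x - y \<in> N" using add[of x "-y"] neg[of y] by simp
qed

lemma weyl_stable_sum: "weyl_stable m \<alpha> \<beta> N \<Longrightarrow> (\<And>i. i \<in> A \<Longrightarrow> f i \<in> N) \<Longrightarrow> (\<Sum>i\<in>A. f i) \<in> N"
  by (induction A rule: infinite_finite_induct) (auto intro: weyl_stableD(1,2))

lemma weyl_stable_free_act: "weyl_stable m \<alpha> \<beta> N \<Longrightarrow> x \<in> N \<Longrightarrow> free_act m \<alpha> \<beta> w x \<in> N"
proof -
  assume N: "weyl_stable m \<alpha> \<beta> N" and x: "x \<in> N"
  have "foldr (gen_act m \<alpha> \<beta>) l x \<in> N" for l
    by (induction l) (auto simp: x weyl_stableD(4)[OF N] simp del: gen_act.simps)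
  then show ?thesis unfolding free_act_def by (intro weyl_stable_sum[OF N] weyl_stableD(3)[OF N])
qed

lemma weyl_stable_poly:
  assumes "weyl_stable m \<alpha> \<beta> N" "x \<in> N"
  shows "Fract g 1 * x \<in> N"
proof -
  obtain w where w: "poly_to_weyl g = weyl_class w" unfolding poly_to_weyl_def by blast
  have "poly_to_weyl g \<odot>\<^bsub>M_mod m \<alpha> \<beta>\<^esub> x = Fract g 1 * x" by (rule poly_to_weyl_act)
  then have "free_act m \<alpha> \<beta> w x = Fract g 1 * x" by (simp only: w M_mod_smult)
  then show ?thesis using weyl_stable_free_act[OF assms, of w] by simp
qed

lemma M_mod_simps:
  "\<zero>\<^bsub>M_mod m \<alpha> \<beta>\<^esub> = 0" "x \<oplus>\<^bsub>M_mod m \<alpha> \<beta>\<^esub> y = x + y"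
  "carrier (M_mod m \<alpha> \<beta>) = localization (\<Prod>i=1..m. \<alpha> i)"
  by (simp_all add: M_mod_def)

definition cs :: "'a::ab_group_add set \<Rightarrow> 'a \<Rightarrow> 'a set" where "cs A x = (\<lambda>a. a + x) ` A"

locale nonzero_forms =
  fixes m :: nat and \<alpha> :: "nat \<Rightarrow> poly_xy" and \<beta> :: "nat \<Rightarrow> complex"
  assumes nz: "i \<in> {1..m} \<Longrightarrow> \<alpha> i \<noteq> 0"
begin

abbreviation "MM \<equiv> M_mod m \<alpha> \<beta>"
abbreviation "ws \<equiv> weyl_stable m \<alpha> \<beta>"

sublocale left_module A2 MM
  by (rule left_module_M_mod) (rule nz)

lemma uminus_MM: "x \<in> carrier MM \<Longrightarrow> inv\<^bsub>add_monoid MM\<^esub> x = - x"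
proof -
  assume x: "x \<in> carrier MM"
  have "Fract (- 1) 1 * x \<in> carrier MM"
    using smult_closed[of "poly_to_weyl (- 1)" x] x poly_to_weyl_act[where g = "-1" and m = m and \<alpha> = \<alpha> and \<beta> = \<beta> and f = x]
    by (simp add: poly_to_weyl_def A2_simps)
  then have "- x \<in> carrier MM" by (simp flip: minus_fract One_fract_def)
  then have "\<ominus>\<^bsub>MM\<^esub> x = - x"
    using x by (intro M.minus_equality) (simp_all add: M_mod_simps)
  then show ?thesis by (simp only: a_inv_def)
qed

lemma submodule_iff: "submodule N A2 MM \<longleftrightarrow> ws N"
proof
  assume "submodule N A2 MM"
  then interpret N: submodule N A2 MM .
  have act: "free_act m \<alpha> \<beta> w x \<in> N" if "x \<in> N" for w x
    using N.smult_closed[of "weyl_class w" x] that by (simp add: A2_simps M_mod_smult)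
  have "Fract (const_xy c) 1 * x \<in> N" if "x \<in> N" for c x
    using act[OF that, of "Poly_Mapping.single 0 c"] by (simp add: free_act_single zero_free_word_def)
  moreover have "gen_act m \<alpha> \<beta> g x \<in> N" if "x \<in> N" for g x
    using act[OF that, of "gen g"] by (simp only: gen_act_free)
  moreover have "x + y \<in> N" if "x \<in> N" "y \<in> N" for x y
    using N.m_closed[OF that] by (simp add: M_mod_simps)
  ultimately show "ws N" using N.subset N.one_closed by (simp add: weyl_stable_def M_mod_simps)
next
  assume N: "ws N"
  show "submodule N A2 MM"
  proof (intro submodule.intro subgroup.intro submodule_axioms.intro)
    show "N \<subseteq> carrier (add_monoid MM)" using weyl_stableD(5)[OF N] by (auto simp: M_mod_simps)
    show "\<one>\<^bsub>add_monoid MM\<^esub> \<in> N" using weyl_stableD(1)[OF N] by (simp add: M_mod_simps)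
    show "x \<otimes>\<^bsub>add_monoid MM\<^esub> y \<in> N" if "x \<in> N" "y \<in> N" for x y
      using weyl_stableD(2)[OF N that] by (simp add: M_mod_simps)
    show "inv\<^bsub>add_monoid MM\<^esub> x \<in> N" if "x \<in> N" for x
      using weyl_stableD(6)[OF N that] weyl_stableD(5)[OF N that] uminus_MM[of x] by (simp add: M_mod_simps)
    show "r \<odot>\<^bsub>MM\<^esub> x \<in> N" if "r \<in> carrier A2" "x \<in> N" for r x
      using that weyl_stable_free_act[OF N that(2)] by (auto simp: A2_simps M_mod_smult)
  qed
qed

section \<open>Subquotients and their supports\<close>

definition subq :: "ratfun_xy set \<Rightarrow> ratfun_xy set \<Rightarrow> (weyl_free set, ratfun_xy set) module" where
  "subq A B = quot_module (MM\<lparr>carrier := B\<rparr>) A"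

lemma cs_eq: "A +>\<^bsub>MM\<^esub> x = cs A x" "A +>\<^bsub>MM\<lparr>carrier := B\<rparr>\<^esub> x = cs A x"
  by (auto simp: a_r_coset_def r_coset_def M_mod_simps cs_def)

lemma cs_iff: "ws A \<Longrightarrow> cs A x = cs A y \<longleftrightarrow> x - y \<in> A"
proof
  assume A: "ws A" and "cs A x = cs A y"
  moreover have "x \<in> cs A x" using weyl_stableD(1)[OF A] by (force simp: cs_def)
  ultimately obtain a where "a \<in> A" "x = a + y" by (auto simp: cs_def)
  then show "x - y \<in> A" by simp
next
  assume A: "ws A" and xy: "x - y \<in> A"
  have "cs A u \<subseteq> cs A v" if "u - v \<in> A" for u v
  proof
    fix z assume "z \<in> cs A u"
    then obtain a where a: "a \<in> A" "z = a + u" by (auto simp: cs_def)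
    then have "z = (a + (u - v)) + v" "a + (u - v) \<in> A" using weyl_stableD(2)[OF A a(1) that] by auto
    then show "z \<in> cs A v" unfolding cs_def by blast
  qed
  from this[OF xy] this[of y x] weyl_stableD(6)[OF A xy] show "cs A x = cs A y" by auto
qed

lemma cs_mem: "ws A \<Longrightarrow> z \<in> cs A x \<longleftrightarrow> z - x \<in> A"
proof
  assume "z - x \<in> A"
  then have "(z - x) + x \<in> cs A x" unfolding cs_def by (rule imageI)
  then show "z \<in> cs A x" by simp
qed (auto simp: cs_def)

lemma subq_simps:
  assumes A: "ws A"
  shows "carrier (subq A B) = cs A ` B" "\<zero>\<^bsub>subq A B\<^esub> = cs A 0"
    "cs A x \<oplus>\<^bsub>subq A B\<^esub> cs A y = cs A (x + y)"
    "weyl_class w \<odot>\<^bsub>subq A B\<^esub> cs A x = cs A (free_act m \<alpha> \<beta> w x)"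
proof -
  show "carrier (subq A B) = cs A ` B"
    by (auto simp: subq_def quot_module_def A_RCOSETS_def' cs_eq)
  show "\<zero>\<^bsub>subq A B\<^esub> = cs A 0" by (simp add: subq_def quot_module_def cs_def)
  show "cs A x \<oplus>\<^bsub>subq A B\<^esub> cs A y = cs A (x + y)"
  proof -
    have "cs A x \<oplus>\<^bsub>subq A B\<^esub> cs A y = {g + h | g h. g \<in> cs A x \<and> h \<in> cs A y}"
      by (auto simp: subq_def quot_module_def set_add_def set_mult_def M_mod_simps)
    also have "\<dots> = cs A (x + y)"
    proof safe
      fix g h assume "g \<in> cs A x" "h \<in> cs A y"
      then have "(g - x) + (h - y) \<in> A" using weyl_stableD(2)[OF A] by (simp add: cs_mem[OF A])
      then show "g + h \<in> cs A (x + y)" by (simp add: cs_mem[OF A] algebra_simps)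
    next
      fix z assume z: "z \<in> cs A (x + y)"
      have "z - y \<in> cs A x" "y \<in> cs A y" using z weyl_stableD(1)[OF A] by (simp_all add: cs_mem[OF A] algebra_simps)
      then show "\<exists>g h. z = g + h \<and> g \<in> cs A x \<and> h \<in> cs A y" by (metis diff_add_cancel)
    qed
    finally show ?thesis .
  qed
  show "weyl_class w \<odot>\<^bsub>subq A B\<^esub> cs A x = cs A (free_act m \<alpha> \<beta> w x)"
  proof -
    have "weyl_class w \<odot>\<^bsub>subq A B\<^esub> cs A x = (\<Union>y\<in>cs A x. cs A (free_act m \<alpha> \<beta> w y))"
      by (simp add: subq_def quot_module_def cs_eq M_mod_smult)
    also have "\<dots> = (\<Union>y\<in>cs A x. cs A (free_act m \<alpha> \<beta> w x))"
    proof (rule SUP_cong[OF refl])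
      fix y assume "y \<in> cs A x"
      then have "free_act m \<alpha> \<beta> w (y - x) \<in> A" using weyl_stable_free_act[OF A] by (simp add: cs_mem[OF A])
      moreover have "free_act m \<alpha> \<beta> w y = free_act m \<alpha> \<beta> w (y - x) + free_act m \<alpha> \<beta> w x"
        by (simp flip: free_act_add_right)
      ultimately show "cs A (free_act m \<alpha> \<beta> w y) = cs A (free_act m \<alpha> \<beta> w x)"
        by (simp add: cs_iff[OF A])
    qed
    also have "\<dots> = cs A (free_act m \<alpha> \<beta> w x)"
      using weyl_stableD(1)[OF A] by (auto simp: cs_def)
    finally show ?thesis .
  qed
qed

lemma subq_inv:
  assumes A: "ws A" and B: "ws B" and x: "x \<in> B"
  shows "inv\<^bsub>add_monoid (subq A B)\<^esub> (cs A x) = cs A (- x)"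
  unfolding m_inv_def
proof (rule the_equality)
  show "cs A (- x) \<in> carrier (add_monoid (subq A B)) \<and>
    cs A x \<otimes>\<^bsub>add_monoid (subq A B)\<^esub> cs A (- x) = \<one>\<^bsub>add_monoid (subq A B)\<^esub> \<and>
    cs A (- x) \<otimes>\<^bsub>add_monoid (subq A B)\<^esub> cs A x = \<one>\<^bsub>add_monoid (subq A B)\<^esub>"
    using weyl_stableD(6)[OF B x] by (simp add: subq_simps[OF A])
  fix U assume U: "U \<in> carrier (add_monoid (subq A B)) \<and>
    cs A x \<otimes>\<^bsub>add_monoid (subq A B)\<^esub> U = \<one>\<^bsub>add_monoid (subq A B)\<^esub> \<and>
    U \<otimes>\<^bsub>add_monoid (subq A B)\<^esub> cs A x = \<one>\<^bsub>add_monoid (subq A B)\<^esub>"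
  then obtain y where y: "U = cs A y" by (auto simp: subq_simps[OF A])
  then have "x + y \<in> A" using U by (simp add: subq_simps[OF A] cs_iff[OF A])
  then show "U = cs A (- x)" unfolding y by (simp add: cs_iff[OF A] add.commute)
qed

lemma submodule_subq:
  assumes A: "ws A" and B: "ws B" and N: "ws N" "A \<subseteq> N" "N \<subseteq> B"
  shows "submodule (cs A ` N) A2 (subq A B)"
proof (intro submodule.intro subgroup.intro submodule_axioms.intro)
  show "cs A ` N \<subseteq> carrier (add_monoid (subq A B))" using N by (auto simp: subq_simps[OF A])
  show "\<one>\<^bsub>add_monoid (subq A B)\<^esub> \<in> cs A ` N" using weyl_stableD(1)[OF N(1)] by (auto simp: subq_simps[OF A])
  show "U \<otimes>\<^bsub>add_monoid (subq A B)\<^esub> V \<in> cs A ` N" if "U \<in> cs A ` N" "V \<in> cs A ` N" for U V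
    using that weyl_stableD(2)[OF N(1)] by (auto simp: subq_simps[OF A])
  show "inv\<^bsub>add_monoid (subq A B)\<^esub> U \<in> cs A ` N" if "U \<in> cs A ` N" for U
    using that N weyl_stableD(6)[OF N(1)] by (auto simp: subq_inv[OF A B])
  show "r \<odot>\<^bsub>subq A B\<^esub> U \<in> cs A ` N" if "r \<in> carrier A2" "U \<in> cs A ` N" for r U
    using that weyl_stable_free_act[OF N(1)] by (auto simp: A2_simps subq_simps[OF A])
qed

lemma submodule_subq_pullback:
  assumes A: "ws A" and B: "ws B" and AB: "A \<subseteq> B" and N: "submodule N A2 (subq A B)"
  defines "N' \<equiv> {x \<in> B. cs A x \<in> N}"
  shows "ws N'" "A \<subseteq> N'" "N' \<subseteq> B" "cs A ` N' = N"
proof -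
  interpret N: submodule N A2 "subq A B" by (rule N)
  have act: "free_act m \<alpha> \<beta> w x \<in> N'" if "x \<in> N'" for w x
    using N.smult_closed[of "weyl_class w" "cs A x"] that weyl_stable_free_act[OF B]
    by (simp add: A2_simps subq_simps[OF A] N'_def)
  have zero: "cs A 0 \<in> N" using N.one_closed by (simp add: subq_simps[OF A])
  show "A \<subseteq> N'"
  proof
    fix x assume x: "x \<in> A"
    then have "cs A x = cs A 0" by (simp add: cs_iff[OF A])
    then show "x \<in> N'" using zero x AB by (auto simp: N'_def)
  qed
  show "N' \<subseteq> B" by (auto simp: N'_def)
  show "cs A ` N' = N" using N.subset by (auto simp: N'_def subq_simps[OF A])
  have "Fract (const_xy c) 1 * x \<in> N'" if "x \<in> N'" for c x
    using act[OF that, of "Poly_Mapping.single 0 c"] by (simp add: free_act_single zero_free_word_def)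
  moreover have "gen_act m \<alpha> \<beta> g x \<in> N'" if "x \<in> N'" for g x
    using act[OF that, of "gen g"] by (simp only: gen_act_free)
  moreover have "x + y \<in> N'" if "x \<in> N'" "y \<in> N'" for x y
    using N.m_closed[of "cs A x" "cs A y"] that weyl_stableD(2)[OF B] by (simp add: N'_def subq_simps[OF A])
  moreover have "0 \<in> N'" using zero weyl_stableD(1)[OF B] by (simp add: N'_def)
  ultimately show "ws N'" using B by (auto simp: weyl_stable_def N'_def)
qed

text \<open>By the correspondence between submodules of a quotient and intermediate submodules,
  simplicity becomes the covering relation of the lattice.\<close>

lemma simple_subq:
  assumes A: "ws A" and B: "ws B" and AB: "A \<subseteq> B"
  shows "simple_module A2 (subq A B) \<longleftrightarrow> A \<noteq> B \<and> (\<forall>N. ws N \<longrightarrow> A \<subseteq> N \<longrightarrow> N \<subseteq> B \<longrightarrow> N = A \<or> N = B)"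
proof -
  have inj: "N = N'" if N: "ws N" "A \<subseteq> N" "ws N'" "A \<subseteq> N'" and eq: "cs A ` N = cs A ` N'" for N N'
  proof -
    have "N \<subseteq> N'" if N: "ws N" "A \<subseteq> N" "ws N'" "A \<subseteq> N'" and eq: "cs A ` N = cs A ` N'" for N N'
    proof
      fix x assume "x \<in> N"
      then obtain y where y: "y \<in> N'" "cs A x = cs A y" using eq by blast
      then have "x - y \<in> N'" using cs_iff[OF A] N by blast
      then show "x \<in> N'" using weyl_stableD(2)[OF N(3) _ y(1), of "x - y"] by simp
    qed
    from this[OF N eq] this[OF N(3,4,1,2) eq[symmetric]] show ?thesis by blast
  qed
  have "cs A x = cs A 0" if "x \<in> A" for x using that by (simp add: cs_iff[OF A])
  then have "cs A ` A = {cs A 0}" using weyl_stableD(1)[OF A] by blast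
  then have csA: "cs A ` A = {\<zero>\<^bsub>subq A B\<^esub>}" by (simp only: subq_simps[OF A])
  have csB: "cs A ` B = carrier (subq A B)" by (simp add: subq_simps[OF A])
  show ?thesis
  proof
    assume s: "simple_module A2 (subq A B)"
    show "A \<noteq> B \<and> (\<forall>N. ws N \<longrightarrow> A \<subseteq> N \<longrightarrow> N \<subseteq> B \<longrightarrow> N = A \<or> N = B)"
    proof (intro conjI allI impI)
      show "A \<noteq> B" using s csA csB unfolding simple_module_def by metis
      fix N assume N: "ws N" "A \<subseteq> N" "N \<subseteq> B"
      then have "cs A ` N = cs A ` A \<or> cs A ` N = cs A ` B"
        using s submodule_subq[OF A B N] unfolding simple_module_def csA csB by blast
      then show "N = A \<or> N = B" using inj[OF N(1,2)] A B AB by blast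
    qed
  next
    assume r: "A \<noteq> B \<and> (\<forall>N. ws N \<longrightarrow> A \<subseteq> N \<longrightarrow> N \<subseteq> B \<longrightarrow> N = A \<or> N = B)"
    show "simple_module A2 (subq A B)"
      unfolding simple_module_def csA[symmetric] csB[symmetric]
    proof (intro conjI allI impI)
      show "cs A ` B \<noteq> cs A ` A" using inj[OF B AB A subset_refl] r by blast
      fix N assume N: "submodule N A2 (subq A B)"
      define N' where "N' = {x \<in> B. cs A x \<in> N}"
      note p = submodule_subq_pullback[OF A B AB N, folded N'_def]
      have "N' = A \<or> N' = B" using r p(1-3) by blast
      then have "cs A ` N' = cs A ` A \<or> cs A ` N' = cs A ` B" by (elim disjE) (simp_all only: simp_thms)
      then show "N = cs A ` A \<or> N = cs A ` B" unfolding p(4) .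
    qed
  qed
qed

text \<open>The points where the localization of the quotient of \<open>B\<close> by
  \<open>A\<close> is nonzero, phrased on representatives so that it can serve as the label of a
  pair.\<close>

definition supp :: "ratfun_xy set \<Rightarrow> ratfun_xy set \<Rightarrow> (complex \<times> complex) set" where
  "supp A B = {p. \<exists>b\<in>B. \<forall>s\<in>denominators p. Fract s 1 * b \<notin> A}"

lemma denominators_1: "1 \<in> denominators p"
  by (simp add: denominators_def eval_xy_def)

text \<open>A localization vanishes exactly when each element is killed by some denominator; in that
  case any two fractions are equivalent and the stalk has a single class.\<close>

lemma support_subq:
  assumes A: "ws A" and B: "ws B" and AB: "A \<subseteq> B"
  shows "support (subq A B) = supp A B"
proof -
  define N where "N = poly_restrict (subq A B)"
  have N1: "carrier N = cs A ` B" "\<zero>\<^bsub>N\<^esub> = cs A 0"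
    by (simp_all add: N_def poly_restrict_def subq_simps[OF A])
  have N2: "f \<odot>\<^bsub>N\<^esub> cs A x = cs A (Fract f 1 * x)" for f x
  proof -
    have "f \<odot>\<^bsub>N\<^esub> cs A x = cs A (poly_to_weyl f \<odot>\<^bsub>MM\<^esub> x)"
      by (simp add: N_def poly_restrict_def poly_to_weyl_def subq_simps[OF A] M_mod_smult)
    then show ?thesis by (simp only: poly_to_weyl_act)
  qed
  have rel: "((cs A x, s), (cs A y, s')) \<in> frac_rel N p \<longleftrightarrow> s \<in> denominators p \<and> s' \<in> denominators p \<and>
     (\<exists>v\<in>denominators p. Fract v 1 * (Fract s' 1 * x - Fract s 1 * y) \<in> A)"
    if "x \<in> B" "y \<in> B" for x y s s' p
    using that by (auto simp: frac_rel_def N1 N2 cs_iff[OF A] right_diff_distrib)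
  have 0: "0 \<in> B" using weyl_stableD(1)[OF B] .
  have "p \<in> support (subq A B) \<longleftrightarrow> p \<in> supp A B" for p
  proof -
    let ?c0 = "frac_rel N p `` {(cs A 0, 1)}"
    have st: "p \<in> support (subq A B) \<longleftrightarrow> stalk N p \<noteq> {?c0}"
      by (simp add: support_def N_def[symmetric] Let_def N1)
    show ?thesis
    proof
      assume "p \<in> supp A B"
      then obtain b where b: "b \<in> B" "\<forall>s\<in>denominators p. Fract s 1 * b \<notin> A" by (auto simp: supp_def)
      show "p \<in> support (subq A B)"
      proof (rule ccontr)
        assume "p \<notin> support (subq A B)"
        then have "stalk N p = {?c0}" using st by simp
        moreover have "frac_rel N p `` {(cs A b, 1)} \<in> stalk N p"
          unfolding stalk_def using b(1) denominators_1 by (intro quotientI) (simp add: N1)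
        ultimately have "frac_rel N p `` {(cs A b, 1)} = ?c0" by simp
        moreover have "((cs A b, 1), (cs A b, 1)) \<in> frac_rel N p"
          unfolding rel[OF b(1) b(1)] using denominators_1[of p] weyl_stableD(1)[OF A] by auto
        ultimately have "((cs A 0, 1), (cs A b, 1)) \<in> frac_rel N p" by blast
        then obtain v where v: "v \<in> denominators p" "Fract v 1 * (- b) \<in> A"
          unfolding rel[OF 0 b(1)] by (auto simp: One_fract_def[symmetric])
        then show False using b(2) weyl_stableD(6)[OF A v(2)] by simp
      qed
    next
      assume sup: "p \<in> support (subq A B)"
      show "p \<in> supp A B"
      proof (rule ccontr)
        assume "p \<notin> supp A B"
        then have tor: "\<exists>s\<in>denominators p. Fract s 1 * b \<in> A" if "b \<in> B" for b using that by (auto simp: supp_def)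
        have all: "((cs A x, s), (cs A y, s')) \<in> frac_rel N p"
          if "x \<in> B" "y \<in> B" "s \<in> denominators p" "s' \<in> denominators p" for x y s s'
        proof -
          have "Fract s' 1 * x - Fract s 1 * y \<in> B"
            by (intro weyl_stableD(7)[OF B] weyl_stable_poly[OF B] that)
          then show ?thesis using tor rel[OF that(1,2)] that by blast
        qed
        have cl: "frac_rel N p `` {(cs A x, s)} = cs A ` B \<times> denominators p"
          if "x \<in> B" "s \<in> denominators p" for x s
          using all[OF that(1) _ that(2)] by (auto simp: frac_rel_def N1)
        have "stalk N p = {?c0}"
        proof (rule equalityI; rule subsetI)
          fix U assume "U \<in> stalk N p"
          then obtain z where z: "z \<in> cs A ` B \<times> denominators p" "U = frac_rel N p `` {z}"
            unfolding stalk_def N1(1) by (rule quotientE)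
          then obtain x s where "x \<in> B" "s \<in> denominators p" "z = (cs A x, s)" by blast
          then show "U \<in> {?c0}" using z(2) cl cl[OF 0 denominators_1] by simp
        next
          fix U assume "U \<in> {?c0}"
          then show "U \<in> stalk N p"
            unfolding stalk_def using 0 denominators_1[of p] by (auto simp: N1 intro!: quotientI)
        qed
        then show False using sup st by simp
      qed
    qed
  qed
  then show ?thesis by (rule Set.set_eqI)
qed

lemma factor_eq: "factor MM C i = subq (C i) (C (Suc i))"
  by (simp add: factor_def subq_def)

text \<open>In \<open>b = x + y\<close> the summand from \<open>A\<close> disappears modulo
  \<open>A\<close>, so the same denominators kill \<open>b\<close> and \<open>y\<close>.\<close>

lemma supp_setsum:
  assumes A: "ws A" and Y: "ws Y"
  shows "supp A (setsum A Y) = supp (A \<inter> Y) Y"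
proof -
  have "p \<in> supp A (setsum A Y) \<longleftrightarrow> p \<in> supp (A \<inter> Y) Y" for p
  proof
    assume "p \<in> supp A (setsum A Y)"
    then obtain b where b: "b \<in> setsum A Y" "\<forall>s\<in>denominators p. Fract s 1 * b \<notin> A" by (auto simp: supp_def)
    then obtain x y where xy: "x \<in> A" "y \<in> Y" "b = x + y" by (auto simp: setsum_def)
    have "Fract s 1 * y \<notin> A \<inter> Y" if "s \<in> denominators p" for s
      using b(2) that weyl_stableD(2)[OF A weyl_stable_poly[OF A xy(1)], of "Fract s 1 * y" s] xy by (auto simp: distrib_left)
    then show "p \<in> supp (A \<inter> Y) Y" using xy by (auto simp: supp_def)
  next
    assume "p \<in> supp (A \<inter> Y) Y"
    then obtain y where y: "y \<in> Y" "\<forall>s\<in>denominators p. Fract s 1 * y \<notin> A \<inter> Y" by (auto simp: supp_def)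
    then have "y \<in> setsum A Y" "\<forall>s\<in>denominators p. Fract s 1 * y \<notin> A"
      using weyl_stableD(1)[OF A] weyl_stable_poly[OF Y y(1)] unfolding setsum_def by force+
    then show "p \<in> supp A (setsum A Y)" by (auto simp: supp_def)
  qed
  then show ?thesis by (rule Set.set_eqI)
qed

lemma ws_Int:
  assumes A: "ws A" and B: "ws B"
  shows "ws (A \<inter> B)"
  unfolding weyl_stable_def
proof (intro conjI ballI allI)
  show "A \<inter> B \<subseteq> localization (\<Prod>i=1..m. \<alpha> i)" using weyl_stableD(5)[OF A] by blast
qed (use weyl_stableD(1-4)[OF A] weyl_stableD(1-4)[OF B] in simp_all)

lemma ws_setsum:
  assumes A: "ws A" and B: "ws B"
  shows "ws (setsum A B)"
proof -
  have "setsum A B \<subseteq> localization (\<Prod>i=1..m. \<alpha> i)"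
  proof
    fix z assume "z \<in> setsum A B"
    then obtain x y where "x \<in> A" "y \<in> B" "z = x + y" by (auto simp: setsum_def)
    then show "z \<in> localization (\<Prod>i=1..m. \<alpha> i)"
      using M.a_closed[of x y] weyl_stableD(5)[OF A, of x] weyl_stableD(5)[OF B, of y] by (simp add: M_mod_simps)
  qed
  moreover have "0 \<in> setsum A B" using weyl_stableD(1)[OF A] weyl_stableD(1)[OF B] unfolding setsum_def
    by (intro CollectI exI[of _ 0]) simp
  moreover have "x + y \<in> setsum A B" if xy: "x \<in> setsum A B" "y \<in> setsum A B" for x y
  proof -
    obtain a b a' b' where *: "x = a + b" "y = a' + b'" "a \<in> A" "b \<in> B" "a' \<in> A" "b' \<in> B"
      using xy by (auto simp: setsum_def)
    then have "x + y = (a + a') + (b + b')" "a + a' \<in> A" "b + b' \<in> B" using weyl_stableD(2)[OF A] weyl_stableD(2)[OF B] by auto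
    then show ?thesis unfolding setsum_def by blast
  qed
  moreover have "Fract (const_xy c) 1 * x \<in> setsum A B" if "x \<in> setsum A B" for c x
  proof -
    obtain a b where "x = a + b" "a \<in> A" "b \<in> B" using \<open>x \<in> setsum A B\<close> by (auto simp: setsum_def)
    then show ?thesis using weyl_stableD(3)[OF A, of a c] weyl_stableD(3)[OF B, of b c]
      unfolding setsum_def by (auto simp only: distrib_left)
  qed
  moreover have "gen_act m \<alpha> \<beta> g x \<in> setsum A B" if "x \<in> setsum A B" for g x
  proof -
    obtain a b where "x = a + b" "a \<in> A" "b \<in> B" using \<open>x \<in> setsum A B\<close> by (auto simp: setsum_def)
    then show ?thesis using weyl_stableD(4)[OF A, of a g] weyl_stableD(4)[OF B, of b g]
      unfolding setsum_def by (auto simp only: gen_act_add)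
  qed
  ultimately show ?thesis by (auto simp: weyl_stable_def)
qed

sublocale L: subgroup_lattice ws supp
proof (rule subgroup_lattice.intro)
  fix A B :: "ratfun_xy set" and x y :: ratfun_xy
  assume A: "ws A"
  show "0 \<in> A" by (rule weyl_stableD(1)[OF A])
  show "x \<in> A \<Longrightarrow> y \<in> A \<Longrightarrow> x + y \<in> A" by (rule weyl_stableD(2)[OF A])
  show "x \<in> A \<Longrightarrow> - x \<in> A" by (rule weyl_stableD(6)[OF A])
  assume B: "ws B"
  show "ws (A \<inter> B)" "ws (setsum A B)" by (rule ws_Int[OF A B], rule ws_setsum[OF A B])
  show "supp A (setsum A B) = supp (A \<inter> B) B" by (rule supp_setsum[OF A B])
qed

lemma composition_series_iff: "composition_series A2 MM C r \<longleftrightarrow> L.chain C r (carrier MM)"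
proof -
  have step: "C i \<subset> C (Suc i) \<and> simple_module A2 (factor MM C i) \<longleftrightarrow> L.covers (C i) (C (Suc i))"
    if "ws (C i)" "ws (C (Suc i))" for i
  proof (cases "C i \<subseteq> C (Suc i)")
    case True
    then show ?thesis using simple_subq[OF that True] that
      by (simp add: L.covers_def factor_eq psubset_eq)
  next
    case False
    then show ?thesis by (simp add: L.covers_def psubset_eq)
  qed
  have "(\<forall>i<r. C i \<subset> C (Suc i) \<and> simple_module A2 (factor MM C i)) \<longleftrightarrow> (\<forall>i<r. L.covers (C i) (C (Suc i)))"
    if "\<forall>i\<le>r. ws (C i)"
    using step that by (simp add: Suc_leI)
  then show ?thesis
    unfolding composition_series_def L.chain_def submodule_iff M_mod_simps(1) by blast
qed

lemma num_factors_with_support_eq: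
  assumes "L.chain C r (carrier MM)"
  shows "num_factors_with_support MM C r Z = card {i. i < r \<and> supp (C i) (C (Suc i)) \<in> {Z}}"
proof -
  have "support (factor MM C i) = supp (C i) (C (Suc i))" if "i < r" for i
    unfolding factor_eq using L.chain_sub[OF assms] L.chain_mono[OF assms, of i "Suc i"] that
    by (intro support_subq) simp_all
  then show ?thesis unfolding num_factors_with_support_def by (intro arg_cong[of _ _ card]) auto
qed

text \<open>One explicit chain suffices: by \<open>chain_count\<close> its length and its supports
  are those of every composition series.\<close>

lemma composition_series_invariants:
  assumes C: "L.chain C r (carrier MM)"
  shows "finite_length A2 MM" "num_factors A2 MM = r"
    "composition_series A2 MM D s \<Longrightarrow>
      num_factors_with_support MM D s Z = card {i. i < r \<and> supp (C i) (C (Suc i)) = Z}"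
proof -
  show "finite_length A2 MM" using C by (auto simp: finite_length_def composition_series_iff)
  show "num_factors A2 MM = r" unfolding num_factors_def composition_series_iff
  proof (rule the_equality)
    show "\<exists>C. L.chain C r (carrier MM)" using C by blast
    show "\<And>s. \<exists>D. L.chain D s (carrier MM) \<Longrightarrow> s = r" using L.chain_length[OF C] by (elim exE)
  qed
  show "num_factors_with_support MM D s Z = card {i. i < r \<and> supp (C i) (C (Suc i)) = Z}"
    if "composition_series A2 MM D s"
    using that num_factors_with_support_eq[of D s Z] L.chain_count[OF C, of D s "{Z}"]
    by (simp add: composition_series_iff)
qed

end

section \<open>Line arrangements\<close>

definition dlog :: "('a::field \<Rightarrow> 'a) \<Rightarrow> 'a \<Rightarrow> 'a" where "dlog D x = D x / x"

lemma dlog_mult: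
  assumes "is_derivation D" "x \<noteq> 0" "y \<noteq> 0"
  shows "dlog D (x * y) = dlog D x + dlog D y"
  using assms by (simp add: dlog_def derivationD field_simps)

lemma dlog_inverse:
  assumes "is_derivation D" "x \<noteq> 0"
  shows "dlog D (inverse x) = - dlog D x"
proof -
  have "dlog D (x * inverse x) = 0" using assms by (simp add: dlog_def derivationD)
  then have "dlog D x + dlog D (inverse x) = 0" using dlog_mult[OF assms(1,2), of "inverse x"] assms(2) by simp
  then show ?thesis by (simp add: eq_neg_iff_add_eq_0 add.commute)
qed

lemma dlog_power: "is_derivation D \<Longrightarrow> x \<noteq> 0 \<Longrightarrow> dlog D (x ^ n) = of_nat n * dlog D x"
  by (induction n) (simp_all add: dlog_mult algebra_simps, simp add: dlog_def derivationD)

lemma dlog_power_int: "is_derivation D \<Longrightarrow> x \<noteq> 0 \<Longrightarrow> dlog D (x powi n) = of_int n * dlog D x"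
  by (cases "n \<ge> 0") (simp_all add: power_int_def dlog_power dlog_inverse power_inverse[symmetric] del: power_inverse)

lemma dlog_prod:
  assumes "is_derivation D" "\<And>i. i \<in> A \<Longrightarrow> f i \<noteq> 0"
  shows "dlog D (\<Prod>i\<in>A. f i) = (\<Sum>i\<in>A. dlog D (f i))"
  using assms(2)
proof (induction A rule: infinite_finite_induct)
  case (insert x F)
  then show ?case using dlog_mult[OF assms(1), of "f x" "\<Prod>i\<in>F. f i"] by simp
qed (simp_all add: dlog_def derivationD[OF assms(1)])

declare add_fract [simp del] mult_fract [simp del] minus_fract [simp del] divide_fract [simp del]
  diff_fract [simp del] inverse_fract [simp del]

abbreviation emb :: "poly_xy \<Rightarrow> ratfun_xy" where "emb g \<equiv> Fract g 1"
abbreviation kc :: "complex \<Rightarrow> ratfun_xy" where "kc c \<equiv> emb (const_xy c)"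

lemma emb_add: "emb (f + g) = emb f + emb g" and emb_mult: "emb (f * g) = emb f * emb g"
  and emb_0: "emb 0 = 0" and emb_1: "emb 1 = 1"
  by (simp_all add: Zero_fract_def One_fract_def add_fract mult_fract)

lemma emb_eq_iff: "emb f = emb g \<longleftrightarrow> f = g"
  by (simp add: eq_fract)

lemma emb_eq_0_iff: "emb f = 0 \<longleftrightarrow> f = 0"
  using emb_eq_iff[of f 0] by (simp add: emb_0)

lemma emb_power: "emb (f ^ n) = emb f ^ n"
  by (induction n) (simp_all only: power.simps emb_1 emb_mult)

lemma emb_prod: "emb (\<Prod>i\<in>A. f i) = (\<Prod>i\<in>A. emb (f i))"
  by (induction A rule: infinite_finite_induct) (simp_all add: emb_1 emb_mult)

lemma Fract_emb: "g \<noteq> 0 \<Longrightarrow> Fract f g = emb f / emb g"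
  by (simp add: divide_fract)

lemma kc_inject: "kc c = kc d \<longleftrightarrow> c = d"
  by (simp add: emb_eq_iff const_xy_def)

lemma kc_0: "kc 0 = 0" and kc_1: "kc 1 = 1"
  by (simp_all add: const_xy_def Zero_fract_def One_fract_def one_pCons)

lemmas kc_add = const_arith(1) and kc_mult = const_arith(2)

lemma kc_minus: "kc (- c) = - kc c"
  using kc_add[of c "- c"] by (simp add: kc_0 eq_neg_iff_add_eq_0 add.commute)

lemma kc_divide: "d \<noteq> 0 \<Longrightarrow> kc (c / d) = kc c / kc d"
proof -
  assume d: "d \<noteq> 0"
  then have "kc d \<noteq> 0" using kc_inject[of d 0] by (simp add: kc_0)
  moreover have "kc (c / d) * kc d = kc c" using d by (simp flip: kc_mult)
  ultimately show ?thesis by (metis nonzero_mult_div_cancel_right)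
qed

lemma kc_of_int: "kc (of_int n) = of_int n"
proof -
  have *: "kc (of_nat j) = of_nat j" for j by (induction j) (simp_all only: of_nat_0 of_nat_Suc kc_0 kc_add kc_1)
  show ?thesis by (cases n rule: int_cases2) (simp_all only: of_int_minus of_int_of_nat_eq kc_minus *)
qed

lemma linear_form_coeffs:
  assumes "linear_form f"
  shows "f = const_xy (coeff (coeff f 0) 1) * var_x + const_xy (coeff (coeff f 1) 0) * var_y"
proof -
  obtain a b where f: "f = const_xy a * var_x + const_xy b * var_y" using assms by (auto simp: linear_form_def)
  have "f = [:[:0, a:], [:b:]:]" by (simp add: f const_xy_def var_x_def var_y_def)
  then have "coeff (coeff f 0) 1 = a" "coeff (coeff f 1) 0 = b" by simp_all
  then show ?thesis using f by simp
qed

locale arrangement =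
  fixes k m :: nat and \<alpha> :: "nat \<Rightarrow> poly_xy" and \<beta> :: "nat \<Rightarrow> complex"
  assumes k1: "1 \<le> k" and km: "k < m"
    and lin: "\<And>i. i \<in> {1..m} \<Longrightarrow> linear_form (\<alpha> i)"
    and indep: "\<And>i j. i \<in> {1..m} \<Longrightarrow> j \<in> {1..m} \<Longrightarrow> i \<noteq> j \<Longrightarrow> lin_indep2 (\<alpha> i) (\<alpha> j)"
    and \<beta>_int: "\<And>i. i \<in> {1..k} \<Longrightarrow> \<beta> i \<in> \<int>"
    and \<beta>_nonint: "\<And>i. i \<in> {k+1..m} \<Longrightarrow> \<beta> i \<notin> \<int>"
begin

definition cx :: "nat \<Rightarrow> complex" where "cx i = coeff (coeff (\<alpha> i) 0) 1"
definition cy :: "nat \<Rightarrow> complex" where "cy i = coeff (coeff (\<alpha> i) 1) 0"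

lemma \<alpha>_eq: "i \<in> {1..m} \<Longrightarrow> \<alpha> i = const_xy (cx i) * var_x + const_xy (cy i) * var_y"
  unfolding cx_def cy_def by (rule linear_form_coeffs[OF lin])

definition det :: "nat \<Rightarrow> nat \<Rightarrow> complex" where "det i j = cx i * cy j - cy i * cx j"

lemma \<alpha>_nz: "i \<in> {1..m} \<Longrightarrow> \<alpha> i \<noteq> 0"
proof
  assume i: "i \<in> {1..m}" and z: "\<alpha> i = 0"
  obtain j where j: "j \<in> {1..m}" "j \<noteq> i" using k1 km i by (metis atLeastAtMost_iff le_refl less_imp_le less_irrefl order_le_less_trans)
  have "const_xy 1 * \<alpha> i + const_xy 0 * \<alpha> j = 0" using z by (simp add: const_xy_def)
  then show False using indep[OF i j(1)] j(2) unfolding lin_indep2_def by (metis zero_neq_one)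
qed

sublocale nonzero_forms m \<alpha> \<beta>
  by unfold_locales (rule \<alpha>_nz)

lemma \<alpha>_poly: "i \<in> {1..m} \<Longrightarrow> \<alpha> i = [:[:0, cx i:], [:cy i:]:]"
  by (subst \<alpha>_eq) (simp_all add: const_xy_def var_x_def var_y_def)

lemma det_nz:
  assumes "i \<in> {1..m}" "j \<in> {1..m}" "i \<noteq> j"
  shows "det i j \<noteq> 0"
proof
  assume d: "det i j = 0"
  have ind: "a = 0 \<and> b = 0" if "const_xy a * \<alpha> i + const_xy b * \<alpha> j = 0" for a b
    using indep[OF assms] that unfolding lin_indep2_def by blast
  have "const_xy (cx j) * \<alpha> i + const_xy (- cx i) * \<alpha> j = 0" "const_xy (cy j) * \<alpha> i + const_xy (- cy i) * \<alpha> j = 0"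
    using d assms by (simp_all add: \<alpha>_poly const_xy_def det_def algebra_simps)
  then have "cx j = 0" "cy j = 0" using ind by blast+
  then show False using \<alpha>_nz[OF assms(2)] \<alpha>_poly[OF assms(2)] by simp
qed

definition \<Delta> :: complex where "\<Delta> = det m 1"

lemma range1: "1 \<in> {1..m}" "m \<in> {1..m}" "m \<noteq> 1" using k1 km by auto

lemma \<Delta>_nz: "\<Delta> \<noteq> 0" unfolding \<Delta>_def using range1 by (intro det_nz) auto

text \<open>Since \<open>k < m\<close>, the form \<open>\<alpha> m\<close> has nonintegral exponent,
  as \<open>\<omega>_nonint\<close> demands of the line at infinity; \<open>\<alpha> 1\<close> is
  merely an independent second form.\<close>

definition u :: ratfun_xy where "u = emb (\<alpha> m)"
definition v :: ratfun_xy where "v = emb (\<alpha> 1)"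
definition t :: ratfun_xy where "t = v / u"

lemma u_nz: "u \<noteq> 0" unfolding u_def emb_eq_0_iff using \<alpha>_nz range1 by blast

lemma v_eq: "v = u * t" by (simp add: t_def u_nz)

lemma emb_\<alpha>: "i \<in> {1..m} \<Longrightarrow> emb (\<alpha> i) = kc (cx i) * emb var_x + kc (cy i) * emb var_y"
  by (subst \<alpha>_eq, assumption) (simp only: emb_add emb_mult)

lemma kc_det: "kc (det i j) = kc (cx i) * kc (cy j) - kc (cy i) * kc (cx j)"
  using kc_add[of "cx i * cy j" "- (cy i * cx j)"] by (simp add: det_def kc_mult kc_minus)

lemma xy_uv: "kc \<Delta> * emb var_x = kc (cy 1) * u - kc (cy m) * v"
  "kc \<Delta> * emb var_y = kc (cx m) * v - kc (cx 1) * u"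
  unfolding u_def v_def emb_\<alpha>[OF range1(1)] emb_\<alpha>[OF range1(2)] \<Delta>_def kc_det
  by (simp_all add: algebra_simps)

definition C\<^sub>v :: "nat \<Rightarrow> complex" where "C\<^sub>v i = det m i / \<Delta>"
definition C\<^sub>u :: "nat \<Rightarrow> complex" where "C\<^sub>u i = det i 1 / \<Delta>"

lemma kc\<Delta>_nz: "kc \<Delta> \<noteq> 0" using \<Delta>_nz kc_inject[of \<Delta> 0] by (simp add: kc_0)

text \<open>Cramer's rule in the basis \<open>u\<close>, \<open>v\<close>.\<close>

lemma emb_\<alpha>_uv: "i \<in> {1..m} \<Longrightarrow> emb (\<alpha> i) = kc (C\<^sub>u i) * u + kc (C\<^sub>v i) * v"
proof -
  assume i: "i \<in> {1..m}"
  have "kc \<Delta> * emb (\<alpha> i) = kc (cx i) * (kc \<Delta> * emb var_x) + kc (cy i) * (kc \<Delta> * emb var_y)"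
    unfolding emb_\<alpha>[OF i] by (simp add: algebra_simps)
  also have "\<dots> = kc (det i 1) * u + kc (det m i) * v"
    unfolding xy_uv kc_det by (simp add: algebra_simps)
  finally show ?thesis using kc\<Delta>_nz unfolding C\<^sub>u_def C\<^sub>v_def kc_divide[OF \<Delta>_nz]
    by (simp add: field_simps)
qed

definition a :: "nat \<Rightarrow> complex" where "a i = - C\<^sub>u i / C\<^sub>v i"

lemma Cv_nz: "i \<in> {1..m} \<Longrightarrow> i \<noteq> m \<Longrightarrow> C\<^sub>v i \<noteq> 0"
  unfolding C\<^sub>v_def using det_nz[OF range1(2)] \<Delta>_nz by auto

definition I :: "nat set" where "I = {1..m-1}"

lemma I_iff: "i \<in> I \<longleftrightarrow> i \<in> {1..m} \<and> i \<noteq> m"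
  using k1 km by (auto simp: I_def)

lemma emb_\<alpha>_t: "i \<in> I \<Longrightarrow> emb (\<alpha> i) = kc (C\<^sub>v i) * u * (t - kc (a i))"
proof -
  assume "i \<in> I"
  then have i: "i \<in> {1..m}" and c: "C\<^sub>v i \<noteq> 0" using Cv_nz I_iff by auto
  have "kc (C\<^sub>u i) = - (kc (C\<^sub>v i) * kc (a i))"
    using c by (simp add: a_def flip: kc_mult kc_minus)
  then show ?thesis unfolding emb_\<alpha>_uv[OF i] v_eq by (simp add: algebra_simps)
qed

lemma inj_a: "inj_on a I"
proof (rule inj_onI, rule ccontr)
  fix i j assume i: "i \<in> I" and j: "j \<in> I" and eq: "a i = a j" and ne: "i \<noteq> j"
  then have i': "i \<in> {1..m}" "j \<in> {1..m}" by (auto simp: I_iff)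
  have "kc (C\<^sub>v j) * emb (\<alpha> i) + kc (- C\<^sub>v i) * emb (\<alpha> j) = 0"
    unfolding emb_\<alpha>_t[OF i] emb_\<alpha>_t[OF j] eq kc_minus by (simp add: algebra_simps)
  then have "const_xy (C\<^sub>v j) * \<alpha> i + const_xy (- C\<^sub>v i) * \<alpha> j = 0"
    by (simp only: emb_mult[symmetric] emb_add[symmetric] emb_eq_0_iff)
  then have "C\<^sub>v j = 0" using indep[OF i' ne] unfolding lin_indep2_def by blast
  then show False using Cv_nz j by (auto simp: I_iff)
qed

lemma t_nonconst: "t \<noteq> kc c"
proof
  assume "t = kc c"
  then have "kc 1 * emb (\<alpha> 1) + kc (- c) * emb (\<alpha> m) = 0" using v_eq by (simp add: u_def v_def kc_1 kc_minus)
  then have "const_xy 1 * \<alpha> 1 + const_xy (- c) * \<alpha> m = 0"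
    by (simp only: emb_mult[symmetric] emb_add[symmetric] emb_eq_0_iff)
  then show False using indep[OF range1(1,2)] range1(3) unfolding lin_indep2_def by (metis zero_neq_one)
qed

text \<open>Integer shifts of the exponents do not change the module: \<open>n\<close> moves \<open>\<beta>\<^sub>i\<close> to \<open>0\<close> for \<open>i \<le> k\<close> and, if
  \<open>\<Sum>\<beta>\<^sub>i\<close> is an integer, the sum to \<open>0\<close>.\<close>

definition n :: "nat \<Rightarrow> int" where
  "n i = (if i \<le> k then \<lfloor>Re (\<beta> i)\<rfloor>
    else if i = m \<and> (\<Sum>i=1..m. \<beta> i) \<in> \<int> then \<lfloor>Re ((\<Sum>i=1..m. \<beta> i) - (\<Sum>i=1..k. \<beta> i))\<rfloor> else 0)"

definition \<beta>' :: "nat \<Rightarrow> complex" where "\<beta>' i = \<beta> i - of_int (n i)"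

lemma floor_Re_Ints: "z \<in> \<int> \<Longrightarrow> of_int \<lfloor>Re z\<rfloor> = z"
  by (auto elim!: Ints_cases)

lemma \<beta>'_zero: "i \<in> {1..k} \<Longrightarrow> \<beta>' i = 0"
  using floor_Re_Ints[OF \<beta>_int] by (simp add: \<beta>'_def n_def)

lemma \<beta>'_nonint: "i \<in> {k+1..m} \<Longrightarrow> \<beta>' i \<notin> \<int>"
  using \<beta>_nonint[of i] by (metis Ints_add Ints_of_int \<beta>'_def diff_add_cancel)

lemma sum_\<beta>': "(\<Sum>i=1..m. \<beta>' i) = (if (\<Sum>i=1..m. \<beta> i) \<in> \<int> then 0 else (\<Sum>i=1..m. \<beta> i) - (\<Sum>i=1..k. \<beta> i))"
proof -
  have "(\<Sum>i=1..m. of_int (n i) :: complex) = (\<Sum>i=1..k. \<beta> i) + (\<Sum>i=k+1..m. of_int (n i))"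
  proof -
    have "{1..m} = {1..k} \<union> {k+1..m}" using km by auto
    moreover have "{1..k} \<inter> {k+1..m} = {}" by auto
    ultimately have "(\<Sum>i=1..m. of_int (n i) :: complex) = (\<Sum>i=1..k. of_int (n i)) + (\<Sum>i=k+1..m. of_int (n i))"
      by (simp add: sum.union_disjoint)
    also have "(\<Sum>i=1..k. of_int (n i) :: complex) = (\<Sum>i=1..k. \<beta> i)"
      by (rule sum.cong) (auto simp: n_def floor_Re_Ints[OF \<beta>_int])
    finally show ?thesis .
  qed
  also have "(\<Sum>i=k+1..m. of_int (n i) :: complex) = of_int (n m)"
  proof -
    have "(\<Sum>i=k+1..m. of_int (n i) :: complex) = (\<Sum>i\<in>{m}. of_int (n i))"
      by (rule sum.mono_neutral_right) (use km in \<open>auto simp: n_def\<close>)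
    then show ?thesis by simp
  qed
  also have "of_int (n m) = (if (\<Sum>i=1..m. \<beta> i) \<in> \<int> then (\<Sum>i=1..m. \<beta> i) - (\<Sum>i=1..k. \<beta> i) else 0)"
  proof -
    have "(\<Sum>i=1..k. \<beta> i) \<in> \<int>" by (intro Ints_sum \<beta>_int)
    then have "(\<Sum>i=1..m. \<beta> i) \<in> \<int> \<Longrightarrow> (\<Sum>i=1..m. \<beta> i) - (\<Sum>i=1..k. \<beta> i) \<in> \<int>" by (rule Ints_diff[rotated])
    then have d: "(\<Sum>i=1..m. \<beta> i) \<in> \<int> \<Longrightarrow> of_int \<lfloor>Re ((\<Sum>i=1..m. \<beta> i) - (\<Sum>i=1..k. \<beta> i))\<rfloor> =
        (\<Sum>i=1..m. \<beta> i) - (\<Sum>i=1..k. \<beta> i)" by (rule floor_Re_Ints)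
    have mk: "(m \<le> k) = False" using km by simp
    show ?thesis
      by (cases "(\<Sum>i=1..m. \<beta> i) \<in> \<int>") (simp_all only: n_def mk d if_True if_False simp_thms of_int_0)
  qed
  finally show ?thesis by (simp add: \<beta>'_def sum_subtractf)
qed

lemma sum_I: "(\<Sum>i=1..m. f i) = (\<Sum>i\<in>I. f i) + f m"
proof -
  have "{1..m} = insert m I" "m \<notin> I" using k1 km by (auto simp: I_def)
  then show ?thesis by (simp add: I_def add.commute)
qed

lemma sum_cases: "(\<Sum>i\<in>I. \<beta>' i) + \<beta>' m \<notin> \<int> \<or> (\<Sum>i\<in>I. \<beta>' i) + \<beta>' m = 0"
proof (cases "(\<Sum>i=1..m. \<beta> i) \<in> \<int>")
  case True then show ?thesis using sum_\<beta>' sum_I[of \<beta>'] by simp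
next
  case False
  have "(\<Sum>i=1..k. \<beta> i) \<in> \<int>" by (intro Ints_sum \<beta>_int)
  then show ?thesis using False sum_\<beta>' sum_I[of \<beta>'] by (metis Ints_add diff_add_cancel)
qed

section \<open>Derivations dual to the coordinates u and v\<close>

abbreviation "fdx \<equiv> fract_deriv poly_dx"
abbreviation "fdy \<equiv> fract_deriv poly_dy"

lemmas der_xy = is_derivation_fract_deriv[OF is_derivation_dx] is_derivation_fract_deriv[OF is_derivation_dy]

lemma derivation_comb: "is_derivation D \<Longrightarrow> is_derivation E \<Longrightarrow> is_derivation (\<lambda>f. c * D f + d * E (f :: 'b::comm_ring_1))"
  by (simp add: is_derivation_def algebra_simps)

text \<open>\<open>pu\<close> and \<open>pv\<close> are the derivations dual to \<open>u\<close> and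
  \<open>v\<close>, obtained from the inverse coefficient matrix, and \<open>ev\<close> is the Euler
  field.\<close>

definition pu :: "ratfun_xy \<Rightarrow> ratfun_xy" where "pu f = kc (cy 1 / \<Delta>) * fdx f + kc (- cx 1 / \<Delta>) * fdy f"
definition pv :: "ratfun_xy \<Rightarrow> ratfun_xy" where "pv f = kc (- cy m / \<Delta>) * fdx f + kc (cx m / \<Delta>) * fdy f"
definition ev :: "ratfun_xy \<Rightarrow> ratfun_xy" where "ev f = emb var_x * fdx f + emb var_y * fdy f"

lemma der_p: "is_derivation pu" "is_derivation pv" "is_derivation ev"
  unfolding pu_def[abs_def] pv_def[abs_def] ev_def[abs_def] by (intro derivation_comb der_xy)+

lemma fd_emb: "fdx (emb g) = emb (poly_dx g)" "fdy (emb g) = emb (poly_dy g)"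
  by (simp_all add: fract_deriv_Fract is_derivation_dx is_derivation_dy derivationD[OF is_derivation_dx] derivationD[OF is_derivation_dy])

lemma fd_kc: "fdx (kc c) = 0" "fdy (kc c) = 0"
  by (simp_all only: fd_emb pderiv_const_values emb_0)

lemma fd_xy: "fdx (emb var_x) = 1" "fdy (emb var_x) = 0" "fdx (emb var_y) = 0" "fdy (emb var_y) = 1"
  by (simp_all only: fd_emb pderiv_const_values emb_0 emb_1)

lemma p_kc: "pu (kc c) = 0" "pv (kc c) = 0" "ev (kc c) = 0"
  by (simp_all only: pu_def pv_def ev_def fd_kc mult_zero_right add_0)

lemma fd_\<alpha>: "i \<in> {1..m} \<Longrightarrow> fdx (emb (\<alpha> i)) = kc (cx i)" "i \<in> {1..m} \<Longrightarrow> fdy (emb (\<alpha> i)) = kc (cy i)"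
  by (simp_all only: emb_\<alpha> derivationD[OF der_xy(1)] derivationD[OF der_xy(2)] fd_kc fd_xy mult_zero_left mult_zero_right add_0 add_0_right mult_1_right)

lemma pv_\<alpha>: "i \<in> {1..m} \<Longrightarrow> pv (emb (\<alpha> i)) = kc (C\<^sub>v i)"
proof -
  assume i: "i \<in> {1..m}"
  have "kc (C\<^sub>v i) = kc ((- cy m / \<Delta>) * cx i + (cx m / \<Delta>) * cy i)"
    by (simp add: C\<^sub>v_def det_def diff_divide_distrib algebra_simps)
  then show ?thesis unfolding pv_def fd_\<alpha>[OF i] by (simp only: kc_add kc_mult)
qed

lemma ev_\<alpha>: "i \<in> {1..m} \<Longrightarrow> ev (emb (\<alpha> i)) = emb (\<alpha> i)"
  by (simp only: ev_def fd_\<alpha>) (simp add: emb_\<alpha> mult.commute)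

lemma ev_eq: "ev f = u * pu f + v * pv f"
proof -
  have "kc \<Delta> * ev f = (kc \<Delta> * emb var_x) * fdx f + (kc \<Delta> * emb var_y) * fdy f"
    by (simp only: ev_def distrib_left mult.assoc)
  also have "\<dots> = kc \<Delta> * (u * pu f + v * pv f)"
    unfolding xy_uv pu_def pv_def kc_divide[OF \<Delta>_nz] kc_minus using kc\<Delta>_nz
    by (simp add: field_simps)
  finally show ?thesis using kc\<Delta>_nz by simp
qed

lemma pv_u: "pv u = 0"
  unfolding u_def pv_\<alpha>[OF range1(2)] by (simp add: C\<^sub>v_def det_def kc_0)

lemma pv_t: "u * pv t = 1"
proof -
  have "pv v = 1" unfolding v_def pv_\<alpha>[OF range1(1)] using \<Delta>_nz by (simp only: C\<^sub>v_def \<Delta>_def[symmetric]) (simp add: kc_1)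
  then show ?thesis unfolding v_eq derivationD(2)[OF der_p(2)] pv_u by simp
qed

lemma ev_t: "ev t = 0"
proof -
  have "ev v = v" "ev u = u" unfolding u_def v_def using ev_\<alpha> range1 by blast+
  then show ?thesis using u_nz unfolding v_eq derivationD(2)[OF der_p(3)] by simp
qed

definition \<delta> :: "ratfun_xy \<Rightarrow> ratfun_xy" where "\<delta> f = u * pv f"

sublocale twisted_line kc t \<delta> I a \<beta>' "\<beta>' m"
proof
  show "kc (c + d) = kc c + kc d" "kc (c * d) = kc c * kc d" for c d by (rule kc_add kc_mult)+
  show "kc 1 = 1" by (rule kc_1)
  show "is_derivation \<delta>" using der_p(2) by (simp add: is_derivation_def \<delta>_def algebra_simps)
  show "\<delta> (kc c) = 0" for c by (simp only: \<delta>_def p_kc mult_zero_right)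
  show "\<delta> t = 1" by (simp only: \<delta>_def pv_t)
  show "t \<noteq> kc c" for c by (rule t_nonconst)
  show "finite I" by (simp add: I_def)
  show "inj_on a I" by (rule inj_a)
  show "\<beta>' i = 0 \<or> \<beta>' i \<notin> \<int>" if "i \<in> I" for i
    using \<beta>'_zero[of i] \<beta>'_nonint[of i] that by (cases "i \<le> k") (auto simp: I_iff)
  show "\<beta>' m \<notin> \<int>" using km by (intro \<beta>'_nonint) auto
  show "(\<Sum>i\<in>I. \<beta>' i) + \<beta>' m \<notin> \<int> \<or> (\<Sum>i\<in>I. \<beta>' i) + \<beta>' m = 0" by (rule sum_cases)
qed

lemma emb_\<alpha>_nz: "i \<in> {1..m} \<Longrightarrow> emb (\<alpha> i) \<noteq> 0"
  using \<alpha>_nz emb_eq_0_iff by blast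

text \<open>Since \<open>\<beta>' i = \<beta> i - of_int (n i)\<close>, multiplying the generator
  with exponents \<open>\<beta>\<close> by \<open>e\<close> gives the generator with exponents
  \<open>\<beta>'\<close>.\<close>

definition e :: ratfun_xy where "e = (\<Prod>i=1..m. emb (\<alpha> i) powi (- n i))"

lemma e_nz: "e \<noteq> 0"
  unfolding e_def using emb_\<alpha>_nz by (simp add: power_int_eq_0_iff)

definition Ld :: "(ratfun_xy \<Rightarrow> ratfun_xy) \<Rightarrow> (nat \<Rightarrow> complex) \<Rightarrow> ratfun_xy" where
  "Ld D b = (\<Sum>i=1..m. kc (b i) * dlog D (emb (\<alpha> i)))"

definition Du :: "ratfun_xy \<Rightarrow> ratfun_xy" where "Du f = pu f + f * Ld pu \<beta>"
definition Dv :: "ratfun_xy \<Rightarrow> ratfun_xy" where "Dv f = pv f + f * Ld pv \<beta>"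

lemma gen_act_Ld: "gen_act m \<alpha> \<beta> GDx f = fdx f + f * Ld fdx \<beta>"
  "gen_act m \<alpha> \<beta> GDy f = fdy f + f * Ld fdy \<beta>"
proof -
  have "Fract (const_xy (\<beta> i) * poly_dx (\<alpha> i)) (\<alpha> i) = kc (\<beta> i) * dlog fdx (emb (\<alpha> i))"
    "Fract (const_xy (\<beta> i) * poly_dy (\<alpha> i)) (\<alpha> i) = kc (\<beta> i) * dlog fdy (emb (\<alpha> i))"
    if "i \<in> {1..m}" for i
    unfolding Fract_emb[OF \<alpha>_nz[OF that]] by (simp_all add: emb_mult dlog_def fd_emb)
  then have "(\<Sum>i=1..m. Fract (const_xy (\<beta> i) * poly_dx (\<alpha> i)) (\<alpha> i)) = Ld fdx \<beta>"
    "(\<Sum>i=1..m. Fract (const_xy (\<beta> i) * poly_dy (\<alpha> i)) (\<alpha> i)) = Ld fdy \<beta>"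
    unfolding Ld_def by (intro sum.cong refl; blast)+
  then show "gen_act m \<alpha> \<beta> GDx f = fdx f + f * Ld fdx \<beta>"
    "gen_act m \<alpha> \<beta> GDy f = fdy f + f * Ld fdy \<beta>"
    by (simp_all only: twisted_deriv_def gen_act.simps)
qed

lemma Ld_comb: "Ld (\<lambda>f. c * D f + d * E f) b = c * Ld D b + d * Ld E b"
  by (simp add: Ld_def dlog_def sum_distrib_left sum.distrib add_divide_distrib algebra_simps)

lemma D_gen_act:
  "Du f = kc (cy 1 / \<Delta>) * gen_act m \<alpha> \<beta> GDx f + kc (- cx 1 / \<Delta>) * gen_act m \<alpha> \<beta> GDy f"
  "Dv f = kc (- cy m / \<Delta>) * gen_act m \<alpha> \<beta> GDx f + kc (cx m / \<Delta>) * gen_act m \<alpha> \<beta> GDy f"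
  unfolding Du_def Dv_def gen_act_Ld pu_def[abs_def] pv_def[abs_def] Ld_comb by (simp_all add: algebra_simps)

lemma kc_det_1: "kc (cx m) * kc (cy 1) - kc (cy m) * kc (cx 1) = kc \<Delta>"
  by (simp only: \<Delta>_def kc_det)

lemma gen_act_D:
  "gen_act m \<alpha> \<beta> GDx f = kc (cx m) * Du f + kc (cx 1) * Dv f"
  "gen_act m \<alpha> \<beta> GDy f = kc (cy m) * Du f + kc (cy 1) * Dv f"
proof -
  have *: "kc \<Delta> * (kc (c / \<Delta>) * g) = kc c * g" for c g
    using \<Delta>_nz by (simp flip: mult.assoc kc_mult)
  have "kc \<Delta> * gen_act m \<alpha> \<beta> GDx f = kc \<Delta> * (kc (cx m) * Du f + kc (cx 1) * Dv f)"
    unfolding D_gen_act distrib_left mult.left_commute[of "kc \<Delta>" "kc (cx m)"] mult.left_commute[of "kc \<Delta>" "kc (cx 1)"] *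
    unfolding kc_det_1[symmetric] kc_minus by (simp add: algebra_simps)
  then show "gen_act m \<alpha> \<beta> GDx f = kc (cx m) * Du f + kc (cx 1) * Dv f" using kc\<Delta>_nz by simp
  have "kc \<Delta> * gen_act m \<alpha> \<beta> GDy f = kc \<Delta> * (kc (cy m) * Du f + kc (cy 1) * Dv f)"
    unfolding D_gen_act distrib_left mult.left_commute[of "kc \<Delta>" "kc (cy m)"] mult.left_commute[of "kc \<Delta>" "kc (cy 1)"] *
    unfolding kc_det_1[symmetric] kc_minus by (simp add: algebra_simps)
  then show "gen_act m \<alpha> \<beta> GDy f = kc (cy m) * Du f + kc (cy 1) * Dv f" using kc\<Delta>_nz by simp
qed

lemma dlog_e: "is_derivation D \<Longrightarrow> dlog D e = - (\<Sum>i=1..m. of_int (n i) * dlog D (emb (\<alpha> i)))"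
  unfolding e_def using emb_\<alpha>_nz
  by (subst dlog_prod) (auto simp: dlog_power_int sum_negf power_int_eq_0_iff)

lemma dlog_e_Ld: "is_derivation D \<Longrightarrow> dlog D e + Ld D \<beta> = Ld D \<beta>'"
proof -
  assume D: "is_derivation D"
  have "kc (\<beta>' i) = kc (\<beta> i) - of_int (n i)" for i
    unfolding \<beta>'_def using kc_add[of "\<beta> i" "- of_int (n i)"] by (simp add: kc_minus kc_of_int)
  then show ?thesis unfolding dlog_e[OF D] Ld_def by (simp add: left_diff_distrib sum_subtractf)
qed

text \<open>The logarithmic derivative of \<open>e\<close> replaces the exponents
  \<open>\<beta>\<close> by \<open>\<beta>'\<close>, and that of \<open>u powi d\<close> adds
  \<open>d\<close> to the exponent of \<open>u\<close>.\<close>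

lemma twisted_homog:
  assumes D: "is_derivation D"
  shows "D (e * u powi d * h) + e * u powi d * h * Ld D \<beta> =
    e * u powi d * (D h + h * (Ld D \<beta>' + of_int d * dlog D u))"
proof -
  let ?w = "e * u powi d"
  have w: "?w \<noteq> 0" using e_nz u_nz by (simp add: power_int_eq_0_iff)
  have "dlog D ?w = dlog D e + of_int d * dlog D u"
    using D e_nz u_nz by (simp add: dlog_mult dlog_power_int power_int_eq_0_iff)
  moreover have "D ?w = ?w * dlog D ?w" using w by (simp add: dlog_def)
  ultimately have "D (?w * h) + ?w * h * Ld D \<beta> = ?w * (D h + h * ((dlog D e + Ld D \<beta>) + of_int d * dlog D u))"
    unfolding derivationD(2)[OF D, of ?w h] by (simp add: algebra_simps)
  then show ?thesis unfolding dlog_e_Ld[OF D] .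
qed

lemma \<alpha>_po: "i \<in> I \<Longrightarrow> kc (C\<^sub>v i) / emb (\<alpha> i) = po i / u"
proof -
  assume i: "i \<in> I"
  then have "kc (C\<^sub>v i) \<noteq> 0" using Cv_nz kc_inject[of "C\<^sub>v i" 0] by (auto simp: I_iff kc_0)
  then show ?thesis unfolding emb_\<alpha>_t[OF i] pt_def[symmetric] po_def by (simp add: field_simps)
qed

lemma Ld_pv: "u * Ld pv \<beta>' = (\<Sum>i\<in>I. kc (\<beta>' i) * po i)"
proof -
  have "dlog pv (emb (\<alpha> m)) = 0" using pv_u by (simp add: dlog_def u_def)
  moreover have "dlog pv (emb (\<alpha> i)) = po i / u" if "i \<in> I" for i
    using \<alpha>_po[OF that] pv_\<alpha>[of i] that by (simp add: dlog_def I_iff)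
  ultimately have "Ld pv \<beta>' = (\<Sum>i\<in>I. kc (\<beta>' i) * (po i / u))"
    unfolding Ld_def sum_I by simp
  then show ?thesis using u_nz by (simp add: sum_distrib_left)
qed

lemma power_int_pred: "u powi d = u powi (d - 1) * u"
  using u_nz by (simp add: power_int_diff)

lemma Dv_homog: "Dv (e * u powi d * h) = e * u powi (d - 1) * nabla h"
proof -
  have "Dv (e * u powi d * h) = e * u powi d * (pv h + h * Ld pv \<beta>')"
    unfolding Dv_def twisted_homog[OF der_p(2)] by (simp add: dlog_def pv_u)
  also have "\<dots> = e * u powi (d - 1) * (u * pv h + u * Ld pv \<beta>' * h)"
    unfolding power_int_pred[of d] by (simp add: algebra_simps)
  finally show ?thesis unfolding Ld_pv nabla_def \<delta>_def .
qed

lemma ev_Q: "h \<in> Q T \<Longrightarrow> ev h = 0"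
proof (induction rule: Q.induct)
  case (Q_po i)
  have "ev (pt i) = 0"
    using derivationD(1)[OF der_p(3), of t "- kc (a i)"] by (simp add: pt_def ev_t p_kc derivationD(5)[OF der_p(3)])
  then have "pt i * ev (po i) = ev (pt i * po i)" unfolding derivationD(2)[OF der_p(3)] by simp
  then show ?case by (simp add: derivationD(4)[OF der_p(3)])
qed (auto simp: p_kc ev_t derivationD[OF der_p(3)])

lemma Ld_ev: "Ld ev \<beta>' = kc (\<Sum>i=1..m. \<beta>' i)"
proof -
  have "kc (\<beta>' i) * dlog ev (emb (\<alpha> i)) = kc (\<beta>' i)" if "i \<in> {1..m}" for i
    unfolding dlog_def ev_\<alpha>[OF that] using emb_\<alpha>_nz[OF that] by simp
  then show ?thesis unfolding Ld_def \<kappa>_sum by (intro sum.cong refl)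
qed

text \<open>\<open>Du\<close> is read off from the Euler field: \<open>ev\<close> kills functions of
  \<open>t\<close>, so \<open>u * Du + v * Dv\<close> acts in degree \<open>d\<close> by the scalar
  \<open>lam d\<close>, and the value of \<open>Dv\<close> is known.\<close>

lemma Du_homog:
  assumes h: "h \<in> Q I"
  shows "Du (e * u powi d * h) = e * u powi (d - 1) * (kc (lam d) * h - t * nabla h)"
proof -
  let ?f = "e * u powi d * h"
  have "ev = (\<lambda>f. u * pu f + v * pv f)" by (rule ext, rule ev_eq)
  from arg_cong[OF this, of "\<lambda>D. Ld D \<beta>"] have "Ld ev \<beta> = u * Ld pu \<beta> + v * Ld pv \<beta>"
    unfolding Ld_comb .
  then have "u * Du ?f + v * Dv ?f = ev ?f + ?f * Ld ev \<beta>"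
    unfolding Du_def Dv_def ev_eq[of ?f] by (simp add: algebra_simps)
  also have "\<dots> = e * u powi d * (h * (kc (\<Sum>i=1..m. \<beta>' i) + of_int d))"
  proof -
    have "dlog ev u = 1" unfolding u_def dlog_def using ev_\<alpha>[OF range1(2)] emb_\<alpha>_nz[OF range1(2)] by simp
    then show ?thesis unfolding twisted_homog[OF der_p(3)] ev_Q[OF h] Ld_ev by simp
  qed
  also have "kc (\<Sum>i=1..m. \<beta>' i) + of_int d = kc (lam d)"
    unfolding lam_def sum_I \<kappa>_add kc_of_int by simp
  finally have "u * Du ?f = e * u powi d * (h * kc (lam d)) - v * (e * u powi (d - 1) * nabla h)"
    unfolding Dv_homog by (simp add: eq_diff_eq)
  also have "\<dots> = u * (e * u powi (d - 1) * (kc (lam d) * h - t * nabla h))"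
    unfolding v_eq power_int_pred[of d] by (simp add: algebra_simps)
  finally show ?thesis using u_nz by simp
qed

sublocale twisted_plane kc t \<delta> I a \<beta>' "\<beta>' m" e u Du Dv
proof
  show "e \<noteq> 0" "u \<noteq> 0" by (rule e_nz, rule u_nz)
  show "Du (f + g) = Du f + Du g" "Dv (f + g) = Dv f + Dv g" for f g
    by (simp_all add: Du_def Dv_def derivationD(1)[OF der_p(1)] derivationD(1)[OF der_p(2)] algebra_simps)
qed (use Dv_homog Du_homog in auto)

section \<open>The localization as a sum of homogeneous parts\<close>

definition At :: "nat set \<Rightarrow> poly_xy" where "At T = (\<Prod>i\<in>insert m T. \<alpha> i)"

lemma At_props:
  assumes "T \<subseteq> I"
  shows "At T \<noteq> 0" "i \<in> insert m T \<Longrightarrow> \<alpha> i dvd At T"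
proof -
  have fin: "finite T" using assms fin_I finite_subset by blast
  have "insert m T \<subseteq> {1..m}" using assms range1 by (auto simp: I_iff)
  then show "At T \<noteq> 0" unfolding At_def using fin \<alpha>_nz by (simp add: subset_iff)
  show "i \<in> insert m T \<Longrightarrow> \<alpha> i dvd At T" unfolding At_def using fin by (intro dvd_prodI) auto
qed

lemma inverse_emb: "g \<noteq> 0 \<Longrightarrow> inverse (emb g) = Fract 1 g"
  by (simp add: inverse_fract)

lemma localization_prod: "(b::'a::idom) \<noteq> 0 \<Longrightarrow> (\<And>i. i \<in> A \<Longrightarrow> f i \<in> localization b) \<Longrightarrow> (\<Prod>i\<in>A. f i) \<in> localization b"
  by (induction A rule: infinite_finite_induct) (auto simp: localization_closed One_fract_def)

lemma localization_power_int:
  assumes "(b::'a::idom) \<noteq> 0" "f \<in> localization b" "inverse f \<in> localization b"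
  shows "f powi d \<in> localization b"
proof -
  have "g ^ j \<in> localization b" if "g \<in> localization b" for g j
    by (induction j) (auto simp: localization_closed[OF assms(1)] One_fract_def that)
  then show ?thesis using assms by (auto simp: power_int_def)
qed

lemma Q_localization:
  assumes T: "T \<subseteq> I" and h: "h \<in> Q T"
  shows "h \<in> localization (At T)"
  using h
proof (induction rule: Q.induct)
  note cl = localization_closed[OF At_props(1)[OF T]]
  have inv: "inverse (emb (\<alpha> i)) \<in> localization (At T)" if "i \<in> insert m T" for i
  proof -
    have "\<alpha> i \<noteq> 0" using that T range1 by (intro \<alpha>_nz) (auto simp: I_iff)
    then show ?thesis using cl(6)[OF At_props(2)[OF T that]] by (simp add: inverse_emb)
  qed
  {
    case (Q_\<kappa> c) show ?case by (rule cl(2))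
  next
    case Q_t
    show ?case unfolding t_def divide_inverse using inv[of m] by (intro cl(4)) (auto simp: v_def u_def cl)
  next
    case (Q_po i)
    then have i: "i \<in> I" using T by blast
    have "po i = kc (C\<^sub>v i) * u * inverse (emb (\<alpha> i))"
      using \<alpha>_po[OF i] u_nz by (simp add: field_simps)
    then show ?case using inv[of i] Q_po by (simp add: cl u_def)
  next
    case (Q_add f g) then show ?case by (simp add: cl)
  next
    case (Q_mult f g) then show ?case by (simp add: cl)
  }
qed

lemma tot_Q_localization:
  assumes T: "T \<subseteq> I" and f: "f \<in> tot (\<lambda>d. Q T)"
  shows "\<exists>g\<in>localization (At T). f = e * g"
  using f
proof (induction rule: tot_induct)
  note cl = localization_closed[OF At_props(1)[OF T]]
  {
    case zero show ?case using cl(1) by auto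
  next
    case (add f g) then show ?case using cl(3) by (metis distrib_left)
  next
    case (homog d h)
    have "inverse u \<in> localization (At T)" unfolding u_def
      using cl(6)[OF At_props(2)[OF T insertI1]] \<alpha>_nz[OF range1(2)] by (simp add: inverse_emb)
    then have "u powi d \<in> localization (At T)"
      using cl(2) by (intro localization_power_int At_props(1)[OF T]) (auto simp: u_def)
    then have "u powi d * h \<in> localization (At T)" using Q_localization[OF T homog] by (rule cl(4))
    then show ?case by (intro bexI[of _ "u powi d * h"]) (simp_all add: homog_def mult.assoc)
  }
qed

lemma At_I: "At I = (\<Prod>i=1..m. \<alpha> i)"
proof -
  have "insert m I = {1..m}" using k1 km by (auto simp: I_def)
  then show ?thesis by (simp only: At_def)
qed

text \<open>The coefficients that remain after dividing by \<open>e\<close> form a ring, so that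
  \<open>tot_Q_I\<close> reduces to generators: polynomials and inverses of the forms.\<close>

definition Rg :: "ratfun_xy set" where "Rg = {f. e * f \<in> tot (\<lambda>d. Q I)}"

lemma Rg_homog: "h \<in> Q I \<Longrightarrow> u powi d * h \<in> Rg"
  using tot_homog[of h "\<lambda>d. Q I" d] by (simp add: Rg_def homog_def mult.assoc)

lemma tot_Q_add: "f \<in> tot (\<lambda>d. Q I) \<Longrightarrow> g \<in> tot (\<lambda>d. Q I) \<Longrightarrow> f + g \<in> tot (\<lambda>d. Q I)"
  by (rule tot_add) (rule csub_Q)

lemma Rg_add: "f \<in> Rg \<Longrightarrow> g \<in> Rg \<Longrightarrow> f + g \<in> Rg"
  using tot_Q_add[of "e * f" "e * g"] by (simp add: Rg_def distrib_left)

lemma Rg_mult: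
  assumes "f \<in> Rg" "g \<in> Rg"
  shows "f * g \<in> Rg"
proof -
  have 1: "u powi d * h * w \<in> tot (\<lambda>d. Q I)" if h: "h \<in> Q I" and w: "w \<in> tot (\<lambda>d. Q I)" for d h w
    using w
  proof (induction rule: tot_induct)
    case zero show ?case by (simp add: tot_0)
  next
    case (add f g) then show ?case by (simp add: distrib_left tot_Q_add)
  next
    case (homog d' h')
    have "u powi d * h * homog d' h' = homog (d + d') (h * h')"
      using u_nz by (simp add: homog_def power_int_add algebra_simps)
    then show ?case using tot_homog[of "h * h'" "\<lambda>d. Q I" "d + d'"] Q_mult[OF h homog] by simp
  qed
  have 2: "w * g \<in> tot (\<lambda>d. Q I)" if "w \<in> tot (\<lambda>d. Q I)" for w
    using that
  proof (induction rule: tot_induct)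
    case zero show ?case by (simp add: tot_0)
  next
    case (add f f') then show ?case by (simp add: distrib_right tot_Q_add)
  next
    case (homog d h)
    have "homog d h * g = u powi d * h * (e * g)" by (simp add: homog_def algebra_simps)
    also have "\<dots> \<in> tot (\<lambda>d. Q I)" using 1[OF homog] assms(2) unfolding Rg_def by blast
    finally show ?case .
  qed
  show ?thesis using 2[of "e * f"] assms(1) by (simp add: Rg_def mult.assoc)
qed

lemma Rg_Q: "h \<in> Q I \<Longrightarrow> h \<in> Rg" using Rg_homog[of h 0] by simp

lemma Rg_0: "0 \<in> Rg" and Rg_1: "1 \<in> Rg" by (intro Rg_Q Q_0 Q_1)+

lemma Rg_sum: "(\<And>i. i \<in> A \<Longrightarrow> f i \<in> Rg) \<Longrightarrow> (\<Sum>i\<in>A. f i) \<in> Rg"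
  by (induction A rule: infinite_finite_induct) (auto intro: Rg_0 Rg_add)

lemma Rg_prod: "(\<And>i. i \<in> A \<Longrightarrow> f i \<in> Rg) \<Longrightarrow> (\<Prod>i\<in>A. f i) \<in> Rg"
  by (induction A rule: infinite_finite_induct) (auto intro: Rg_1 Rg_mult)

lemma Rg_power: "f \<in> Rg \<Longrightarrow> f ^ j \<in> Rg"
  by (induction j) (auto intro: Rg_1 Rg_mult)

lemma Rg_u: "u \<in> Rg" "inverse u \<in> Rg"
  using Rg_homog[OF Q_1, of 1] Rg_homog[OF Q_1, of "-1"] by simp_all

lemma Rg_kc: "kc c \<in> Rg" by (intro Rg_Q Q_\<kappa>)

lemma xy_eq: "emb var_x = kc (cy 1 / \<Delta>) * u + kc (- cy m / \<Delta>) * v"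
  "emb var_y = kc (cx m / \<Delta>) * v + kc (- cx 1 / \<Delta>) * u"
  using xy_uv kc\<Delta>_nz unfolding kc_divide[OF \<Delta>_nz] kc_minus by (simp_all add: field_simps)

lemma Rg_emb: "emb g \<in> Rg"
proof -
  have v: "v \<in> Rg" unfolding v_eq by (intro Rg_mult Rg_u Rg_Q Q_t)
  have xy: "emb var_x \<in> Rg" "emb var_y \<in> Rg" unfolding xy_eq by (intro Rg_add Rg_mult Rg_kc v Rg_u)+
  have esum: "emb (\<Sum>i\<in>A. f i) = (\<Sum>i\<in>A. emb (f i))" for A and f :: "nat \<Rightarrow> poly_xy"
    by (induction A rule: infinite_finite_induct) (simp_all add: emb_add emb_0)
  show ?thesis
    by (subst poly_expand) (simp only: esum emb_mult emb_power, intro Rg_sum Rg_mult Rg_power Rg_kc xy)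
qed

lemma Rg_inverse_\<alpha>: "i \<in> {1..m} \<Longrightarrow> inverse (emb (\<alpha> i)) \<in> Rg"
proof (cases "i = m")
  case True then show ?thesis using Rg_u(2) by (simp add: u_def)
next
  case False
  assume "i \<in> {1..m}"
  then have i: "i \<in> I" "C\<^sub>v i \<noteq> 0" using False Cv_nz by (auto simp: I_iff)
  have "inverse (emb (\<alpha> i)) = kc (inverse (C\<^sub>v i)) * (po i * inverse u)"
  proof -
    have "inverse (emb (\<alpha> i)) = (kc (inverse (C\<^sub>v i)) * kc (C\<^sub>v i)) * inverse (emb (\<alpha> i))"
      by (simp only: \<kappa>_inverse_mult[OF i(2)] mult_1_left)
    also have "\<dots> = kc (inverse (C\<^sub>v i)) * (kc (C\<^sub>v i) / emb (\<alpha> i))"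
      by (simp only: divide_inverse mult.assoc)
    also have "\<dots> = kc (inverse (C\<^sub>v i)) * (po i * inverse u)"
      unfolding \<alpha>_po[OF i(1)] by (simp only: divide_inverse)
    finally show ?thesis .
  qed
  also have "\<dots> \<in> Rg" by (intro Rg_mult Rg_kc Rg_u Rg_Q[OF Q_po] i)
  finally show ?thesis .
qed

lemma tot_Q_I: "tot (\<lambda>d. Q I) = localization (\<Prod>i=1..m. \<alpha> i)"
proof
  have A: "At I \<noteq> 0" by (rule At_props) simp
  note cl = localization_closed[OF A]
  have "emb (\<alpha> i) powi j \<in> localization (At I)" if "i \<in> {1..m}" for i j
  proof (rule localization_power_int[OF A])
    show "emb (\<alpha> i) \<in> localization (At I)" by (rule cl)
    show "inverse (emb (\<alpha> i)) \<in> localization (At I)"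
      unfolding inverse_emb[OF \<alpha>_nz[OF that]]
      by (rule cl(6)[OF At_props(2)]) (use that in \<open>auto simp: I_iff\<close>)
  qed
  then have eloc: "e \<in> localization (At I)" unfolding e_def by (intro localization_prod[OF A])
  show "tot (\<lambda>d. Q I) \<subseteq> localization (\<Prod>i=1..m. \<alpha> i)"
    using tot_Q_localization[OF subset_refl] cl(4)[OF eloc] unfolding At_I[symmetric] by auto
  show "localization (\<Prod>i=1..m. \<alpha> i) \<subseteq> tot (\<lambda>d. Q I)"
  proof
    fix f assume "f \<in> localization (\<Prod>i=1..m. \<alpha> i)"
    then obtain g j where f: "f = Fract g ((\<Prod>i=1..m. \<alpha> i) ^ j)" by (auto simp: localization_def)
    have nzj: "(\<Prod>i=1..m. \<alpha> i) ^ j \<noteq> 0" using A by (simp add: At_I)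
    have "f = emb g * inverse ((\<Prod>i=1..m. emb (\<alpha> i)) ^ j)"
      unfolding f Fract_emb[OF nzj] by (simp only: emb_power emb_prod divide_inverse)
    also have "\<dots> = emb g * (\<Prod>i=1..m. inverse (emb (\<alpha> i))) ^ j"
      by (simp only: power_inverse prod_inversef[unfolded o_def])
    finally have fR: "f \<in> Rg" by (auto intro!: Rg_mult Rg_emb Rg_power Rg_prod Rg_inverse_\<alpha>)
    have "inverse e = (\<Prod>i=1..m. emb (\<alpha> i) powi n i)"
      unfolding e_def by (simp add: prod_inversef[unfolded o_def] power_int_minus)
    moreover have "emb (\<alpha> i) powi j \<in> Rg" if "i \<in> {1..m}" for i j
      using that by (auto simp: power_int_def intro!: Rg_power Rg_emb Rg_inverse_\<alpha> simp flip: power_inverse)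
    ultimately have "inverse e \<in> Rg" by (auto intro!: Rg_prod)
    then have "inverse e * f \<in> Rg" using fR by (rule Rg_mult)
    then show "f \<in> tot (\<lambda>d. Q I)" using e_nz by (simp add: Rg_def flip: mult.assoc)
  qed
qed

lemma xy_comb: "emb var_x * f = kc (cy 1 / \<Delta>) * (u * f) + kc (- cy m / \<Delta>) * (u * t * f)"
  "emb var_y * f = kc (cx m / \<Delta>) * (u * t * f) + kc (- cx 1 / \<Delta>) * (u * f)"
  unfolding xy_eq v_eq by (simp_all only: distrib_right mult.assoc)

text \<open>An invertible constant matrix relates the two coordinate systems and their derivations,
  so both notions of stability agree.\<close>

lemma ws_iff_sub: "ws N \<longleftrightarrow> sub N"
proof
  assume N: "ws N"
  have c: "csub N" using weyl_stableD(1-3)[OF N] by (auto simp: csub_def)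
  have "u * f \<in> N \<and> u * t * f \<in> N \<and> Du f \<in> N \<and> Dv f \<in> N" if f: "f \<in> N" for f
  proof (intro conjI)
    show "u * f \<in> N" unfolding u_def by (rule weyl_stable_poly[OF N f])
    show "u * t * f \<in> N" unfolding v_eq[symmetric] v_def by (rule weyl_stable_poly[OF N f])
    show "Du f \<in> N" "Dv f \<in> N" unfolding D_gen_act by (intro csubD(2,3)[OF c] weyl_stableD(4)[OF N f])+
  qed
  then show "sub N" unfolding sub_def stable_def tot_Q_I using c weyl_stableD(5)[OF N] by blast
next
  assume N: "sub N"
  note c = csubD[OF subD(1)[OF N]]
  have s: "u * f \<in> N" "u * t * f \<in> N" "Du f \<in> N" "Dv f \<in> N" if "f \<in> N" for f
    using N that by (auto simp: sub_def stable_def)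
  have "gen_act m \<alpha> \<beta> g f \<in> N" if f: "f \<in> N" for g f
  proof (cases g)
    case GX
    have "emb var_x * f \<in> N" unfolding xy_comb by (intro c(2,3) s f)
    then show ?thesis using GX by simp
  next
    case GY
    have "emb var_y * f \<in> N" unfolding xy_comb by (intro c(2,3) s f)
    then show ?thesis using GY by simp
  next
    case GDx show ?thesis unfolding GDx gen_act_D by (intro c(2,3) s f)
  next
    case GDy show ?thesis unfolding GDy gen_act_D by (intro c(2,3) s f)
  qed
  then show "ws N" unfolding weyl_stable_def using c(1-3) subD(2)[OF N] unfolding tot_Q_I by blast
qed

lemma family_covers_covers: "family_covers P P' \<Longrightarrow> P' \<le> (\<lambda>d. Q I) \<Longrightarrow> L.covers (tot P) (tot P')"
  using tot_family_covers[of P P'] unfolding L.covers_def ws_iff_sub by blast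

end

section \<open>Supports and the composition series\<close>

lemma eval_xy_simps: "eval_xy (f + g) p = eval_xy f p + eval_xy g p" "eval_xy (f * g) p = eval_xy f p * eval_xy g p"
  "eval_xy 0 p = 0" "eval_xy 1 p = 1" "eval_xy (const_xy c) p = c" "eval_xy var_x p = fst p" "eval_xy var_y p = snd p"
  by (simp_all add: eval_xy_def const_xy_def var_x_def var_y_def)

lemma eval_xy_power: "eval_xy (f ^ n) p = eval_xy f p ^ n"
  by (induction n) (simp_all add: eval_xy_simps)

lemma eval_xy_prod: "eval_xy (\<Prod>i\<in>A. f i) p = (\<Prod>i\<in>A. eval_xy (f i) p)"
  by (induction A rule: infinite_finite_induct) (simp_all add: eval_xy_simps)

lemma eval_xy_line: "\<exists>r. \<forall>z. eval_xy f (z * a, z * b) = poly r z"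
proof (induction f)
  case 0 show ?case by (rule exI[of _ 0]) (simp add: eval_xy_simps)
next
  case (pCons c f)
  then obtain r where "\<forall>z. eval_xy f (z * a, z * b) = poly r z" by blast
  then have "\<forall>z. eval_xy (pCons c f) (z * a, z * b) = poly (pcompose c [:0, a:] + [:0, b:] * r) z"
    by (simp add: eval_xy_def poly_pcompose mult.assoc)
  then show ?case by blast
qed

lemma eval_xy_line_nonzero:
  assumes "eval_xy f (0, 0) \<noteq> 0"
  shows "\<exists>z. z \<noteq> 0 \<and> eval_xy f (z * a, z * b) \<noteq> 0"
proof -
  obtain r where r: "\<forall>z. eval_xy f (z * a, z * b) = poly r z" using eval_xy_line by blast
  then have "poly r 0 \<noteq> 0" using assms by (metis mult_zero_left)
  then have "r \<noteq> 0" by auto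
  then have "finite (insert 0 {z. poly r z = 0})" using poly_roots_finite by simp
  then obtain z where "z \<notin> insert 0 {z. poly r z = 0}"
    using infinite_UNIV_char_0 ex_new_if_finite by blast
  then show ?thesis using r by auto
qed

lemma poly_xy_split_origin: "\<exists>g h. f = const_xy (eval_xy f (0, 0)) + var_x * g + var_y * h"
proof -
  obtain c f' where f: "f = pCons c f'" by (cases f)
  obtain c0 c' where c: "c = pCons c0 c'" by (cases c)
  have "f = const_xy (eval_xy f (0, 0)) + var_x * [:c':] + var_y * f'"
    by (simp add: f c eval_xy_def const_xy_def var_x_def var_y_def)
  then show ?thesis by blast
qed

context arrangement begin

lemma eval_\<alpha>: "i \<in> {1..m} \<Longrightarrow> eval_xy (\<alpha> i) (x, y) = cx i * x + cy i * y"
  by (subst \<alpha>_eq) (simp_all add: eval_xy_simps)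

lemma two_forms_vanish:
  assumes "i \<in> {1..m}" "j \<in> {1..m}" "i \<noteq> j" "eval_xy (\<alpha> i) p = 0" "eval_xy (\<alpha> j) p = 0"
  shows "p = (0, 0)"
proof -
  obtain x y where p: "p = (x, y)" by (cases p)
  have e: "cx i * x + cy i * y = 0" "cx j * x + cy j * y = 0"
    using assms eval_\<alpha> unfolding p by auto
  have "det i j * x = (cx i * x + cy i * y) * cy j - (cx j * x + cy j * y) * cy i"
    "det i j * y = (cx j * x + cy j * y) * cx i - (cx i * x + cy i * y) * cx j"
    by (simp_all add: det_def algebra_simps)
  then show ?thesis using det_nz[OF assms(1-3)] unfolding e p by simp
qed

lemma den_iff: "s \<in> denominators p \<longleftrightarrow> eval_xy s p \<noteq> 0"
  by (simp add: denominators_def)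

section \<open>Supports of the successive quotients\<close>

lemma torsion_tot:
  assumes N: "ws N" and P: "\<And>d h. h \<in> P d \<Longrightarrow> \<exists>J. emb f ^ J * homog d h \<in> N" and b: "b \<in> tot P"
  shows "\<exists>J. emb f ^ J * b \<in> N"
  using b
proof (induction rule: tot_induct)
  case zero show ?case using weyl_stableD(1)[OF N] by auto
next
  case (add x y)
  then obtain i j where ij: "emb f ^ i * x \<in> N" "emb f ^ j * y \<in> N" by blast
  have "emb (f ^ j) * (emb f ^ i * x) + emb (f ^ i) * (emb f ^ j * y) \<in> N"
    by (intro weyl_stableD(2)[OF N] weyl_stable_poly[OF N] ij)
  also have "emb (f ^ j) * (emb f ^ i * x) + emb (f ^ i) * (emb f ^ j * y) = emb f ^ (i + j) * (x + y)"
    by (simp add: emb_power power_add algebra_simps)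
  finally show ?case by blast
next
  case (homog d h) then show ?case by (rule P)
qed

lemma torsion_not_supp:
  assumes "\<And>b. b \<in> B \<Longrightarrow> \<exists>J. emb f ^ J * b \<in> A" "eval_xy f p \<noteq> 0"
  shows "p \<notin> supp A B"
proof
  assume "p \<in> supp A B"
  then obtain b where b: "b \<in> B" "\<forall>s\<in>denominators p. emb s * b \<notin> A" by (auto simp: supp_def)
  obtain J where "emb (f ^ J) * b \<in> A" using assms(1)[OF b(1)] by (auto simp: emb_power)
  moreover have "f ^ J \<in> denominators p" using assms(2) by (simp add: den_iff eval_xy_power)
  ultimately show False using b by blast
qed

lemma u_power_homog: "u ^ J * homog d h = homog (d + int J) h"
  by (induction J) (simp_all add: homog_simps mult.assoc algebra_simps)

lemma v_power_homog: "v ^ J * homog d h = homog (d + int J) (t ^ J * h)"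
proof (induction J)
  case (Suc J)
  have "v ^ Suc J * homog d h = v * (v ^ J * homog d h)" by simp
  also have "\<dots> = homog (d + int J + 1) (t * (t ^ J * h))" unfolding Suc by (simp only: v_eq homog_simps)
  finally show ?case by (simp add: algebra_simps)
qed simp

lemma supp_generic: "h \<in> P d \<Longrightarrow> h \<noteq> 0 \<Longrightarrow> supp {0} (tot P) = UNIV"
proof -
  assume h: "h \<in> P d" "h \<noteq> 0"
  have "homog d h \<noteq> 0" using h e_nz u_nz by (simp add: homog_def)
  moreover have "emb s \<noteq> 0" if "s \<in> denominators p" for s p
    using that by (auto simp: den_iff emb_eq_0_iff eval_xy_simps)
  ultimately show ?thesis unfolding supp_def using tot_homog[of h P d, OF h(1)]
    by (auto intro!: bexI[of _ "homog d h"])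
qed

lemma fam_le_Q: "T \<subseteq> I \<Longrightarrow> fam T W \<le> (\<lambda>d. Q I)"
  unfolding le_fun_def using subset_trans[OF fam_subset_Q Q_mono[of T I]] by blast

lemma ws_fam:
  assumes "T \<subseteq> I" "graded (fam T W)"
  shows "ws (tot (fam T W))"
  unfolding ws_iff_sub using assms by (intro sub_tot fam_le_Q)

text \<open>Clearing denominators makes \<open>f\<close> times forms other than
  \<open>\<alpha> s\<close> divisible by \<open>\<alpha> s\<close>. At a point of the line other
  than the origin only \<open>\<alpha> s\<close> vanishes, so \<open>f\<close> would have to vanish
  there.\<close>

lemma po_not_localized:
  assumes T: "T \<subseteq> I" and s: "s \<in> I" "s \<notin> T" and p: "eval_xy (\<alpha> s) p = 0" "eval_xy f p \<noteq> 0"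
  shows "emb f * homog 0 (po s) \<notin> tot (\<lambda>d. Q T)"
proof
  assume "emb f * homog 0 (po s) \<in> tot (\<lambda>d. Q T)"
  then obtain g where g: "g \<in> localization (At T)" "emb f * homog 0 (po s) = e * g" using tot_Q_localization[OF T] by blast
  have g': "emb f * po s = g"
  proof -
    have "e * (emb f * po s) = e * g" using g(2) by (simp add: homog_def algebra_simps)
    then show ?thesis using e_nz by simp
  qed
  obtain b j where b: "g = Fract b (At T ^ j)" using g(1) by (auto simp: localization_def)
  have sm: "s \<in> {1..m}" "s \<noteq> m" using s by (auto simp: I_iff)
  have A: "At T ^ j \<noteq> 0" using At_props(1)[OF T] by simp
  have "po s = kc (C\<^sub>v s) * u / emb (\<alpha> s)"
    using \<alpha>_po[OF s(1)] u_nz by (simp add: field_simps)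
  then have "emb f * (kc (C\<^sub>v s) * u / emb (\<alpha> s)) = emb b / emb (At T ^ j)"
    using g' unfolding b Fract_emb[OF A] by simp
  then have "emb f * kc (C\<^sub>v s) * u * emb (At T ^ j) = emb b * emb (\<alpha> s)"
    using emb_\<alpha>_nz[OF sm(1)] A emb_eq_0_iff[of "At T ^ j"] by (simp add: field_simps)
  then have eq: "f * const_xy (C\<^sub>v s) * \<alpha> m * At T ^ j = b * \<alpha> s"
    unfolding u_def by (simp only: emb_mult[symmetric] emb_eq_iff)
  have main: False if q: "eval_xy (\<alpha> s) q = 0" "eval_xy f q \<noteq> 0" "q \<noteq> (0, 0)" for q
  proof -
    have "eval_xy (f * const_xy (C\<^sub>v s) * \<alpha> m * At T ^ j) q = 0" unfolding eq by (simp add: eval_xy_simps q)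
    then have "eval_xy f q * C\<^sub>v s * eval_xy (\<alpha> m) q * eval_xy (At T) q ^ j = 0"
      by (simp add: eval_xy_simps eval_xy_power)
    moreover have "C\<^sub>v s \<noteq> 0" using Cv_nz sm by blast
    moreover have nz: "eval_xy (\<alpha> i) q \<noteq> 0" if "i \<in> insert m T" for i
    proof
      assume "eval_xy (\<alpha> i) q = 0"
      moreover have "i \<in> {1..m}" "i \<noteq> s" using that T s sm by (auto simp: I_iff)
      ultimately show False using two_forms_vanish[OF _ sm(1) _ _ q(1)] q(3) by blast
    qed
    moreover have "eval_xy (At T) q \<noteq> 0"
      unfolding At_def eval_xy_prod using nz T fin_I finite_subset by (subst prod_zero_iff) auto
    ultimately show False using q(2) by simp
  qed
  show False
  proof (cases "p = (0, 0)")
    case False then show False using main p by blast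
  next
    case True
    \<comment> \<open>At the origin all forms vanish, so the argument moves along the line of
      \<open>\<alpha> s\<close> to a nearby point; \<open>f\<close> is not 0 at the origin and hence
      not identically 0 on this line.\<close>
    obtain z where z: "z \<noteq> 0" "eval_xy f (z * (- cy s), z * cx s) \<noteq> 0"
      using eval_xy_line_nonzero p(2) True by blast
    have "cx s \<noteq> 0 \<or> cy s \<noteq> 0" using \<alpha>_nz[OF sm(1)] \<alpha>_poly[OF sm(1)] by auto
    then have "(z * (- cy s), z * cx s) \<noteq> (0, 0)" using z(1) by auto
    moreover have "eval_xy (\<alpha> s) (z * (- cy s), z * cx s) = 0"
      unfolding eval_\<alpha>[OF sm(1)] by (simp add: algebra_simps)
    ultimately show False using main z(2) by blast
  qed
qed

lemma supp_line:
  assumes T: "\<gamma>supp \<subseteq> T" and s: "s \<in> I" "T \<subseteq> I" "s \<notin> T"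
  shows "supp (tot (fam T (Wmin T))) (tot (fam (insert s T) (Wmin (insert s T)))) = zero_set (\<alpha> s)"
    (is "supp ?A ?B = _")
proof (rule Set.set_eqI)
  fix p
  have sm: "s \<in> {1..m}" using s by (auto simp: I_iff)
  have A: "ws ?A" by (rule ws_fam[OF s(2)]) (use graded_fam_Wmin[of T] T in blast)
  show "p \<in> supp ?A ?B \<longleftrightarrow> p \<in> zero_set (\<alpha> s)"
  proof
    assume "p \<in> zero_set (\<alpha> s)"
    then have p: "eval_xy (\<alpha> s) p = 0" by (simp add: zero_set_def)
    have "po s \<in> fam (insert s T) (Wmin (insert s T)) 0" by (simp add: fam_def Q_po)
    then have "homog 0 (po s) \<in> ?B" by (rule tot_homog)
    moreover have "emb f * homog 0 (po s) \<notin> ?A" if "f \<in> denominators p" for f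
    proof -
      have "fam T (Wmin T) \<le> (\<lambda>d. Q T)" using fam_subset_Q by (auto simp: le_fun_def)
      then show ?thesis using po_not_localized[OF s(2,1,3) p] that tot_mono unfolding den_iff by blast
    qed
    ultimately show "p \<in> supp ?A ?B" unfolding supp_def by blast
  next
    assume "p \<in> supp ?A ?B"
    moreover have "p \<notin> supp ?A ?B" if "eval_xy (\<alpha> s) p \<noteq> 0"
    proof (rule torsion_not_supp[OF _ that])
      fix b assume "b \<in> ?B"
      then show "\<exists>J. emb (\<alpha> s) ^ J * b \<in> ?A"
      proof (rule torsion_tot[OF A, rotated])
        fix d h assume "h \<in> fam (insert s T) (Wmin (insert s T)) d"
        then have "h \<in> Q (insert s T)" using fam_subset_Q by blast
        then obtain J where J: "pt s ^ J * h \<in> Q T" using Q_clear by blast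
        \<comment> \<open>\<open>J\<close> factors clear the pole at \<open>a s\<close>, and
          \<open>nat (- d)\<close> more raise the degree to at least 0, where the smaller family is
          all of \<open>Q T\<close>.\<close>
        define K where "K = J + nat (- d)"
        have "pt s ^ nat (- d) * (pt s ^ J * h) \<in> Q T" by (rule Q_mult[OF Q_power[OF Q_pt] J])
        then have "pt s ^ K * h \<in> Q T" by (simp add: K_def power_add mult_ac)
        then have "kc (C\<^sub>v s ^ K) * (pt s ^ K * h) \<in> fam T (Wmin T) (d + int K)"
          by (auto simp: fam_def K_def intro: Q_mult Q_\<kappa>)
        moreover have "emb (\<alpha> s) ^ K * homog d h = homog (d + int K) (kc (C\<^sub>v s ^ K) * (pt s ^ K * h))"
        proof -
          have "emb (\<alpha> s) ^ K = u ^ K * (kc (C\<^sub>v s ^ K) * pt s ^ K)"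
            unfolding emb_\<alpha>_t[OF s(1)] pt_def[symmetric] \<kappa>_power by (simp add: power_mult_distrib mult_ac)
          then have "emb (\<alpha> s) ^ K * homog d h = (kc (C\<^sub>v s ^ K) * pt s ^ K) * (u ^ K * homog d h)" by (simp only: mult_ac)
          then show ?thesis unfolding u_power_homog by (simp add: homog_def mult_ac)
        qed
        ultimately show "\<exists>J. emb (\<alpha> s) ^ J * homog d h \<in> ?A" using tot_homog by metis
      qed
    qed
    ultimately show "p \<in> zero_set (\<alpha> s)" by (auto simp: zero_set_def)
  qed
qed

text \<open>Both families are all of \<open>Q I\<close> from degree -1 on. Hence \<open>x\<close>
  and \<open>y\<close> kill the class of \<open>w\<close> in degree -2, whereas a polynomial not
  vanishing at the origin acts on it by a nonzero constant. Conversely every class is killed by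
  powers of \<open>\<alpha> m\<close> and of \<open>\<alpha> 1\<close>, whose lines meet only at the
  origin.\<close>

lemma supp_origin:
  assumes g: "graded (fam I W)" and W: "W \<subseteq> Q I" and W': "W' \<subseteq> Q I" and w: "w \<in> W'" "w \<notin> W"
  shows "supp (tot (fam I W)) (tot (fam I W')) = {(0, 0)}" (is "supp ?A ?B = _")
proof (rule Set.set_eqI)
  fix p
  have A: "ws ?A" by (rule ws_fam[OF subset_refl g])
  have gA: "gpart ?A = fam I W" using fam_subset_Q by (intro gpart_tot g) (auto simp: le_fun_def)
  show "p \<in> supp ?A ?B \<longleftrightarrow> p \<in> {(0, 0)}"
  proof
    assume "p \<in> {(0, 0)}"
    then have p: "p = (0, 0)" by simp
    have wQ: "w \<in> Q I" using w W' by blast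
    have "w \<in> fam I W' (-2)" using fam_minus_2[OF W'] w by simp
    then have B: "homog (-2) w \<in> ?B" by (rule tot_homog)
    have u1: "u * homog (-2) w \<in> ?A" "u * t * homog (-2) w \<in> ?A"
      unfolding homog_simps by (rule tot_homog; simp add: fam_def wQ Q_mult Q_t)+
    have xy: "emb var_x * homog (-2) w \<in> ?A" "emb var_y * homog (-2) w \<in> ?A"
      unfolding xy_comb by (intro weyl_stableD(2,3)[OF A] u1)+
    have "emb f * homog (-2) w \<notin> ?A" if f: "f \<in> denominators p" for f
    proof
      assume "emb f * homog (-2) w \<in> ?A"
      moreover obtain f1 f2 where f12: "f = const_xy (eval_xy f (0, 0)) + var_x * f1 + var_y * f2"
        using poly_xy_split_origin by blast
      have "emb f = kc (eval_xy f (0, 0)) + emb f1 * emb var_x + emb f2 * emb var_y"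
        by (subst f12) (simp only: emb_add emb_mult mult.commute)
      then have "kc (eval_xy f (0, 0)) * homog (-2) w = emb f * homog (-2) w - (emb f1 * (emb var_x * homog (-2) w) + emb f2 * (emb var_y * homog (-2) w))"
        by (simp add: algebra_simps)
      moreover have "emb f1 * (emb var_x * homog (-2) w) + emb f2 * (emb var_y * homog (-2) w) \<in> ?A"
        by (intro weyl_stableD(2)[OF A] weyl_stable_poly[OF A] xy)
      ultimately have "kc (eval_xy f (0, 0)) * homog (-2) w \<in> ?A" using weyl_stableD(7)[OF A] by metis
      moreover have "eval_xy f (0, 0) \<noteq> 0" using f p by (simp add: den_iff)
      moreover have "csub ?A" using A unfolding ws_iff_sub by (rule subD)
      ultimately have "homog (-2) w \<in> ?A" using csub_cancel by blast
      then have "w \<in> gpart ?A (-2)" using wQ by (simp add: gpart_def)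
      then show False unfolding gA fam_minus_2[OF W] using w by blast
    qed
    then show "p \<in> supp ?A ?B" unfolding supp_def using B by blast
  next
    assume supp: "p \<in> supp ?A ?B"
    have "eval_xy (\<alpha> m) p = 0"
    proof (rule ccontr)
      assume nz: "eval_xy (\<alpha> m) p \<noteq> 0"
      have "p \<notin> supp ?A ?B"
      proof (rule torsion_not_supp[OF torsion_tot[OF A] nz])
        fix d h assume "h \<in> fam I W' d"
        then have "h \<in> Q I" using fam_subset_Q by blast
        then have "h \<in> fam I W (d + int (nat (- d)))" by (simp add: fam_def)
        then show "\<exists>J. emb (\<alpha> m) ^ J * homog d h \<in> ?A"
          unfolding u_def[symmetric] using u_power_homog tot_homog by metis
      qed
      then show False using supp by blast
    qed
    moreover have "eval_xy (\<alpha> 1) p = 0"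
    proof (rule ccontr)
      assume nz: "eval_xy (\<alpha> 1) p \<noteq> 0"
      have "p \<notin> supp ?A ?B"
      proof (rule torsion_not_supp[OF torsion_tot[OF A] nz])
        fix d h assume "h \<in> fam I W' d"
        then have "h \<in> Q I" using fam_subset_Q by blast
        then have "t ^ nat (- d) * h \<in> fam I W (d + int (nat (- d)))" by (simp add: fam_def Q_mult Q_power Q_t)
        then show "\<exists>J. emb (\<alpha> 1) ^ J * homog d h \<in> ?A"
          unfolding v_def[symmetric] using v_power_homog tot_homog by metis
      qed
      then show False using supp by blast
    qed
    ultimately show "p \<in> {(0, 0)}" using two_forms_vanish[OF range1(2,1,3)] by blast
  qed
qed

section \<open>The explicit composition series\<close>

definition Tn :: "nat \<Rightarrow> nat set" where "Tn j = {k+1..m-1} \<union> {1..j}"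

lemma \<gamma>supp_eq: "\<gamma>supp = Tn 0"
proof (rule Set.set_eqI)
  fix i
  show "i \<in> \<gamma>supp \<longleftrightarrow> i \<in> Tn 0"
  proof (cases "i \<in> {1..k}")
    case True
    then show ?thesis using \<beta>'_zero[OF True] by (simp add: \<gamma>supp_def Tn_def)
  next
    case False
    then have "i \<in> I \<Longrightarrow> \<beta>' i \<noteq> 0" using \<beta>'_nonint[of i] by (auto simp: I_iff)
    then have "i \<in> \<gamma>supp \<longleftrightarrow> i \<in> I" by (auto simp: \<gamma>supp_def)
    then show ?thesis using False by (auto simp: Tn_def I_def)
  qed
qed

lemma Tn_props: "\<gamma>supp \<subseteq> Tn j" "j \<le> k \<Longrightarrow> Tn j \<subseteq> I" "Tn k = I" "Tn (Suc j) = insert (Suc j) (Tn j)"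
  "j < k \<Longrightarrow> Suc j \<notin> Tn j" "j < k \<Longrightarrow> Suc j \<in> I"
  unfolding \<gamma>supp_eq using km by (auto simp: Tn_def I_def)

text \<open>One definition serves both cases. Without resonance the chain is complete at index
  \<open>k + 1\<close>, where \<open>Wmin I = Q I\<close>; at resonance this term is the one with
  \<open>Wpoles {}\<close>, and one simple pole is then added at a time.\<close>

definition chain0 :: "nat \<Rightarrow> ratfun_xy set" where
  "chain0 i = (if i = 0 then {0} else if i \<le> k + 1 then tot (fam (Tn (i - 1)) (Wmin (Tn (i - 1))))
     else tot (fam I (Wpoles {1..i - (k + 1)})))"

lemma tot_zero: "tot (\<lambda>d. {0}) = {0}"
proof -
  have "f = 0" if "f \<in> tot (\<lambda>d. {0})" for f using that
    by (induction rule: tot_induct) (auto simp: homog_simps)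
  then show ?thesis using tot_0 by blast
qed

lemma chain0_generic:
  "L.covers (chain0 0) (chain0 1)" "supp (chain0 0) (chain0 1) = UNIV"
proof -
  have c: "chain0 0 = {0}" "chain0 1 = tot (fam \<gamma>supp (Wmin \<gamma>supp))" by (simp_all add: chain0_def \<gamma>supp_eq)
  have "L.covers (tot (\<lambda>d. {0})) (tot (fam \<gamma>supp (Wmin \<gamma>supp)))"
    by (intro family_covers_covers family_covers_generic fam_le_Q \<gamma>supp_I)
  then show "L.covers (chain0 0) (chain0 1)" unfolding c tot_zero .
  show "supp (chain0 0) (chain0 1) = UNIV"
    unfolding c by (rule supp_generic[of 1 _ 0]) (simp_all add: fam_def Q_1)
qed

lemma chain0_line:
  assumes "i \<in> {1..k}"
  shows "L.covers (chain0 i) (chain0 (Suc i))" "supp (chain0 i) (chain0 (Suc i)) = zero_set (\<alpha> i)"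
proof -
  obtain j where j: "i = Suc j" "j < k" using assms by (cases i) auto
  have c: "chain0 i = tot (fam (Tn j) (Wmin (Tn j)))"
    "chain0 (Suc i) = tot (fam (insert i (Tn j)) (Wmin (insert i (Tn j))))"
    using j by (simp_all add: chain0_def Tn_props(4)[symmetric])
  have T: "\<gamma>supp \<subseteq> Tn j" "i \<in> I" "Tn j \<subseteq> I" "i \<notin> Tn j" using Tn_props j by auto
  show "L.covers (chain0 i) (chain0 (Suc i))"
    unfolding c using T by (intro family_covers_covers family_covers_line fam_le_Q) auto
  show "supp (chain0 i) (chain0 (Suc i)) = zero_set (\<alpha> i)"
    unfolding c by (rule supp_line[OF T])
qed

lemma lam0: "lam 0 = 0 \<longleftrightarrow> (\<Sum>i=1..m. \<beta> i) \<in> \<int>"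
proof -
  have l: "lam 0 = (\<Sum>i=1..m. \<beta>' i)" unfolding lam_def sum_I by simp
  have "(\<Sum>i=1..k. \<beta> i) \<in> \<int>" by (intro Ints_sum \<beta>_int)
  then show ?thesis unfolding l sum_\<beta>' by auto
qed

lemma chain0_Wpoles: "lam 0 = 0 \<Longrightarrow> i \<ge> k + 1 \<Longrightarrow> chain0 i = tot (fam I (Wpoles {1..i - (k + 1)}))"
  by (cases "i = k + 1") (simp_all add: chain0_def Tn_props(3) Wmin_def Wpoles_empty)

lemma two_nonint: "(\<Sum>i=1..m. \<beta> i) \<in> \<int> \<Longrightarrow> m - k \<ge> 2"
proof (rule ccontr)
  assume s: "(\<Sum>i=1..m. \<beta> i) \<in> \<int>" and "\<not> m - k \<ge> 2"
  then have mk: "m = k + 1" using km by auto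
  have "(\<Sum>i=1..k. \<beta> i) \<in> \<int>" by (intro Ints_sum \<beta>_int)
  moreover have "(\<Sum>i=1..m. \<beta> i) = (\<Sum>i=1..k. \<beta> i) + \<beta> m" by (simp add: mk)
  ultimately have "\<beta> m \<in> \<int>" using s by (metis Ints_diff add_diff_cancel_left')
  then show False using \<beta>_nonint[of m] km by simp
qed

lemma chain0_origin:
  assumes S: "(\<Sum>i=1..m. \<beta> i) \<in> \<int>" and i: "k + 1 \<le> i" "i < m + k - 1"
  shows "L.covers (chain0 i) (chain0 (Suc i))" "supp (chain0 i) (chain0 (Suc i)) = {(0, 0)}"
proof -
  have l0: "lam 0 = 0" using S lam0 by simp
  have mk: "m - k \<ge> 2" by (rule two_nonint[OF S])
  define j where "j = i - (k + 1)"
  have jm: "Suc j \<le> m - 2" using i mk by (simp add: j_def)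
  have c: "chain0 i = tot (fam I (Wpoles {1..j}))" "chain0 (Suc i) = tot (fam I (Wpoles {1..Suc j}))"
  proof -
    have "Suc i - (k + 1) = Suc j" using i by (simp add: j_def)
    then show "chain0 i = tot (fam I (Wpoles {1..j}))" "chain0 (Suc i) = tot (fam I (Wpoles {1..Suc j}))"
      using chain0_Wpoles[OF l0 i(1)] chain0_Wpoles[OF l0, of "Suc i"] i(1) unfolding j_def[symmetric] by simp_all
  qed
  \<comment> \<open>The pole left out of the basis must have nonzero exponent. Since
    \<open>m - k \<ge> 2\<close>, the index \<open>m - 1\<close> is that of a finite line with
    nonintegral exponent.\<close>
  have r: "m - 1 \<in> \<gamma>supp" unfolding \<gamma>supp_eq using mk by (auto simp: Tn_def)
  have J: "{1..Suc j} \<subseteq> I - {m - 1}" using jm by (auto simp: I_def)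
  moreover have "{1..j} \<subseteq> {1..Suc j}" "Suc j \<in> {1..Suc j}" by auto
  ultimately have JI: "{1..j} \<subseteq> I - {m - 1}" "{1..j} \<subseteq> I" "{1..Suc j} \<subseteq> I" "Suc j \<in> I - {m - 1}" by blast+
  have notin: "po (Suc j) \<notin> Wpoles {1..j}" by (rule po_notin_Wpoles[OF l0 r JI(1,4)]) simp
  have ins: "{1..Suc j} = insert (Suc j) {1..j}" by auto
  have W': "Wpoles {1..Suc j} = {x + kc c * po (Suc j) | x c. x \<in> Wpoles {1..j}}"
    unfolding ins by (rule Wpoles_insert) auto
  have f: "family_covers (fam I (Wpoles {1..j})) (fam I (Wpoles {1..Suc j}))"
    by (rule family_covers_origin[OF \<gamma>supp_I csub_Wpoles Wpoles_nabla Wpoles_subset_Q[OF JI(2)] l0 _ notin W'])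
      (use JI(4) in \<open>auto intro: Q_po\<close>)
  show "L.covers (chain0 i) (chain0 (Suc i))"
    unfolding c by (intro family_covers_covers f fam_le_Q) simp
  have "po (Suc j) \<in> Wpoles {1..Suc j}" by (rule Wpoles_po) auto
  then show "supp (chain0 i) (chain0 (Suc i)) = {(0, 0)}"
    unfolding c using f notin by (intro supp_origin Wpoles_subset_Q JI) (auto simp: family_covers_def)
qed

lemma chain0_chain:
  assumes "\<And>i. i < r \<Longrightarrow> L.covers (chain0 i) (chain0 (Suc i))" "chain0 r = tot (\<lambda>d. Q I)"
  shows "L.chain chain0 r (carrier MM)"
  unfolding L.chain_def
proof (intro conjI allI impI)
  show "chain0 0 = {0}" by (simp add: chain0_def)
  show "chain0 r = carrier MM" using assms(2) by (simp add: tot_Q_I M_mod_simps)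
  show "L.covers (chain0 i) (chain0 (Suc i))" if "i < r" for i using assms(1) that .
  show "ws (chain0 i)" if "i \<le> r" for i
  proof (cases "i < r")
    case True then show ?thesis using assms(1) by (simp add: L.covers_def)
  next
    case False
    then have "i = r" using that by simp
    then show ?thesis unfolding assms(2) \<open>i = r\<close> ws_iff_sub
      by (intro sub_tot graded_Q \<gamma>supp_I) simp
  qed
qed

lemma fam_Q: "fam T (Q T) = (\<lambda>d. Q T)"
  by (rule ext) (auto simp: fam_def Q_mult Q_power Q_t)

lemma chain_nonint:
  assumes "(\<Sum>i=1..m. \<beta> i) \<notin> \<int>"
  shows "L.chain chain0 (k + 1) (carrier MM)"
proof (rule chain0_chain)
  show "L.covers (chain0 i) (chain0 (Suc i))" if "i < k + 1" for i
    using that chain0_generic(1) chain0_line(1)[of i] by (cases "i = 0") auto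
  show "chain0 (k + 1) = tot (\<lambda>d. Q I)"
    using assms lam0 by (simp add: chain0_def Tn_props(3) Wmin_def fam_Q)
qed

lemma chain_int:
  assumes S: "(\<Sum>i=1..m. \<beta> i) \<in> \<int>"
  shows "L.chain chain0 (m + k - 1) (carrier MM)"
proof (rule chain0_chain)
  show "L.covers (chain0 i) (chain0 (Suc i))" if "i < m + k - 1" for i
  proof -
    consider "i = 0" | "i \<in> {1..k}" | "k + 1 \<le> i" by fastforce
    then show ?thesis
      using chain0_generic(1) chain0_line(1)[of i] chain0_origin(1)[OF S, of i] that by cases auto
  qed
  have l0: "lam 0 = 0" using S lam0 by simp
  have mk: "m - k \<ge> 2" by (rule two_nonint[OF S])
  have r: "m - 1 \<in> \<gamma>supp" unfolding \<gamma>supp_eq using mk by (auto simp: Tn_def)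
  have "{1..m + k - 1 - (k + 1)} = I - {m - 1}" using mk by (auto simp: I_def)
  then show "chain0 (m + k - 1) = tot (\<lambda>d. Q I)"
    using chain0_Wpoles[OF l0, of "m + k - 1"] mk k1 Wpoles_top[OF l0 r] by (simp add: fam_Q)
qed

text \<open>Counting factors by support requires that the plane, the lines and the origin be
  pairwise different sets.\<close>

lemma zero_set_props:
  assumes "i \<in> {1..m}"
  shows "zero_set (\<alpha> i) \<noteq> UNIV" "zero_set (\<alpha> i) \<noteq> {(0, 0)}" "j \<in> {1..m} \<Longrightarrow> zero_set (\<alpha> i) = zero_set (\<alpha> j) \<Longrightarrow> i = j"
proof -
  have p: "(- cy i, cx i) \<in> zero_set (\<alpha> i)"
    by (simp add: zero_set_def eval_\<alpha>[OF assms])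
  have "(- cy i, cx i) \<noteq> (0, 0)"
    using \<alpha>_nz[OF assms] \<alpha>_poly[OF assms] by auto
  note p = p this
  show "zero_set (\<alpha> i) \<noteq> {(0, 0)}" using p by blast
  show "i = j" if j: "j \<in> {1..m}" "zero_set (\<alpha> i) = zero_set (\<alpha> j)" for j
  proof (rule ccontr)
    assume "i \<noteq> j"
    moreover have "eval_xy (\<alpha> i) (- cy i, cx i) = 0" "eval_xy (\<alpha> j) (- cy i, cx i) = 0"
      using p(1) p(1)[unfolded j(2)] unfolding zero_set_def by simp_all
    ultimately show False using two_forms_vanish[OF assms j(1)] p(2) by blast
  qed
  show "zero_set (\<alpha> i) \<noteq> UNIV"
  proof
    assume "zero_set (\<alpha> i) = UNIV"
    then have "(1, 0) \<in> zero_set (\<alpha> i)" "(0, 1) \<in> zero_set (\<alpha> i)" by simp_all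
    then have "cx i = 0" "cy i = 0" by (simp_all add: zero_set_def eval_\<alpha>[OF assms])
    then show False using p(2) by simp
  qed
qed

lemma UNIV_neq_origin: "UNIV \<noteq> {(0 :: complex, 0 :: complex)}"
  by (metis UNIV_I prod.inject singletonD zero_neq_one)

lemma supp_chain0:
  assumes "i < r" "r = k + 1 \<or> (\<Sum>i=1..m. \<beta> i) \<in> \<int> \<and> r = m + k - 1"
  shows "supp (chain0 i) (chain0 (Suc i)) =
    (if i = 0 then UNIV else if i \<le> k then zero_set (\<alpha> i) else {(0, 0)})"
proof -
  consider "i = 0" | "i \<in> {1..k}" | "k + 1 \<le> i" by fastforce
  then show ?thesis
    using chain0_generic(2) chain0_line(2)[of i] chain0_origin(2)[of i] assms by cases auto
qed

lemma factor_counts: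
  assumes r: "r = k + 1 \<or> (\<Sum>i=1..m. \<beta> i) \<in> \<int> \<and> r = m + k - 1" and kr: "k < r"
  shows "card {i. i < r \<and> supp (chain0 i) (chain0 (Suc i)) = UNIV} = 1"
    "s \<in> {1..k} \<Longrightarrow> card {i. i < r \<and> supp (chain0 i) (chain0 (Suc i)) = zero_set (\<alpha> s)} = 1"
    "card {i. i < r \<and> supp (chain0 i) (chain0 (Suc i)) = {(0, 0)}} = r - (k + 1)"
proof -
  note eq = supp_chain0[OF _ r]
  have z: "zero_set (\<alpha> i) \<noteq> UNIV" "zero_set (\<alpha> i) \<noteq> {(0, 0)}" if "i \<noteq> 0" "i \<le> k" for i
    using zero_set_props[of i] that km by auto
  have "supp (chain0 i) (chain0 (Suc i)) = UNIV \<longleftrightarrow> i = 0" if "i < r" for i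
    unfolding eq[OF that] using z(1)[of i] UNIV_neq_origin by metis
  then have "{i. i < r \<and> supp (chain0 i) (chain0 (Suc i)) = UNIV} = {0}" using kr by auto
  then show "card {i. i < r \<and> supp (chain0 i) (chain0 (Suc i)) = UNIV} = 1" by simp
  show "card {i. i < r \<and> supp (chain0 i) (chain0 (Suc i)) = zero_set (\<alpha> s)} = 1" if s: "s \<in> {1..k}"
  proof -
    have "i = s" if "zero_set (\<alpha> i) = zero_set (\<alpha> s)" "i \<noteq> 0" "i \<le> k" for i
      using zero_set_props(3)[of i s] that s km by auto
    moreover have "s \<noteq> 0" "s \<le> k" using s by auto
    ultimately have "supp (chain0 i) (chain0 (Suc i)) = zero_set (\<alpha> s) \<longleftrightarrow> i = s" if "i < r" for i
      unfolding eq[OF that] using z[of s] by metis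
    then have "{i. i < r \<and> supp (chain0 i) (chain0 (Suc i)) = zero_set (\<alpha> s)} = {i. i < r \<and> i = s}"
      by (intro Collect_cong conj_cong refl)
    also have "\<dots> = {s}" using kr \<open>s \<le> k\<close> by auto
    finally show ?thesis by simp
  qed
  have "supp (chain0 i) (chain0 (Suc i)) = {(0, 0)} \<longleftrightarrow> k < i" if "i < r" for i
    unfolding eq[OF that] using z(2)[of i] UNIV_neq_origin by (metis not_less_zero not_le)
  then have "{i. i < r \<and> supp (chain0 i) (chain0 (Suc i)) = {(0, 0)}} = {i. i < r \<and> k < i}"
    by (intro Collect_cong conj_cong refl)
  also have "\<dots> = {k+1..<r}" by auto
  finally show "card {i. i < r \<and> supp (chain0 i) (chain0 (Suc i)) = {(0, 0)}} = r - (k + 1)" by simp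
qed

end

theorem theorem5p2:
  fixes k m :: nat and \<alpha> :: "nat \<Rightarrow> poly_xy" and \<beta> :: "nat \<Rightarrow> complex"
  assumes "1 \<le> k" and "k < m"
    and "\<And>i. i \<in> {1..m} \<Longrightarrow> linear_form (\<alpha> i)"
    and "\<And>i j. i \<in> {1..m} \<Longrightarrow> j \<in> {1..m} \<Longrightarrow> i \<noteq> j \<Longrightarrow> lin_indep2 (\<alpha> i) (\<alpha> j)"
    and "\<And>i. i \<in> {1..k} \<Longrightarrow> \<beta> i \<in> \<int>"
    and "\<And>i. i \<in> {k+1..m} \<Longrightarrow> \<beta> i \<notin> \<int>"
  shows
    "((\<Sum>i=1..m. \<beta> i) \<notin> \<int> \<longrightarrow>
        finite_length A2 (M_mod m \<alpha> \<beta>) \<and>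
        num_factors A2 (M_mod m \<alpha> \<beta>) = k + 1 \<and>
        (\<forall>C r. composition_series A2 (M_mod m \<alpha> \<beta>) C r \<longrightarrow>
          num_factors_with_support (M_mod m \<alpha> \<beta>) C r UNIV = 1 \<and>
          (\<forall>s\<in>{1..k}. num_factors_with_support (M_mod m \<alpha> \<beta>) C r (zero_set (\<alpha> s)) = 1) \<and>
          num_factors_with_support (M_mod m \<alpha> \<beta>) C r {(0, 0)} = 0)) \<and>
     ((\<Sum>i=1..m. \<beta> i) \<in> \<int> \<longrightarrow>
        m - k \<ge> 2 \<and>
        finite_length A2 (M_mod m \<alpha> \<beta>) \<and>
        num_factors A2 (M_mod m \<alpha> \<beta>) = m + k - 1 \<and>
        (\<forall>C r. composition_series A2 (M_mod m \<alpha> \<beta>) C r \<longrightarrow>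
          num_factors_with_support (M_mod m \<alpha> \<beta>) C r UNIV = 1 \<and>
          (\<forall>s\<in>{1..k}. num_factors_with_support (M_mod m \<alpha> \<beta>) C r (zero_set (\<alpha> s)) = 1) \<and>
          num_factors_with_support (M_mod m \<alpha> \<beta>) C r {(0, 0)} = m - 2))"
proof -
  interpret arrangement k m \<alpha> \<beta> by unfold_locales (fact assms)+
  show ?thesis
  proof (intro conjI impI allI ballI)
    assume S: "(\<Sum>i=1..m. \<beta> i) \<notin> \<int>"
    note inv = composition_series_invariants[OF chain_nonint[OF S]]
    have kr: "k < k + 1" by simp
    note cnt = factor_counts[OF disjI1[OF refl] kr]
    show "finite_length A2 MM" "num_factors A2 MM = k + 1" by (rule inv)+
    fix C r assume C: "composition_series A2 MM C r"
    show "num_factors_with_support MM C r UNIV = 1" unfolding inv(3)[OF C] by (rule cnt)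
    show "num_factors_with_support MM C r (zero_set (\<alpha> s)) = 1" if "s \<in> {1..k}" for s
      unfolding inv(3)[OF C] by (rule cnt(2)[OF that])
    show "num_factors_with_support MM C r {(0, 0)} = 0" unfolding inv(3)[OF C] cnt(3) by simp
  next
    assume S: "(\<Sum>i=1..m. \<beta> i) \<in> \<int>"
    show mk: "m - k \<ge> 2" by (rule two_nonint[OF S])
    note inv = composition_series_invariants[OF chain_int[OF S]]
    have kr: "k < m + k - 1" using mk by simp
    note cnt = factor_counts[OF disjI2[OF conjI[OF S refl]] kr]
    show "finite_length A2 MM" "num_factors A2 MM = m + k - 1" by (rule inv)+
    fix C r assume C: "composition_series A2 MM C r"
    show "num_factors_with_support MM C r UNIV = 1" unfolding inv(3)[OF C] by (rule cnt)
    show "num_factors_with_support MM C r (zero_set (\<alpha> s)) = 1" if "s \<in> {1..k}" for s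
      unfolding inv(3)[OF C] by (rule cnt(2)[OF that])
    show "num_factors_with_support MM C r {(0, 0)} = m - 2" unfolding inv(3)[OF C] cnt(3) by simp
  qed
qed

end
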